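(* Random instances of 3-SAT with density greater than $4.419$ have no non-trivial cores with high probability. That is: for every fixed $\alpha>4.419$, if $F_n$ is a random 3-SAT formula on $n$ boolean variables with $\lfloor\alpha n\rfloor$ clauses, then the probability that $F_n$ has a non-trivial core tends to $0$ as $n\to\infty$.
   Context: Random 3-SAT with density $\alpha$: the formula has $\lfloor\alpha n\rfloor$ clauses drawn independently and uniformly from the $8\binom n3$ clauses consisting of three literals on three distinct variables of an $n$-element variable set $X$. Valuations are maps $X\to\{0,1,*\}$. Under a valuation, a literal is starred if its variable has value $*$; it is true if its variable has value $1$ and the literal is positive, or its variable has value $0$ and the literal is negative. A valuation is valid for $F$ iff each clause contains at least one true literal or at least two starred literals. A boolean solution is a valid valuation with all values in $\{0,1\}$ (i.e. an ordinary satisfying assignment). A variable $x$ is starrable in a valid valuation $\sigma$ if $\sigma(x)\ne *$ and the valuation obtained from $\sigma$ by changing the value of $x$ to $*$ is valid. A core of $F$ is any valuation obtained as follows: start from a boolean solution of $F$; as long as there is a starrable variable in the current valuation, choose one and change its value to $*$; stop when there is no starrable variable. A core is non-trivial if its set of non-starred variables (variables with value $\neq *$) is nonempty. *)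

theory Defs
  imports "HOL-Probability.Probability"
begin

datatype 'v literal = Pos (var: 'v) | Neg (var: 'v)

type_synonym 'v clause = "'v literal set"

definition clauses3 :: "'v set \<Rightarrow> 'v clause set" where
  "clauses3 X = {C. card C = 3 \<and> inj_on var C \<and> var ` C \<subseteq> X}"

lemma card_clauses3:
  assumes X: "finite X"
  shows "card (clauses3 X) = 8 * (card X choose 3)"
proof -
  define lit :: "'a \<Rightarrow> bool \<Rightarrow> 'a literal" where "lit v b = (if b then Pos v else Neg v)" for v b
  define f where "f = (\<lambda>(V, s). (\<lambda>v. lit v (s v)) ` V)"
  define S where "S = (SIGMA V:{V. V \<subseteq> X \<and> card V = 3}. V \<rightarrow>\<^sub>E (UNIV :: bool set))"
  have lit [simp]: "var (lit v b) = v" "lit v b = lit w c \<longleftrightarrow> v = w \<and> b = c" for v w b c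
    by (auto simp: lit_def)
  have var_f: "var ` f (V, s) = V" for V s
    by (auto simp: f_def image_image)
  have "bij_betw f S (clauses3 X)"
  proof (intro bij_betw_imageI inj_onI equalityI subsetI)
    fix p q assume p: "p \<in> S" and q: "q \<in> S" and eq: "f p = f q"
    obtain V s W t where [simp]: "p = (V, s)" "q = (W, t)" by (metis surj_pair)
    have [simp]: "W = V" using eq var_f by (metis \<open>p = (V, s)\<close> \<open>q = (W, t)\<close>)
    have "s v = t v" if "v \<in> V" for v
    proof -
      have "lit v (s v) \<in> f q" using that eq[symmetric] by (auto simp: f_def)
      then show ?thesis by (auto simp: f_def)
    qed
    then show "p = q" using p q by (auto simp: S_def intro: PiE_ext)
  next
    fix C assume "C \<in> f ` S"
    then obtain V s where C: "C = f (V, s)" "V \<subseteq> X" "card V = 3" by (auto simp: S_def)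
    have "card C = 3"
      using C by (auto simp: f_def card_image inj_on_def)
    moreover have "inj_on var C" using C by (auto simp: f_def inj_on_def)
    ultimately show "C \<in> clauses3 X" using C var_f by (auto simp: clauses3_def)
  next
    fix C assume C: "C \<in> clauses3 X"
    let ?V = "var ` C"
    let ?s = "restrict (\<lambda>v. Pos v \<in> C) ?V"
    have "lit (var l) (Pos (var l) \<in> C) = l" if "l \<in> C" for l
    proof (cases "Pos (var l) \<in> C")
      case True
      then have "Pos (var l) = l"
        using C that by (intro inj_onD[of var C]) (auto simp: clauses3_def)
      then show ?thesis using True by (simp add: lit_def)
    next
      case False
      then show ?thesis using that by (cases l) (auto simp: lit_def)
    qed
    then have "f (?V, ?s) = C" by (auto simp: f_def image_image)
    moreover have "(?V, ?s) \<in> S"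
      using C by (auto simp: S_def clauses3_def card_image)
    ultimately show "C \<in> f ` S" by (metis imageI)
  qed
  then have "card (clauses3 X) = card S" by (simp add: bij_betw_same_card)
  also have "\<dots> = (\<Sum>V | V \<subseteq> X \<and> card V = 3. card (V \<rightarrow>\<^sub>E (UNIV :: bool set)))"
    unfolding S_def using X
    by (intro card_SigmaI ballI finite_PiE) (auto dest: finite_subset)
  also have "\<dots> = (\<Sum>V | V \<subseteq> X \<and> card V = 3. 8)"
    using X by (intro sum.cong refl) (auto simp: card_PiE dest: finite_subset)
  also have "\<dots> = 8 * (card X choose 3)" using X by (simp add: n_subsets)
  finally show ?thesis .
qed

(* A formula is a list of clauses, so repeated clauses are allowed.  For n < 3 there are no
   clauses and the distribution below is unspecified. *)
definition random_3sat :: "nat \<Rightarrow> nat \<Rightarrow> nat clause list pmf" where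
  "random_3sat n m = replicate_pmf m (pmf_of_set (clauses3 {..<n}))"

datatype tval = Zero | One | Star

(* Valuations are extensional functions, so their values outside X carry no information. *)
definition valuations :: "'v set \<Rightarrow> ('v \<Rightarrow> tval) set" where
  "valuations X = X \<rightarrow>\<^sub>E UNIV"

definition starred_lit :: "('v \<Rightarrow> tval) \<Rightarrow> 'v literal \<Rightarrow> bool" where
  "starred_lit \<sigma> l \<longleftrightarrow> \<sigma> (var l) = Star"

fun true_lit :: "('v \<Rightarrow> tval) \<Rightarrow> 'v literal \<Rightarrow> bool" where
  "true_lit \<sigma> (Pos x) \<longleftrightarrow> \<sigma> x = One"
| "true_lit \<sigma> (Neg x) \<longleftrightarrow> \<sigma> x = Zero"

definition valid :: "'v set \<Rightarrow> 'v clause list \<Rightarrow> ('v \<Rightarrow> tval) \<Rightarrow> bool" where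
  "valid X F \<sigma> \<longleftrightarrow> \<sigma> \<in> valuations X \<and>
     (\<forall>C\<in>set F. (\<exists>l\<in>C. true_lit \<sigma> l) \<or> card {l\<in>C. starred_lit \<sigma> l} \<ge> 2)"

definition boolean_solution :: "'v set \<Rightarrow> 'v clause list \<Rightarrow> ('v \<Rightarrow> tval) \<Rightarrow> bool" where
  "boolean_solution X F \<sigma> \<longleftrightarrow> valid X F \<sigma> \<and> (\<forall>x\<in>X. \<sigma> x \<in> {Zero, One})"

definition starrable :: "'v set \<Rightarrow> 'v clause list \<Rightarrow> ('v \<Rightarrow> tval) \<Rightarrow> 'v \<Rightarrow> bool" where
  "starrable X F \<sigma> x \<longleftrightarrow> valid X F \<sigma> \<and> x \<in> X \<and> \<sigma> x \<noteq> Star \<and> valid X F (\<sigma>(x := Star))"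

definition star_step :: "'v set \<Rightarrow> 'v clause list \<Rightarrow> ('v \<Rightarrow> tval) \<Rightarrow> ('v \<Rightarrow> tval) \<Rightarrow> bool" where
  "star_step X F \<sigma> \<tau> \<longleftrightarrow> (\<exists>x. starrable X F \<sigma> x \<and> \<tau> = \<sigma>(x := Star))"

definition core :: "'v set \<Rightarrow> 'v clause list \<Rightarrow> ('v \<Rightarrow> tval) \<Rightarrow> bool" where
  "core X F \<sigma> \<longleftrightarrow>
     (\<exists>\<sigma>\<^sub>0. boolean_solution X F \<sigma>\<^sub>0 \<and> (star_step X F)\<^sup>*\<^sup>* \<sigma>\<^sub>0 \<sigma>) \<and> (\<nexists>x. starrable X F \<sigma> x)"

definition nontrivial_core :: "'v set \<Rightarrow> 'v clause list \<Rightarrow> ('v \<Rightarrow> tval) \<Rightarrow> bool" where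
  "nontrivial_core X F \<sigma> \<longleftrightarrow> core X F \<sigma> \<and> {x\<in>X. \<sigma> x \<noteq> Star} \<noteq> {}"

end

theory Submission imports Defs "HOL-Real_Asymp.Real_Asymp" begin

text \<open>
  Let \<open>A\<close> be the set of non-starred variables of a core and \<open>g\<close> a solution extending it; then
  every \<open>x \<in> A\<close> is the only true literal of some clause inside \<open>A\<close> (a cover).  Counting covers
  alone does not reach the density 4.419.  So fix for each \<open>A\<close> a set \<open>T\<close> of \<open>D\<close> starred
  variables, with \<open>D\<close> depending on \<open>|A|\<close> only, and choose \<open>g\<close> with the most true variables on
  \<open>T\<close>.  Let \<open>T \<union> R\<close> be the set of starred variables that unit propagation reaches from the
  values of \<open>g\<close> on \<open>A \<union> T\<close>.  Every \<open>x \<in> R\<close> is the only true literal of a clause inside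
  \<open>A \<union> T \<union> R\<close>, and by maximality every false \<open>x \<in> T\<close> is the only true literal of some
  clause.  Outside \<open>A \<union> T \<union> R\<close>, \<open>g\<close> may be replaced by a canonical solution of the clauses
  that have no true literal in \<open>A \<union> T \<union> R\<close>; the event (a frame) then depends on the values of
  \<open>g\<close> on \<open>A \<union> T \<union> R\<close> only.

  Poissonization bounds the probability of a frame by a product, and a union bound over
  \<open>A\<close>, \<open>R\<close> and the values leaves an exponential rate in \<open>a = |A| / n\<close>,
  \<open>d = D / n\<close> and \<open>u = |T \<union> R| / n\<close>.  Tangent bounds for \<open>exp\<close> turn the rate on a small box
  into a cubic polynomial, and integer arithmetic over a finite list of boxes shows that it is
  negative.  Covers with \<open>a \<le> 0.06\<close> are excluded by \<open>D = 0\<close> alone.  For densities above 4.7 the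
  case \<open>A = {}\<close>, \<open>D = n\<close> shows that the formula has no solution at all.
\<close>

section \<open>Covers, propagation and frames\<close>

text \<open>Every choice in the union bound has a price, and this shapes the construction. The set
  \<open>T\<close> is a function of \<open>A\<close>, so it is free. A false variable of
  \<open>T\<close> needs a witness clause, which has some probability \<open>q < 1\<close>, so each
  variable of \<open>T\<close> costs a factor \<open>1 + q\<close> instead of 2. Closing
  \<open>T\<close> under propagation adds the choice of \<open>R\<close>, but it forbids every
  clause that has no true literal on \<open>A \<union> T \<union> R\<close> and at most one variable
  outside. The witness of a variable of \<open>T\<close> may reach outside
  \<open>A \<union> T \<union> R\<close>, where summing over the values of \<open>g\<close> would
  cost a factor 2 per variable. The canonical solution avoids this sum because it is a function of
  the wild clauses alone. Witness clauses contain a true literal on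
  \<open>A \<union> T \<union> R\<close> and are never wild; given the wild clauses, the others are
  still independent, and the sets they have to hit have sizes that do not depend on the condition.
  The Poisson parameter is free. Taking it above the number of clauses compensates for the clauses
  that a frame forbids; the choice \<open>4.73 * n\<close> costs at most \<open>0.01046 * n\<close>
  in the exponent at densities from 4.419 to 4.7.\<close>

definition lit_true :: "('v \<Rightarrow> bool) \<Rightarrow> 'v literal \<Rightarrow> bool" where
  "lit_true g l = (case l of Pos x \<Rightarrow> g x | Neg x \<Rightarrow> \<not> g x)"

definition sat :: "('v \<Rightarrow> bool) \<Rightarrow> 'v clause \<Rightarrow> bool" where
  "sat g C \<longleftrightarrow> (\<exists>l\<in>C. lit_true g l)"

definition sole_true :: "('v \<Rightarrow> bool) \<Rightarrow> 'v \<Rightarrow> 'v clause \<Rightarrow> bool" where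
  "sole_true g x C \<longleftrightarrow> (\<exists>l\<in>C. var l = x \<and> lit_true g l \<and> (\<forall>l'\<in>C - {l}. \<not> lit_true g l'))"

text \<open>Only wild clauses restrict the values off \<open>B\<close>; every other clause already
  has a true literal on \<open>B\<close>. This separates the clauses that determine
  \<open>fill\<close> from those that can serve as witnesses.\<close>

definition wild :: "'v set \<Rightarrow> ('v \<Rightarrow> bool) \<Rightarrow> 'v clause \<Rightarrow> bool" where
  "wild B g C \<longleftrightarrow> (\<forall>l\<in>C. var l \<in> B \<longrightarrow> \<not> lit_true g l)"

text \<open>A true literal on \<open>A\<close> or two literals off \<open>A\<close>: this is
  validity of the core. The last line is added when \<open>B\<close> is closed under propagation: a
  satisfied clause without a true literal on \<open>A \<union> B\<close> has two variables outside,
  since a single one would have been propagated.\<close>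

definition admissible :: "'v set \<Rightarrow> 'v set \<Rightarrow> ('v \<Rightarrow> bool) \<Rightarrow> 'v clause \<Rightarrow> bool" where
  "admissible A B g C \<longleftrightarrow> (\<exists>l\<in>C. var l \<in> A \<and> lit_true g l) \<or>
     2 \<le> card {l\<in>C. var l \<notin> A} \<and>
     ((\<exists>l\<in>C. var l \<in> B \<and> lit_true g l) \<or> 2 \<le> card {l\<in>C. var l \<notin> A \<union> B})"

text \<open>Off \<open>B\<close> the values depend on the list \<open>ws\<close> only; they are arbitrary if \<open>ws\<close> has no solution
  there.\<close>

definition fill :: "'v set \<Rightarrow> ('v \<Rightarrow> bool) \<Rightarrow> 'v clause list \<Rightarrow> 'v \<Rightarrow> bool" where
  "fill B g ws x = (if x \<in> B then g x
     else (SOME h. \<forall>C\<in>set ws. \<exists>l\<in>C. var l \<notin> B \<and> lit_true h l) x)"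

text \<open>The witnesses of \<open>A\<close> and \<open>R\<close> lie inside
  \<open>A \<union> B\<close>, where \<open>g\<close> equals \<open>b\<close>; only the witnesses of
  \<open>T\<close> see the filled values.\<close>

definition frame :: "'v clause list \<Rightarrow> 'v set \<Rightarrow> 'v set \<Rightarrow> 'v set \<Rightarrow> ('v \<Rightarrow> bool) \<Rightarrow> bool" where
  "frame F A T R b \<longleftrightarrow> (let B = T \<union> R; g = fill (A \<union> B) b (filter (wild (A \<union> B) b) F) in
     (\<forall>C\<in>set F. admissible A B b C) \<and>
     (\<forall>x\<in>A. \<exists>C\<in>set F. sole_true g x C \<and> var ` C \<subseteq> A) \<and>
     (\<forall>x\<in>R. \<exists>C\<in>set F. sole_true g x C \<and> var ` C \<subseteq> A \<union> B) \<and>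
     (\<forall>x\<in>T. \<not> b x \<longrightarrow> (\<exists>C\<in>set F. sole_true g x C)))"

text \<open>The middle condition is validity of the valuation that is starred off \<open>A\<close>,
  the last one says that nothing in \<open>A\<close> can be starred. The way in which the core was
  reached is forgotten; only an extension to a solution is kept.\<close>

definition cover :: "'v clause list \<Rightarrow> 'v set \<Rightarrow> ('v \<Rightarrow> bool) \<Rightarrow> bool" where
  "cover F A g \<longleftrightarrow> (\<forall>C\<in>set F. sat g C) \<and>
     (\<forall>C\<in>set F. (\<exists>l\<in>C. var l \<in> A \<and> lit_true g l) \<or> 2 \<le> card {l\<in>C. var l \<notin> A}) \<and>
     (\<forall>x\<in>A. \<exists>C\<in>set F. sole_true g x C \<and> var ` C \<subseteq> A)"

lemma lit_true_cong: "g (var l) = h (var l) \<Longrightarrow> lit_true g l = lit_true h l"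
  by (cases l) (auto simp: lit_true_def)

lemma core_steps:
  assumes "(star_step X F)\<^sup>*\<^sup>* \<sigma>\<^sub>0 \<sigma>" "valid X F \<sigma>\<^sub>0"
  shows "valid X F \<sigma> \<and> (\<forall>x. \<sigma> x = \<sigma>\<^sub>0 x \<or> \<sigma> x = Star)"
  using assms
proof (induction rule: rtranclp_induct)
  case (step \<tau> \<upsilon>)
  then obtain x where "valid X F (\<tau>(x := Star))" "\<upsilon> = \<tau>(x := Star)"
    by (auto simp: star_step_def starrable_def)
  moreover have "\<forall>y. \<tau> y = \<sigma>\<^sub>0 y \<or> \<tau> y = Star" using step by blast
  ultimately have "\<forall>y. \<upsilon> y = \<sigma>\<^sub>0 y \<or> \<upsilon> y = Star" by simp
  moreover have "valid X F \<upsilon>" using \<open>valid X F (\<tau>(x := Star))\<close> \<open>\<upsilon> = \<tau>(x := Star)\<close> by simp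
  ultimately show ?case by blast
qed simp

text \<open>Starring only erases values, so the initial solution extends the core. If
  \<open>x\<close> is not starrable, starring it breaks a clause. The literal on \<open>x\<close>
  was its only true one, and no other literal is starred, since together with \<open>x\<close> that
  would make two stars.\<close>

lemma core_cover:
  assumes core: "nontrivial_core X F \<sigma>" and F: "set F \<subseteq> clauses3 X"
  obtains A g where "A \<noteq> {}" "A \<subseteq> X" "cover F A g"
proof -
  define A where "A = {x\<in>X. \<sigma> x \<noteq> Star}"
  from core obtain \<sigma>\<^sub>0 where s0: "boolean_solution X F \<sigma>\<^sub>0" "(star_step X F)\<^sup>*\<^sup>* \<sigma>\<^sub>0 \<sigma>"
    and ns: "\<nexists>x. starrable X F \<sigma> x" and ne: "A \<noteq> {}"
    by (auto simp: nontrivial_core_def core_def A_def)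
  have v: "valid X F \<sigma>" and ag: "\<And>x. \<sigma> x = \<sigma>\<^sub>0 x \<or> \<sigma> x = Star"
    using core_steps[OF s0(2)] s0(1) by (auto simp: boolean_solution_def)
  define g where "g x = (\<sigma>\<^sub>0 x = One)" for x
  have b0: "\<sigma>\<^sub>0 x = Zero \<or> \<sigma>\<^sub>0 x = One" if "x \<in> X" for x
    using s0(1) that by (auto simp: boolean_solution_def)
  have t0: "true_lit \<sigma>\<^sub>0 l \<longleftrightarrow> lit_true g l" if "var l \<in> X" for l
    using b0[OF that] by (cases l) (auto simp: lit_true_def g_def)
  have t: "true_lit \<sigma> l \<longleftrightarrow> var l \<in> A \<and> lit_true g l" if "var l \<in> X" for l
    using b0[OF that] ag[of "var l"] that by (cases l) (auto simp: lit_true_def g_def A_def)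
  have st: "starred_lit \<sigma> l \<longleftrightarrow> var l \<notin> A" if "var l \<in> X" for l
    using that by (auto simp: starred_lit_def A_def)
  have vX: "var l \<in> X" if "C \<in> set F" "l \<in> C" for C l
    using F that by (auto simp: clauses3_def)
  have fin: "finite C" if "C \<in> set F" for C
    by (rule card_ge_0_finite) (use subsetD[OF F that] in \<open>simp add: clauses3_def\<close>)
  have "\<exists>l\<in>C. lit_true g l" if C: "C \<in> set F" for C
  proof -
    have "{l\<in>C. starred_lit \<sigma>\<^sub>0 l} = {}"
      using vX[OF C] b0 by (force simp: starred_lit_def)
    moreover have "(\<exists>l\<in>C. true_lit \<sigma>\<^sub>0 l) \<or> 2 \<le> card {l\<in>C. starred_lit \<sigma>\<^sub>0 l}"
      using s0(1) C by (simp add: boolean_solution_def valid_def)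
    ultimately have "\<exists>l\<in>C. true_lit \<sigma>\<^sub>0 l" by (simp only: card.empty) auto
    then show ?thesis using t0 vX[OF C] by blast
  qed
  moreover have "(\<exists>l\<in>C. var l \<in> A \<and> lit_true g l) \<or> 2 \<le> card {l\<in>C. var l \<notin> A}"
    if C: "C \<in> set F" for C
  proof -
    have "{l\<in>C. starred_lit \<sigma> l} = {l\<in>C. var l \<notin> A}" using st vX[OF C] by blast
    moreover have "(\<exists>l\<in>C. true_lit \<sigma> l) \<or> 2 \<le> card {l\<in>C. starred_lit \<sigma> l}"
      using v C by (simp add: valid_def)
    moreover have "\<And>l. l \<in> C \<Longrightarrow> true_lit \<sigma> l \<Longrightarrow> var l \<in> A \<and> lit_true g l" using t vX[OF C] by blast
    ultimately show ?thesis by (simp, blast)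
  qed
  moreover have "\<exists>C\<in>set F. sole_true g x C \<and> var ` C \<subseteq> A" if x: "x \<in> A" for x
  proof -
    let ?\<tau> = "\<sigma>(x := Star)"
    have "\<not> valid X F ?\<tau>" using ns v x by (auto simp: starrable_def A_def)
    moreover have "?\<tau> \<in> valuations X"
      using v x by (auto simp: valid_def valuations_def A_def PiE_iff extensional_def)
    ultimately obtain C where C: "C \<in> set F" and nt: "\<not> (\<exists>l\<in>C. true_lit ?\<tau> l)"
      and c2: "\<not> card {l\<in>C. starred_lit ?\<tau> l} \<ge> 2"
      by (auto simp: valid_def)
    \<comment> \<open>Starring \<open>x\<close> can only add starred literals, so \<open>C\<close>
      did not have two of them before and must have had a true literal.\<close>
    have "card {l\<in>C. starred_lit \<sigma> l} \<le> card {l\<in>C. starred_lit ?\<tau> l}"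
      using fin[OF C] by (intro card_mono) (auto simp: starred_lit_def)
    then have "\<not> 2 \<le> card {l\<in>C. starred_lit \<sigma> l}" using c2 by linarith
    then obtain l where l: "l \<in> C" "true_lit \<sigma> l" using v C by (auto simp: valid_def)
    have lx: "var l = x"
    proof (rule ccontr)
      assume "var l \<noteq> x"
      then have "true_lit ?\<tau> l" using l(2) by (cases l) auto
      then show False using nt l(1) by blast
    qed
    have others: "var l' \<in> A \<and> \<not> lit_true g l'" if l': "l' \<in> C - {l}" for l'
    proof -
      have "\<not> starred_lit ?\<tau> l'"
      proof
        assume "starred_lit ?\<tau> l'"
        then have "{l, l'} \<subseteq> {l\<in>C. starred_lit ?\<tau> l}"
          using l l' lx by (auto simp: starred_lit_def)
        then have "card {l, l'} \<le> card {l\<in>C. starred_lit ?\<tau> l}"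
          using fin[OF C] by (intro card_mono) auto
        then show False using c2 l' by auto
      qed
      then have ne: "var l' \<noteq> x" and ns': "\<sigma> (var l') \<noteq> Star"
        by (auto simp: starred_lit_def split: if_splits)
      have "var l' \<in> A" using ns' vX[OF C] l' by (auto simp: A_def)
      moreover have "\<not> true_lit \<sigma> l'"
      proof
        assume "true_lit \<sigma> l'"
        then have "true_lit ?\<tau> l'" using ne by (cases l') auto
        then show False using nt l' by blast
      qed
      ultimately show ?thesis using t vX[OF C] l' by blast
    qed
    have "sole_true g x C" unfolding sole_true_def
      using l lx others t[of l] vX[OF C l(1)] by blast
    moreover have "var ` C \<subseteq> A" using others lx x by blast
    ultimately show ?thesis using C by blast
  qed
  ultimately have "cover F A g" by (auto simp: cover_def sat_def)
  then show thesis using that[of A g] ne by (auto simp: A_def)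
qed

text \<open>Only variables are recorded, not signs: if \<open>g\<close> satisfies the clause, the
  remaining literal is true under \<open>g\<close>, so propagation reproduces the values of
  \<open>g\<close>.\<close>

inductive_set propagated :: "'v clause list \<Rightarrow> 'v set \<Rightarrow> 'v set \<Rightarrow> ('v \<Rightarrow> bool) \<Rightarrow> 'v set"
  for F A T g where
  seed: "x \<in> T \<Longrightarrow> x \<in> propagated F A T g"
| unit: "C \<in> set F \<Longrightarrow> l \<in> C \<Longrightarrow> var l \<notin> A \<Longrightarrow>
    (\<And>l'. l' \<in> C - {l} \<Longrightarrow> \<not> lit_true g l' \<and> (var l' \<in> A \<or> var l' \<in> propagated F A T g)) \<Longrightarrow>
    var l \<in> propagated F A T g"

text \<open>The extremal solution \<open>b\<close> and the filled solution agree on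
  \<open>A \<union> B\<close>, so they have equally many true variables on \<open>T\<close>, and
  maximality passes from \<open>b\<close> to the filled solution, which is the one that needs
  witnesses. For \<open>T = {}\<close> propagation never starts: a clause of a cover without a true
  literal on \<open>A\<close> has two literals off \<open>A\<close>.\<close>

lemma cover_frame:
  assumes F: "set F \<subseteq> clauses3 X" and X: "finite X" and cov: "cover F A g"
    and T: "T \<subseteq> X - A" and A: "A \<subseteq> X"
  obtains R b where "R \<subseteq> X - A - T" "T = {} \<Longrightarrow> R = {}" "frame F A T R b"
proof -
  have vX: "var l \<in> X" if "C \<in> set F" "l \<in> C" for C l
    using F that by (auto simp: clauses3_def)
  have inj: "l = l'" if "C \<in> set F" "l \<in> C" "l' \<in> C" "var l = var l'" for C l l'
    using F that by (auto simp: clauses3_def inj_on_def)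
  have fin: "finite C" if "C \<in> set F" for C
    by (rule card_ge_0_finite) (use subsetD[OF F that] in \<open>simp add: clauses3_def\<close>)
  define Sol where "Sol = {h. (\<forall>C\<in>set F. sat h C) \<and> (\<forall>x\<in>A. h x = g x)}"
  define ones where "ones h = card {x\<in>T. h x}" for h
  have fT: "finite T" using T X finite_subset by blast
  have gS: "g \<in> Sol" using cov by (auto simp: Sol_def cover_def)
  have "\<exists>b. b \<in> Sol \<and> (\<forall>h. h \<in> Sol \<longrightarrow> ones h \<le> ones b)"
    by (rule ex_has_greatest_nat[of "\<lambda>h. h \<in> Sol" g ones "card T + 1", OF gS])
       (auto simp: ones_def less_Suc_eq_le intro!: card_mono fT)
  then obtain b where b: "b \<in> Sol" and max: "\<And>h. h \<in> Sol \<Longrightarrow> ones h \<le> ones b" by blast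
  have bA: "lit_true b l = lit_true g l" if "var l \<in> A" for l
    using b that by (intro lit_true_cong) (auto simp: Sol_def)
  have satb: "\<exists>l\<in>C. lit_true b l" if "C \<in> set F" for C using b that by (auto simp: Sol_def sat_def)
  define B where "B = propagated F A T b"
  define R where "R = B - T"
  have TB: "T \<subseteq> B" by (auto simp: B_def intro: propagated.seed)
  have Bsub: "B \<subseteq> X - A"
  proof
    fix x assume "x \<in> B"
    then show "x \<in> X - A" unfolding B_def
      by (induction rule: propagated.induct) (use T vX in auto)
  qed
  have BTR: "T \<union> R = B" using TB by (auto simp: R_def)
  have two: "(\<exists>l\<in>C. var l \<in> A \<and> lit_true b l) \<or> 2 \<le> card {l\<in>C. var l \<notin> A}" if C: "C \<in> set F" for C
    using cov C bA unfolding cover_def by metis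
  have emp: "B = {}" if T0: "T = {}"
  proof -
    have "x \<notin> B" for x
    proof
      assume "x \<in> B"
      then show False unfolding B_def
      proof (induction rule: propagated.induct)
        case (seed x) then show ?case using T0 by simp
      next
        case (unit C l)
        have "{l'\<in>C. var l' \<notin> A} \<subseteq> {l}" using unit by blast
        then have "card {l'\<in>C. var l' \<notin> A} \<le> 1" using card_mono[of "{l}"] by fastforce
        moreover have "\<not> (\<exists>l\<in>C. var l \<in> A \<and> lit_true b l)" using unit by blast
        ultimately show False using two[OF unit(1)] by auto
      qed
    qed
    then show ?thesis by blast
  qed
  define ws where "ws = filter (wild (A \<union> B) b) F"
  define P where "P h \<longleftrightarrow> (\<forall>C\<in>set ws. \<exists>l\<in>C. var l \<notin> A \<union> B \<and> lit_true h l)" for h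
  have "P b"
    using satb by (fastforce simp: P_def ws_def wild_def)
  \<comment> \<open>The same choice as inside \<open>fill\<close>; \<open>b\<close> itself shows
    that there is something to choose.\<close>
  define \<kappa> where "\<kappa> = (SOME h. P h)"
  have P\<kappa>: "P \<kappa>" using someI[of P, OF \<open>P b\<close>] by (simp add: \<kappa>_def)
  define G where "G = fill (A \<union> B) b ws"
  have GB: "G x = b x" if "x \<in> A \<union> B" for x using that by (simp add: G_def fill_def)
  have G\<kappa>: "G x = \<kappa> x" if "x \<notin> A \<union> B" for x
    using that by (simp add: G_def fill_def \<kappa>_def P_def[abs_def])
  have lGB: "lit_true G l = lit_true b l" if "var l \<in> A \<union> B" for l
    using GB[OF that] by (rule lit_true_cong)
  have GS: "G \<in> Sol"
  proof -
    have "sat G C" if C: "C \<in> set F" for C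
    proof (cases "wild (A \<union> B) b C")
      case True
      then obtain l where "l \<in> C" "var l \<notin> A \<union> B" "lit_true \<kappa> l"
        using P\<kappa> C by (auto simp: P_def ws_def)
      then show ?thesis using G\<kappa> lit_true_cong[of G l \<kappa>] by (auto simp: sat_def)
    next
      case False
      then show ?thesis using lGB by (auto simp: sat_def wild_def)
    qed
    moreover have "G x = g x" if "x \<in> A" for x using GB[of x] b that by (auto simp: Sol_def)
    ultimately show ?thesis by (auto simp: Sol_def)
  qed
  have "admissible A B b C" if C: "C \<in> set F" for C
  proof (cases "\<exists>l\<in>C. var l \<in> A \<and> lit_true b l")
    case nA: False
    have "2 \<le> card {l\<in>C. var l \<notin> A \<union> B}" if nB: "\<not> (\<exists>l\<in>C. var l \<in> B \<and> lit_true b l)"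
    proof -
      obtain l where l: "l \<in> C" "lit_true b l" using satb[OF C] by blast
      have lo: "var l \<notin> A \<union> B" using nA nB l by blast
      have "\<exists>l'\<in>C - {l}. var l' \<notin> A \<union> B"
      proof (rule ccontr)
        assume H: "\<not> ?thesis"
        \<comment> \<open>All other variables of \<open>C\<close> are in \<open>A \<union> B\<close>
          and no literal is true there, so \<open>C\<close> is a unit clause for
          \<open>var l\<close>.\<close>
        have "var l \<in> B" unfolding B_def
        proof (rule propagated.unit[OF C l(1)])
          show "var l \<notin> A" using lo by blast
          fix l' assume l': "l' \<in> C - {l}"
          then have "var l' \<in> A \<or> var l' \<in> B" using H by blast
          then show "\<not> lit_true b l' \<and> (var l' \<in> A \<or> var l' \<in> propagated F A T b)"
            using nA nB l' by (auto simp: B_def)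
        qed
        then show False using lo by blast
      qed
      then obtain l' where l': "l' \<in> C" "l' \<noteq> l" "var l' \<notin> A \<union> B" by blast
      have "card {l, l'} \<le> card {l\<in>C. var l \<notin> A \<union> B}"
        using l l' lo fin[OF C] by (intro card_mono) auto
      then show ?thesis using l'(2) by simp
    qed
    then show ?thesis using nA two[OF C] by (auto simp: admissible_def)
  qed (auto simp: admissible_def)
  moreover have "\<exists>C\<in>set F. sole_true G x C \<and> var ` C \<subseteq> A" if x: "x \<in> A" for x
  proof -
    obtain C where C: "C \<in> set F" "sole_true g x C" "var ` C \<subseteq> A" using cov x by (auto simp: cover_def)
    have "lit_true G l = lit_true g l" if "l \<in> C" for l
      using C(3) that bA lGB[of l] by blast
    then have "sole_true G x C" using C(2) by (auto simp: sole_true_def)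
    then show ?thesis using C by blast
  qed
  moreover have "\<exists>C\<in>set F. sole_true G x C \<and> var ` C \<subseteq> A \<union> B" if x: "x \<in> R" for x
  proof -
    have "x \<in> propagated F A T b" "x \<notin> T" using x by (auto simp: R_def B_def)
    then show ?thesis
    proof (cases rule: propagated.cases)
      case (unit C l)
      have o: "\<not> lit_true b l' \<and> var l' \<in> A \<union> B" if "l' \<in> C - {l}" for l'
        using unit(5)[OF that] by (auto simp: B_def)
      have tl: "lit_true b l" using satb[OF unit(2)] o by blast
      have lB: "var l \<in> B" using x unit(1) by (auto simp: R_def)
      have "sole_true G x C" unfolding sole_true_def
        using unit tl o lGB lB by (intro bexI[of _ l]) auto
      then show ?thesis using unit(2) o lB by blast
    qed simp
  qed
  moreover have "\<exists>C\<in>set F. sole_true G x C" if x: "x \<in> T" and nx: "\<not> b x" for x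
  proof -
    \<comment> \<open>Making \<open>x\<close> true gains one on \<open>T\<close> and therefore must
      falsify a clause. \<open>G\<close> satisfies this clause, so it does so through
      \<open>x\<close> alone.\<close>
    let ?H = "G(x := True)"
    have "x \<in> B" "x \<notin> A" using x TB T by auto
    have Gx: "\<not> G x" using GB[of x] nx \<open>x \<in> B\<close> by simp
    have "ones b < ones ?H" unfolding ones_def
    proof (rule psubset_card_mono)
      show "finite {x'\<in>T. ?H x'}" using fT by simp
      show "{x\<in>T. b x} \<subset> {x'\<in>T. ?H x'}" using x nx TB GB by fastforce
    qed
    then have "?H \<notin> Sol" using max by (meson linorder_not_less)
    moreover have "\<forall>y\<in>A. ?H y = g y" using GS \<open>x \<notin> A\<close> by (auto simp: Sol_def)
    ultimately obtain C where C: "C \<in> set F" "\<not> sat ?H C" by (auto simp: Sol_def)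
    obtain l where l: "l \<in> C" "lit_true G l" using GS C(1) by (auto simp: Sol_def sat_def)
    have lx: "var l = x"
    proof (rule ccontr)
      assume "var l \<noteq> x"
      then have "lit_true ?H l = lit_true G l" by (intro lit_true_cong) simp
      then show False using C(2) l by (auto simp: sat_def)
    qed
    have "\<not> lit_true G l'" if l': "l' \<in> C - {l}" for l'
    proof -
      have "var l' \<noteq> x" using inj[OF C(1) l(1), of l'] l' lx by auto
      then have "lit_true ?H l' = lit_true G l'" by (intro lit_true_cong) simp
      then show ?thesis using C(2) l' by (auto simp: sat_def)
    qed
    then have "sole_true G x C" using l lx by (auto simp: sole_true_def)
    then show ?thesis using C(1) by blast
  qed
  ultimately have "frame F A T R b"
    unfolding frame_def Let_def BTR by (auto simp: G_def ws_def)
  moreover have "R \<subseteq> X - A - T" using Bsub by (auto simp: R_def)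
  moreover have "T = {} \<Longrightarrow> R = {}" using emp by (auto simp: R_def)
  ultimately show thesis using that by blast
qed

section \<open>Words that hit prescribed sets of letters\<close>

definition words :: "'c set \<Rightarrow> nat \<Rightarrow> 'c list set" where
  "words \<Omega> m = {F. set F \<subseteq> \<Omega> \<and> length F = m}"

lemma words_0 [simp]: "words \<Omega> 0 = {[]}"
  by (auto simp: words_def)

lemma finite_words: "finite \<Omega> \<Longrightarrow> finite (words \<Omega> m)"
  unfolding words_def by (rule finite_lists_length_eq)

lemma card_words: "finite \<Omega> \<Longrightarrow> card (words \<Omega> m) = card \<Omega> ^ m"
  unfolding words_def by (rule card_lists_length_eq)

lemma words_Suc: "words \<Omega> (Suc m) = (\<lambda>(x, xs). x # xs) ` (\<Omega> \<times> words \<Omega> m)"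
  by (auto simp: words_def length_Suc_conv image_iff)

lemma sum_words_Suc:
  fixes f :: "'c list \<Rightarrow> real"
  shows "(\<Sum>F\<in>words \<Omega> (Suc m). f F) = (\<Sum>x\<in>\<Omega>. \<Sum>F\<in>words \<Omega> m. f (x # F))"
proof -
  have "(\<Sum>F\<in>words \<Omega> (Suc m). f F) = (\<Sum>(x, xs)\<in>\<Omega> \<times> words \<Omega> m. f (x # xs))"
    unfolding words_Suc by (subst sum.reindex) (auto simp: inj_on_def case_prod_unfold)
  then show ?thesis by (simp add: sum.cartesian_product)
qed

lemma replicate_pmf_of_set:
  assumes "finite \<Omega>" "\<Omega> \<noteq> {}"
  shows "replicate_pmf m (pmf_of_set \<Omega>) = pmf_of_set (words \<Omega> m)"
proof (induction m)
  case 0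
  show ?case by (simp add: pmf_of_set_singleton)
next
  case (Suc m)
  have ne: "words \<Omega> m \<noteq> {}" using assms card_words[OF assms(1), of m] by auto
  have "replicate_pmf (Suc m) (pmf_of_set \<Omega>)
      = map_pmf (\<lambda>(x, xs). x # xs) (pair_pmf (pmf_of_set \<Omega>) (pmf_of_set (words \<Omega> m)))"
    by (simp add: Suc pair_pmf_def map_bind_pmf map_pmf_def bind_assoc_pmf bind_return_pmf)
  also have "pair_pmf (pmf_of_set \<Omega>) (pmf_of_set (words \<Omega> m)) = pmf_of_set (\<Omega> \<times> words \<Omega> m)"
  proof (intro pmf_eqI)
    fix z show "pmf (pair_pmf (pmf_of_set \<Omega>) (pmf_of_set (words \<Omega> m))) z
        = pmf (pmf_of_set (\<Omega> \<times> words \<Omega> m)) z"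
    proof (cases z)
      case (Pair x xs)
      then show ?thesis
        using pmf_of_set[OF assms(2,1)] pmf_of_set[OF ne finite_words[OF assms(1)]]
          pmf_of_set[of "\<Omega> \<times> words \<Omega> m"] assms ne finite_words[OF assms(1), of m]
        by (simp add: pmf_pair indicator_def card_cartesian_product)
    qed
  qed
  also have "map_pmf (\<lambda>(x, xs). x # xs) \<dots> = pmf_of_set (words \<Omega> (Suc m))"
    unfolding words_Suc using assms ne finite_words[OF assms(1), of m]
    by (intro map_pmf_of_set_inj) (auto simp: inj_on_def)
  finally show ?case .
qed

lemma prob_replicate_pmf_of_set:
  assumes "finite \<Omega>" "\<Omega> \<noteq> {}"
  shows "measure_pmf.prob (replicate_pmf m (pmf_of_set \<Omega>)) E
    = (\<Sum>F\<in>words \<Omega> m. of_bool (F \<in> E)) / real (card \<Omega>) ^ m"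
proof -
  have ne: "words \<Omega> m \<noteq> {}" using assms card_words[OF assms(1), of m] by auto
  have "(\<Sum>F\<in>words \<Omega> m. of_bool (F \<in> E)) = real (card (words \<Omega> m \<inter> E))"
    using finite_words[OF assms(1), of m] by (simp add: Int_def)
  then show ?thesis
    using assms ne finite_words[OF assms(1), of m]
    by (simp add: replicate_pmf_of_set measure_pmf_of_set card_words)
qed

text \<open>The forbidden set may depend on the subword of wild letters, because it consists of
  tame letters and its size is fixed: conditionally on the wild subword the tame letters
  are still independent.\<close>

lemma count_avoiding:
  assumes fin: "finite \<Omega>" and sub: "W \<subseteq> L" "L \<subseteq> \<Omega>"
    and B: "\<And>ws. B ws \<subseteq> L - W" "\<And>ws. card (B ws) = \<beta>"
  shows "(\<Sum>F\<in>words \<Omega> m. of_bool (set F \<subseteq> L \<and> set F \<inter> B (filter (\<lambda>C. C \<in> W) F) = {}))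
    = (real (card L) - real \<beta>) ^ m"
  using B
proof (induction m arbitrary: B)
  case (Suc m)
  have finL: "finite L" "finite W"
    using finite_subset[OF sub(2) fin] finite_subset[OF sub(1)] by auto
  let ?P = "\<lambda>B F. set F \<subseteq> L \<and> set F \<inter> B (filter (\<lambda>C. C \<in> W) F) = {}"
  let ?c = "real (card L) - real \<beta>"
  \<comment> \<open>A wild head becomes a parameter of \<open>B\<close>, which the induction
    hypothesis allows to vary.\<close>
  have W: "(\<Sum>F\<in>words \<Omega> m. of_bool (?P B (x # F))) = ?c ^ m" if x: "x \<in> W" for x
  proof -
    have "?P B (x # F) = ?P (\<lambda>ws. B (x # ws)) F" for F
      using x sub Suc.prems(1) by auto
    then show ?thesis using Suc.IH[of "\<lambda>ws. B (x # ws)"] Suc.prems by simp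
  qed
  have card': "(\<Sum>x\<in>L - W. of_bool (x \<notin> B ws) :: real) = ?c - real (card W)" for ws
  proof -
    have "(\<Sum>x\<in>L - W. of_bool (x \<notin> B ws) :: real) = real (card ((L - W) - B ws))"
      using finL by (simp add: set_diff_eq Int_def)
    also have "\<dots> = real (card (L - W)) - real \<beta>"
    proof -
      have "finite (B ws)" using Suc.prems(1)[of ws] finL finite_subset by blast
      moreover have "\<beta> \<le> card (L - W)"
        using card_mono[of "L - W" "B ws"] Suc.prems finL by simp
      ultimately show ?thesis using Suc.prems by (simp add: card_Diff_subset of_nat_diff)
    qed
    finally show ?thesis using finL sub by (simp add: card_Diff_subset card_mono of_nat_diff)
  qed
  \<comment> \<open>A tame head does not enter the wild subword, and in front of every tail the same
    number of tame letters is allowed.\<close>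
  have LW: "(\<Sum>x\<in>L - W. \<Sum>F\<in>words \<Omega> m. of_bool (?P B (x # F))) = ?c ^ m * (?c - real (card W))"
  proof -
    have "(\<Sum>x\<in>L - W. \<Sum>F\<in>words \<Omega> m. of_bool (?P B (x # F)) :: real)
      = (\<Sum>x\<in>L - W. \<Sum>F\<in>words \<Omega> m.
          of_bool (?P B F) * of_bool (x \<notin> B (filter (\<lambda>C. C \<in> W) F)))"
      by (intro sum.cong refl) auto
    also have "\<dots> = (\<Sum>F\<in>words \<Omega> m. of_bool (?P B F) * (?c - real (card W)))"
      by (subst sum.swap) (simp only: sum_distrib_left[symmetric] card')
    also have "\<dots> = ?c ^ m * (?c - real (card W))"
      using Suc.IH[of B] Suc.prems by (simp add: sum_distrib_right[symmetric])
    finally show ?thesis .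
  qed
  have "(\<Sum>F\<in>words \<Omega> (Suc m). of_bool (?P B F) :: real)
      = (\<Sum>x\<in>L. \<Sum>F\<in>words \<Omega> m. of_bool (?P B (x # F)))"
    unfolding sum_words_Suc using fin sub by (intro sum.mono_neutral_right) auto
  also have "\<dots> = (\<Sum>x\<in>W. \<Sum>F\<in>words \<Omega> m. of_bool (?P B (x # F)))
      + (\<Sum>x\<in>L - W. \<Sum>F\<in>words \<Omega> m. of_bool (?P B (x # F)))"
    using finL sub by (subst sum.subset_diff[of W L]) auto
  also have "\<dots> = ?c ^ Suc m" using W LW by (simp add: algebra_simps)
  finally show ?case .
qed simp

text \<open>Inclusion-exclusion over the sets that are missed. Each term is an instance of
  \<open>count_avoiding\<close>, and disjointness turns the size of a union into a sum, so the count
  is the same as for sets that do not depend on the word.\<close>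

lemma count_hitting:
  assumes fin: "finite \<Omega>" and sub: "W \<subseteq> L" "L \<subseteq> \<Omega>" and I: "finite I"
    and S: "\<And>ws x. x \<in> I \<Longrightarrow> S ws x \<subseteq> L - W" "\<And>ws x. x \<in> I \<Longrightarrow> card (S ws x) = s x"
    and disj: "\<And>ws. disjoint_family_on (S ws) I"
  shows "(\<Sum>F\<in>words \<Omega> m. of_bool (set F \<subseteq> L \<and>
      (\<forall>x\<in>I. set F \<inter> S (filter (\<lambda>C. C \<in> W) F) x \<noteq> {})))
    = (\<Sum>J\<in>Pow I. (- 1) ^ card J * (real (card L) - (\<Sum>x\<in>J. real (s x))) ^ m)"
proof -
  let ?f = "\<lambda>F. filter (\<lambda>C. C \<in> W) F"
  have exp: "of_bool (\<forall>x\<in>I. P x) = (\<Sum>J\<in>Pow I. (- 1) ^ card J * of_bool (\<forall>x\<in>J. \<not> P x) :: real)" for P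
  proof -
    have "of_bool (\<forall>x\<in>I. P x) = (\<Prod>x\<in>I. - of_bool (\<not> P x) + 1 :: real)"
      using I by (induction I rule: finite_induct) auto
    also have "\<dots> = (\<Sum>J\<in>Pow I. (\<Prod>x\<in>J. - of_bool (\<not> P x)) * (\<Prod>x\<in>I - J. 1))"
      using I by (rule prod_add)
    also have "\<dots> = (\<Sum>J\<in>Pow I. (- 1) ^ card J * of_bool (\<forall>x\<in>J. \<not> P x))"
    proof (intro sum.cong refl)
      fix J assume "J \<in> Pow I"
      then have "finite J" using I finite_subset by blast
      then have "(\<Prod>x\<in>J. - of_bool (\<not> P x) :: real) = (- 1) ^ card J * of_bool (\<forall>x\<in>J. \<not> P x)"
        by (induction J rule: finite_induct) auto
      then show "(\<Prod>x\<in>J. - of_bool (\<not> P x)) * (\<Prod>x\<in>I - J. 1) = (- 1) ^ card J * (of_bool (\<forall>x\<in>J. \<not> P x) :: real)"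
        by simp
    qed
    finally show ?thesis .
  qed
  have "(\<Sum>F\<in>words \<Omega> m. of_bool (set F \<subseteq> L \<and> (\<forall>x\<in>I. set F \<inter> S (?f F) x \<noteq> {})) :: real)
    = (\<Sum>F\<in>words \<Omega> m. \<Sum>J\<in>Pow I. (- 1) ^ card J *
        of_bool (set F \<subseteq> L \<and> set F \<inter> (\<Union>x\<in>J. S (?f F) x) = {}))"
  proof (intro sum.cong refl)
    fix F
    have "of_bool (set F \<subseteq> L \<and> (\<forall>x\<in>I. set F \<inter> S (?f F) x \<noteq> {}))
      = of_bool (set F \<subseteq> L) * (of_bool (\<forall>x\<in>I. set F \<inter> S (?f F) x \<noteq> {}) :: real)"
      by simp
    also have "\<dots> = (\<Sum>J\<in>Pow I. of_bool (set F \<subseteq> L) *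
        ((- 1) ^ card J * of_bool (\<forall>x\<in>J. \<not> (set F \<inter> S (?f F) x \<noteq> {}))))"
      by (simp only: exp sum_distrib_left)
    also have "\<dots> = (\<Sum>J\<in>Pow I. (- 1) ^ card J *
        of_bool (set F \<subseteq> L \<and> set F \<inter> (\<Union>x\<in>J. S (?f F) x) = {}))"
      by (intro sum.cong refl) (auto simp: of_bool_def)
    finally show "of_bool (set F \<subseteq> L \<and> (\<forall>x\<in>I. set F \<inter> S (?f F) x \<noteq> {}))
      = (\<Sum>J\<in>Pow I. (- 1) ^ card J *
        (of_bool (set F \<subseteq> L \<and> set F \<inter> (\<Union>x\<in>J. S (?f F) x) = {}) :: real))" .
  qed
  also have "\<dots> = (\<Sum>J\<in>Pow I. (- 1) ^ card J * (\<Sum>F\<in>words \<Omega> m.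
        of_bool (set F \<subseteq> L \<and> set F \<inter> (\<Union>x\<in>J. S (?f F) x) = {})))"
    by (subst sum.swap) (simp only: sum_distrib_left)
  also have "\<dots> = (\<Sum>J\<in>Pow I. (- 1) ^ card J * (real (card L) - (\<Sum>x\<in>J. real (s x))) ^ m)"
  proof (intro sum.cong refl arg_cong2[where f = "(*)"])
    fix J assume J: "J \<in> Pow I"
    have "card (\<Union>x\<in>J. S ws x) = (\<Sum>x\<in>J. s x)" for ws
    proof -
      have fS: "finite (S ws x)" if "x \<in> J" for x
      proof (rule finite_subset[OF _ fin])
        show "S ws x \<subseteq> \<Omega>" using S(1)[of x ws] that J sub(2) by auto
      qed
      have "S ws i \<inter> S ws j = {}" if "i \<in> J" "j \<in> J" "i \<noteq> j" for i j
        using disj[of ws] J that unfolding disjoint_family_on_def by auto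
      moreover have "finite J" using J I finite_subset by auto
      ultimately have "card (\<Union>x\<in>J. S ws x) = (\<Sum>x\<in>J. card (S ws x))"
        using fS by (intro card_UN_disjoint) auto
      then show ?thesis using S(2) J by (simp add: subset_iff)
    qed
    moreover have "(\<Union>x\<in>J. S ws x) \<subseteq> L - W" for ws using S(1) J by blast
    ultimately show "(\<Sum>F\<in>words \<Omega> m. of_bool (set F \<subseteq> L \<and> set F \<inter> (\<Union>x\<in>J. S (?f F) x) = {}))
        = (real (card L) - (\<Sum>x\<in>J. real (s x))) ^ m"
      using count_avoiding[OF fin sub, of "\<lambda>ws. \<Union>x\<in>J. S ws x" "\<Sum>x\<in>J. s x" m] by simp
  qed
  finally show ?thesis .
qed

text \<open>Poissonization: the bound is one term of the exponential generating function.\<close>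

lemma prob_hitting_le:
  assumes fin: "finite \<Omega>" "\<Omega> \<noteq> {}" and sub: "W \<subseteq> L" "L \<subseteq> \<Omega>" and I: "finite I"
    and S: "\<And>ws x. x \<in> I \<Longrightarrow> S ws x \<subseteq> L - W" "\<And>ws x. x \<in> I \<Longrightarrow> card (S ws x) = s x"
    and disj: "\<And>ws. disjoint_family_on (S ws) I" and mu: "\<mu> > (0::real)"
  shows "measure_pmf.prob (replicate_pmf m (pmf_of_set \<Omega>)) {F. set F \<subseteq> L \<and>
      (\<forall>x\<in>I. set F \<inter> S (filter (\<lambda>C. C \<in> W) F) x \<noteq> {})}
    \<le> fact m / \<mu> ^ m * exp (\<mu> * (card L / card \<Omega>)) * (\<Prod>x\<in>I. 1 - exp (- (\<mu> * (s x / card \<Omega>))))"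
proof -
  define N where "N m = (\<Sum>F\<in>words \<Omega> m. of_bool (set F \<subseteq> L \<and>
      (\<forall>x\<in>I. set F \<inter> S (filter (\<lambda>C. C \<in> W) F) x \<noteq> {})) :: real)" for m
  define t where "t = \<mu> / card \<Omega>"
  have c0: "real (card \<Omega>) > 0" using fin by (simp add: card_gt_0_iff)
  have t: "t > 0" using mu c0 by (simp add: t_def)
  let ?q = "\<lambda>J. real (card L) - (\<Sum>x\<in>J. real (s x))"
  have N: "N j = (\<Sum>J\<in>Pow I. (- 1) ^ card J * ?q J ^ j)" for j
    unfolding N_def by (rule count_hitting[OF fin(1) sub I S disj])
  \<comment> \<open>Summing over all word lengths with weights \<open>t ^ j / fact j\<close> turns
    each power into an exponential, and then the alternating sum factors over
    \<open>I\<close>.\<close>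
  have "(\<lambda>j. \<Sum>J\<in>Pow I. (- 1) ^ card J * ((t * ?q J) ^ j / fact j))
      sums (\<Sum>J\<in>Pow I. (- 1) ^ card J * exp (t * ?q J))"
    using exp_converges[of "t * ?q _"]
    by (intro sums_sum sums_mult) (simp add: field_simps scaleR_conv_of_real)
  moreover have "(\<Sum>J\<in>Pow I. (- 1) ^ card J * ((t * ?q J) ^ j / fact j)) = t ^ j / fact j * N j" for j
    unfolding N sum_distrib_left by (intro sum.cong refl) (simp add: power_mult_distrib)
  ultimately have sums: "(\<lambda>j. t ^ j / fact j * N j) sums (\<Sum>J\<in>Pow I. (- 1) ^ card J * exp (t * ?q J))"
    by simp
  have pos: "0 \<le> t ^ j / fact j * N j" for j using t by (simp add: N_def sum_nonneg)
  have "(\<Sum>J\<in>Pow I. (- 1) ^ card J * exp (t * ?q J))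
      = exp (t * card L) * (\<Sum>J\<in>Pow I. (\<Prod>x\<in>J. - exp (- (t * s x))) * (\<Prod>x\<in>I - J. 1))"
    unfolding sum_distrib_left
  proof (intro sum.cong refl)
    fix J assume "J \<in> Pow I"
    then have "finite J" using I finite_subset by blast
    then have "(\<Prod>x\<in>J. - exp (- (t * s x))) = (- 1) ^ card J * exp (- (t * (\<Sum>x\<in>J. real (s x))))"
      by (induction J rule: finite_induct) (auto simp: exp_add[symmetric] algebra_simps)
    then show "(- 1) ^ card J * exp (t * ?q J)
        = exp (t * card L) * ((\<Prod>x\<in>J. - exp (- (t * s x))) * (\<Prod>x\<in>I - J. 1))"
      by (simp add: exp_add[symmetric] algebra_simps)
  qed
  also have "\<dots> = exp (t * card L) * (\<Prod>x\<in>I. - exp (- (t * s x)) + 1)"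
    using prod_add[OF I, of "\<lambda>x. - exp (- (t * s x))" "\<lambda>_. 1"] by simp
  finally have tot: "(\<lambda>j. t ^ j / fact j * N j) sums
      (exp (t * card L) * (\<Prod>x\<in>I. 1 - exp (- (t * s x))))" (is "_ sums ?T")
    using sums by simp
  have "t ^ m / fact m * N m \<le> ?T"
    using sum_le_suminf[OF sums_summable[OF tot], of "{m}"] pos sums_unique[OF tot] by simp
  then have Nm: "N m \<le> fact m / t ^ m * ?T"
    using t by (simp add: field_simps)
  have "measure_pmf.prob (replicate_pmf m (pmf_of_set \<Omega>)) {F. set F \<subseteq> L \<and>
      (\<forall>x\<in>I. set F \<inter> S (filter (\<lambda>C. C \<in> W) F) x \<noteq> {})} = N m / real (card \<Omega>) ^ m"
    unfolding prob_replicate_pmf_of_set[OF fin] N_def by simp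
  also have "\<dots> \<le> fact m / t ^ m * ?T / real (card \<Omega>) ^ m"
    by (rule divide_right_mono[OF Nm]) simp
  also have "\<dots> = fact m / \<mu> ^ m * ?T"
    using c0 mu by (simp add: t_def power_divide)
  finally show ?thesis by (simp add: t_def mult.assoc)
qed

section \<open>Probability of a frame\<close>

definition mk_lit :: "bool \<Rightarrow> 'v \<Rightarrow> 'v literal" where
  "mk_lit b x = (if b then Pos x else Neg x)"

definition false_clause :: "('v \<Rightarrow> bool) \<Rightarrow> 'v set \<Rightarrow> 'v clause" where
  "false_clause g Y = (\<lambda>x. mk_lit (\<not> g x) x) ` Y"

lemma var_mk_lit [simp]: "var (mk_lit b x) = x"
  by (simp add: mk_lit_def)

lemma lit_true_mk_lit [simp]: "lit_true g (mk_lit b x) \<longleftrightarrow> g x = b"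
  by (simp add: mk_lit_def lit_true_def)

lemma mk_lit_eq_iff [simp]: "mk_lit b x = mk_lit c y \<longleftrightarrow> b = c \<and> x = y"
  by (auto simp: mk_lit_def)

lemma mk_lit_false: "\<not> lit_true g l \<Longrightarrow> l = mk_lit (\<not> g (var l)) (var l)"
  by (cases l) (auto simp: mk_lit_def lit_true_def)

lemma mk_lit_true: "lit_true g l \<Longrightarrow> l = mk_lit (g (var l)) (var l)"
  by (cases l) (auto simp: mk_lit_def lit_true_def)

lemma var_false_clause [simp]: "var ` false_clause g Y = Y"
  by (auto simp: false_clause_def image_image)

lemma false_clause_false: "l \<in> false_clause g Y \<Longrightarrow> var l \<in> Y \<and> \<not> lit_true g l"
  by (auto simp: false_clause_def)

lemma card_false_clause [simp]: "card (false_clause g Y) = card Y"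
  unfolding false_clause_def by (intro card_image inj_onI) simp

lemma false_clause_inj: "false_clause g Y = false_clause g Z \<Longrightarrow> Y = Z"
  by (metis var_false_clause)

lemma insert_false_clause_inj:
  assumes "insert l (false_clause g Y) = insert l' (false_clause g Y')"
    and "var l \<notin> Y" "var l' \<notin> Y'" and "var l \<notin> Y'"
  shows "l = l' \<and> Y = Y'"
proof -
  have l: "l = l'" using assms(1,4) false_clause_false[of l g Y'] by blast
  have "insert (var l) Y = insert (var l') Y'"
    using arg_cong[OF assms(1), of "\<lambda>C. var ` C"] by simp
  then show ?thesis using l assms(2,3) by (metis insert_ident)
qed

lemma insert_false_clause_mem:
  assumes "finite Y" "card Y = 2" "Y \<subseteq> X" "var l \<in> X" "var l \<notin> Y"
  shows "insert l (false_clause g Y) \<in> clauses3 X"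
proof -
  have "l \<notin> false_clause g Y" using assms(5) false_clause_false by blast
  moreover have "finite (false_clause g Y)" using assms(1) by (simp add: false_clause_def)
  ultimately have "card (insert l (false_clause g Y)) = 3" using assms(2) by simp
  moreover have "inj_on var (insert l (false_clause g Y))"
    using assms(5) by (auto simp: inj_on_def false_clause_def)
  ultimately show ?thesis using assms by (simp add: clauses3_def)
qed

lemma false_clause_mem:
  assumes "card Y = 3" "Y \<subseteq> X"
  shows "false_clause g Y \<in> clauses3 X"
  using assms by (auto simp: clauses3_def inj_on_def false_clause_def card_image)

lemma finite_clauses3: "finite X \<Longrightarrow> finite (clauses3 X)"
proof -
  assume X: "finite X"
  have "clauses3 X \<subseteq> Pow (Pos ` X \<union> Neg ` X)"
  proof
    fix C assume C: "C \<in> clauses3 X"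
    have "l \<in> Pos ` X \<union> Neg ` X" if "l \<in> C" for l
    proof -
      have "var l \<in> X" using C that by (auto simp: clauses3_def)
      then show ?thesis by (cases l) auto
    qed
    then show "C \<in> Pow (Pos ` X \<union> Neg ` X)" by blast
  qed
  then show ?thesis using X finite_subset by blast
qed

lemma sole_true_unique: "sole_true g x C \<Longrightarrow> sole_true g y C \<Longrightarrow> x = y"
  by (auto simp: sole_true_def)

text \<open>Given \<open>g\<close>, such a clause has no freedom of sign: the literal on
  \<open>x\<close> is the true one and the other two are false. It is determined by its two further
  variables.\<close>

lemma card_sole_true_within:
  assumes X: "finite X" and Z: "Z \<subseteq> X" "x \<in> X" "x \<notin> Z"
  shows "card {C\<in>clauses3 X. sole_true g x C \<and> var ` C \<subseteq> insert x Z} = card Z choose 2"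
proof -
  let ?P = "{Y. Y \<subseteq> Z \<and> card Y = 2}"
  let ?f = "\<lambda>Y. insert (mk_lit (g x) x) (false_clause g Y)"
  have fZ: "finite Z" using X Z finite_subset by blast
  have "{C\<in>clauses3 X. sole_true g x C \<and> var ` C \<subseteq> insert x Z} = ?f ` ?P"
  proof (intro equalityI subsetI)
    fix C assume "C \<in> {C\<in>clauses3 X. sole_true g x C \<and> var ` C \<subseteq> insert x Z}"
    then have C: "C \<in> clauses3 X" "var ` C \<subseteq> insert x Z" and "sole_true g x C" by auto
    then obtain l where l: "l \<in> C" "var l = x" "lit_true g l" "\<And>l'. l' \<in> C - {l} \<Longrightarrow> \<not> lit_true g l'"
      by (auto simp: sole_true_def)
    let ?Y = "var ` (C - {l})"
    have inj: "inj_on var C" and c3: "card C = 3" using C by (auto simp: clauses3_def)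
    have fC: "finite C" by (rule card_ge_0_finite) (simp add: c3)
    have "x \<notin> ?Y" using inj l by (auto simp: inj_on_def)
    then have "?Y \<subseteq> Z" using C(2) by auto
    moreover have "card ?Y = 2"
      using inj c3 l(1) fC by (subst card_image) (auto intro: inj_on_diff)
    moreover have "C = ?f ?Y"
    proof -
      have "C - {l} = false_clause g ?Y"
        unfolding false_clause_def image_image using mk_lit_false[OF l(4)] by force
      moreover have "l = mk_lit (g x) x" using mk_lit_true[OF l(3)] l(2) by simp
      ultimately show ?thesis using l(1) by auto
    qed
    ultimately show "C \<in> ?f ` ?P" by blast
  next
    fix C assume "C \<in> ?f ` ?P"
    then obtain Y where Y: "Y \<subseteq> Z" "card Y = 2" and C: "C = ?f Y" by blast
    have "C \<in> clauses3 X" unfolding C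
      using Y Z fZ by (intro insert_false_clause_mem) (auto intro: finite_subset)
    moreover have "sole_true g x C" unfolding C sole_true_def
      using Y Z by (intro bexI[of _ "mk_lit (g x) x"]) (auto dest: false_clause_false)
    moreover have "var ` C \<subseteq> insert x Z" unfolding C using Y by auto
    ultimately show "C \<in> {C\<in>clauses3 X. sole_true g x C \<and> var ` C \<subseteq> insert x Z}" by blast
  qed
  moreover have "inj_on ?f ?P"
  proof (rule inj_onI)
    fix Y Y' assume "Y \<in> ?P" "Y' \<in> ?P" "?f Y = ?f Y'"
    then show "Y = Y'" using Z insert_false_clause_inj[of "mk_lit (g x) x" g Y "mk_lit (g x) x" Y'] by auto
  qed
  ultimately show ?thesis using n_subsets[OF fZ, of 2] by (simp add: card_image)
qed

text \<open>Used with \<open>Y = A\<close>: if the only true literal is on a variable off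
  \<open>A\<close> and the other two variables are in \<open>A\<close>, the clause has a single
  starred literal, so it is not admissible and cannot be a witness.\<close>

lemma card_sole_true_outside:
  assumes X: "finite X" and Z: "Y \<subseteq> Z" "Z \<subseteq> X" "x \<in> X" "x \<notin> Z"
  shows "card {C\<in>clauses3 X. sole_true g x C \<and> var ` C \<subseteq> insert x Z \<and> \<not> var ` C \<subseteq> insert x Y}
    = (card Z choose 2) - (card Y choose 2)"
proof -
  let ?S = "\<lambda>Z. {C\<in>clauses3 X. sole_true g x C \<and> var ` C \<subseteq> insert x Z}"
  have "{C\<in>clauses3 X. sole_true g x C \<and> var ` C \<subseteq> insert x Z \<and> \<not> var ` C \<subseteq> insert x Y} = ?S Z - ?S Y"
    by blast
  moreover have "?S Y \<subseteq> ?S Z" using Z by blast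
  moreover have "finite (?S Y)" using finite_clauses3[OF X] by simp
  ultimately show ?thesis
    using card_sole_true_within[OF X Z(2-4), of g]
      card_sole_true_within[OF X order.trans[OF Z(1,2)] Z(3) contra_subsetD[OF Z(1,4)], of g]
    by (simp add: card_Diff_subset)
qed

text \<open>Three disjoint families: three false literals on \<open>A \<union> B\<close>; two false
  ones on \<open>A\<close> and a true one on \<open>B\<close>, which leaves a single starred
  variable; two false ones on \<open>A \<union> B\<close> and a third literal outside, whose free
  sign gives the factor 2.\<close>

lemma card_inadmissible_ge:
  assumes X: "finite X" and AB: "A \<subseteq> X" "B \<subseteq> X" "A \<inter> B = {}"
  shows "(card A + card B choose 3) + (card A choose 2) * card B
      + 2 * (card X - card A - card B) * (card A + card B choose 2)
    \<le> card {C\<in>clauses3 X. \<not> admissible A B g C}"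
proof -
  have fin: "finite A" "finite B"
    using finite_subset[OF AB(1) X] finite_subset[OF AB(2) X] by auto
  let ?V = "X - (A \<union> B)"
  let ?pairs = "\<lambda>Z::'a set. {Y. Y \<subseteq> Z \<and> card Y = 2}"
  define B1 where "B1 = false_clause g ` {Y. Y \<subseteq> A \<union> B \<and> card Y = 3}"
  define B2 where "B2 = (\<lambda>(x, Y). insert (mk_lit (g x) x) (false_clause g Y)) ` (B \<times> ?pairs A)"
  define B3 where "B3 = (\<lambda>((b, x), Y). insert (mk_lit b x) (false_clause g Y)) ` ((UNIV \<times> ?V) \<times> ?pairs (A \<union> B))"
  have cAB: "card (A \<union> B) = card A + card B" using fin AB by (simp add: card_Un_disjoint)
  have c1: "card B1 = (card A + card B choose 3)"
    unfolding B1_def using n_subsets[of "A \<union> B" 3] fin cAB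
    by (subst card_image) (auto intro!: inj_onI dest: false_clause_inj)
  have c2: "card B2 = (card A choose 2) * card B"
  proof -
    have "inj_on (\<lambda>(x, Y). insert (mk_lit (g x) x) (false_clause g Y)) (B \<times> ?pairs A)"
    proof (rule inj_onI, clarify)
      fix x Y x' Y' assume "x \<in> B" "x' \<in> B" "Y \<subseteq> A" "Y' \<subseteq> A"
        and "insert (mk_lit (g x) x) (false_clause g Y) = insert (mk_lit (g x') x') (false_clause g Y')"
      moreover from this AB have "x \<notin> Y" "x' \<notin> Y'" "x \<notin> Y'" by auto
      ultimately show "x = x' \<and> Y = Y'"
        using insert_false_clause_inj[of "mk_lit (g x) x" g Y "mk_lit (g x') x'" Y'] by auto
    qed
    then show ?thesis unfolding B2_def using n_subsets[of A 2] fin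
      by (simp add: card_image card_cartesian_product)
  qed
  have c3: "card B3 = 2 * (card X - card A - card B) * (card A + card B choose 2)"
  proof -
    have "inj_on (\<lambda>((b, x), Y). insert (mk_lit b x) (false_clause g Y)) ((UNIV \<times> ?V) \<times> ?pairs (A \<union> B))"
    proof (rule inj_onI)
      fix p q assume mem: "p \<in> (UNIV \<times> ?V) \<times> ?pairs (A \<union> B)" "q \<in> (UNIV \<times> ?V) \<times> ?pairs (A \<union> B)"
        and eq: "(\<lambda>((b, x), Y). insert (mk_lit b x) (false_clause g Y)) p
          = (\<lambda>((b, x), Y). insert (mk_lit b x) (false_clause g Y)) q"
      obtain b x Y b' x' Y' where pq: "p = ((b, x), Y)" "q = ((b', x'), Y')" by (metis surj_pair)
      have "x \<notin> A \<union> B" "x' \<notin> A \<union> B" "Y \<subseteq> A \<union> B" "Y' \<subseteq> A \<union> B" using mem pq by auto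
      then have "x \<notin> Y" "x' \<notin> Y'" "x \<notin> Y'" by auto
      then show "p = q"
        using eq insert_false_clause_inj[of "mk_lit b x" g Y "mk_lit b' x'" Y'] by (simp add: pq)
    qed
    moreover have "card ?V = card X - card A - card B"
      using fin AB cAB by (subst card_Diff_subset) auto
    moreover have "card (UNIV :: bool set) = 2" by simp
    ultimately show ?thesis unfolding B3_def using n_subsets[of "A \<union> B" 2] fin cAB
      by (simp add: card_image card_cartesian_product del: card_UNIV_bool)
  qed
  let ?bad = "{C\<in>clauses3 X. \<not> admissible A B g C}"
  have f2: "finite Y" if "card Y = 2" for Y :: "'a set"
    using that by (intro card_ge_0_finite) simp
  have s1: "B1 \<subseteq> ?bad"
  proof
    fix C assume "C \<in> B1"
    then obtain Y where Y: "Y \<subseteq> A \<union> B" "card Y = 3" "C = false_clause g Y" by (auto simp: B1_def)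
    have "{l\<in>C. var l \<notin> A \<union> B} = {}" "\<not> (\<exists>l\<in>C. lit_true g l)" using Y false_clause_false by blast+
    moreover from this(1) have "\<not> 2 \<le> card {l\<in>C. var l \<notin> A \<union> B}" by (simp only: card.empty)
    ultimately have "\<not> admissible A B g C" unfolding admissible_def by blast
    then show "C \<in> ?bad" using Y AB false_clause_mem by blast
  qed
  have s2: "B2 \<subseteq> ?bad"
  proof
    fix C assume "C \<in> B2"
    then obtain x Y where Y: "x \<in> B" "Y \<subseteq> A" "card Y = 2"
      and C: "C = insert (mk_lit (g x) x) (false_clause g Y)" by (auto simp: B2_def)
    have "{l\<in>C. var l \<notin> A} = {mk_lit (g x) x}" using Y AB false_clause_false unfolding C by fastforce
    moreover have "\<not> (\<exists>l\<in>C. var l \<in> A \<and> lit_true g l)"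
      using Y AB false_clause_false unfolding C by fastforce
    ultimately have "\<not> admissible A B g C" by (simp add: admissible_def)
    moreover have "C \<in> clauses3 X" unfolding C
      using Y AB f2 by (intro insert_false_clause_mem) auto
    ultimately show "C \<in> ?bad" by blast
  qed
  have s3: "B3 \<subseteq> ?bad"
  proof
    fix C assume "C \<in> B3"
    then obtain b x Y where Y: "x \<in> X" "x \<notin> A" "x \<notin> B" "Y \<subseteq> A \<union> B" "card Y = 2"
      and C: "C = insert (mk_lit b x) (false_clause g Y)" by (auto simp: B3_def)
    have "{l\<in>C. var l \<notin> A \<union> B} = {mk_lit b x}" using Y false_clause_false unfolding C by fastforce
    moreover have "\<not> (\<exists>l\<in>C. var l \<in> A \<union> B \<and> lit_true g l)"
      using Y false_clause_false unfolding C by fastforce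
    ultimately have "\<not> admissible A B g C" by (auto simp: admissible_def)
    moreover have "C \<in> clauses3 X" unfolding C
      using Y AB f2 by (intro insert_false_clause_mem) auto
    ultimately show "C \<in> ?bad" by blast
  qed
  have d12: "B1 \<inter> B2 = {}"
  proof -
    have "\<not> lit_true g l" if "C \<in> B1" "l \<in> C" for C l using that false_clause_false by (auto simp: B1_def)
    moreover have "\<exists>l\<in>C. lit_true g l" if "C \<in> B2" for C using that by (auto simp: B2_def)
    ultimately show ?thesis by blast
  qed
  have d3: "(B1 \<union> B2) \<inter> B3 = {}"
  proof -
    have "var ` C \<subseteq> A \<union> B" if "C \<in> B1 \<union> B2" for C
      using that by (auto simp: B1_def B2_def dest: false_clause_false)
    moreover have "\<not> var ` C \<subseteq> A \<union> B" if "C \<in> B3" for C using that by (auto simp: B3_def)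
    ultimately show ?thesis by blast
  qed
  have fb: "finite ?bad" using finite_clauses3[OF X] by simp
  have fB: "finite B1" "finite B2" "finite B3" using s1 s2 s3 fb finite_subset by blast+
  have "card (B1 \<union> B2 \<union> B3) = card B1 + card B2 + card B3"
    using fB d12 d3 by (simp add: card_Un_disjoint)
  moreover have "card (B1 \<union> B2 \<union> B3) \<le> card ?bad" using s1 s2 s3 fb by (intro card_mono) auto
  ultimately show ?thesis using c1 c2 c3 by simp
qed


lemma prob_mono_on_support:
  assumes "\<And>x. x \<in> set_pmf p \<Longrightarrow> x \<in> A \<Longrightarrow> x \<in> B"
  shows "measure_pmf.prob p A \<le> measure_pmf.prob p B"
proof -
  have "measure_pmf.prob p (A \<inter> set_pmf p) \<le> measure_pmf.prob p B"
    using assms by (intro measure_pmf.finite_measure_mono) auto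
  then show ?thesis by (simp add: measure_Int_set_pmf)
qed

text \<open>A frame forces the formula to hit prescribed sets of tame clauses. The sets are disjoint
  because a clause has at most one sole true variable, and their sizes depend on cardinalities only,
  although the sets themselves depend on the filled values.\<close>

lemma prob_frame_le:
  assumes X: "finite X" "card X \<ge> 3" and A: "A \<subseteq> X" and T: "T \<subseteq> X - A" and R: "R \<subseteq> X - A - T"
    and mu: "\<mu> > (0::real)"
  defines "k \<equiv> card A" and "c \<equiv> card T + card R" and "n \<equiv> card X"
  defines "\<Omega> \<equiv> 8 * real (n choose 3)"
  defines "bad \<equiv> (k + c choose 3) + (k choose 2) * c + 2 * (n - k - c) * (k + c choose 2)"
  shows "measure_pmf.prob (replicate_pmf m (pmf_of_set (clauses3 X))) {F. frame F A T R b}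
    \<le> fact m / \<mu> ^ m * exp (\<mu> * (1 - real bad / \<Omega>))
      * (1 - exp (- (\<mu> * (real (k - 1 choose 2) / \<Omega>)))) ^ k
      * (1 - exp (- (\<mu> * (real ((k + c - 1 choose 2) - (k choose 2)) / \<Omega>)))) ^ card R
      * (1 - exp (- (\<mu> * (real ((n - 1 choose 2) - (k choose 2)) / \<Omega>)))) ^ card {x\<in>T. \<not> b x}"
proof -
  define B where "B = T \<union> R"
  have AB: "A \<subseteq> X" "B \<subseteq> X" "A \<inter> B = {}" using A T R by (auto simp: B_def)
  have fin: "finite A" "finite T" "finite R" "finite B"
    using finite_subset[OF A X(1)] finite_subset[OF _ X(1), of T] finite_subset[OF _ X(1), of R] T R
    by (auto simp: B_def)
  have TR: "T \<inter> R = {}" using R by blast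
  have cB: "card B = c" using fin TR by (simp add: B_def c_def card_Un_disjoint)
  have cAB: "card (A \<union> B) = k + c" using fin AB cB by (simp add: card_Un_disjoint k_def)
  define Om where "Om = clauses3 X"
  have fOm: "finite Om" unfolding Om_def by (rule finite_clauses3[OF X(1)])
  have cOm: "real (card Om) = \<Omega>" by (simp add: Om_def \<Omega>_def n_def card_clauses3[OF X(1)])
  have Opos: "\<Omega> > 0" using X by (simp add: \<Omega>_def n_def zero_less_binomial_iff)
  have neOm: "Om \<noteq> {}" using cOm Opos by auto
  define L where "L = {C\<in>Om. admissible A B b C}"
  define W where "W = {C\<in>L. wild (A \<union> B) b C}"
  define Z where "Z = {x\<in>T. \<not> b x}"
  define I where "I = A \<union> R \<union> Z"
  \<comment> \<open>The variable sets are written as \<open>insert x Z\<close> with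
    \<open>x \<notin> Z\<close> to match the counting lemmas. Off \<open>A\<close>, clauses inside
    \<open>insert x A\<close> are removed, as they are not in \<open>L\<close>.\<close>
  define S where "S ws x = (let g = fill (A \<union> B) b ws in
      if x \<in> A then {C\<in>Om. sole_true g x C \<and> var ` C \<subseteq> insert x (A - {x})}
      else if x \<in> R then {C\<in>Om. sole_true g x C \<and> var ` C \<subseteq> insert x (A \<union> B - {x}) \<and> \<not> var ` C \<subseteq> insert x A}
      else {C\<in>Om. sole_true g x C \<and> var ` C \<subseteq> insert x (X - {x}) \<and> \<not> var ` C \<subseteq> insert x A})" for ws x
  define s where "s x = (if x \<in> A then (k - 1 choose 2)
      else if x \<in> R then (k + c - 1 choose 2) - (k choose 2) else (n - 1 choose 2) - (k choose 2))" for x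
  have Om3: "finite C" "inj_on var C" "var ` C \<subseteq> X" if "C \<in> Om" for C
  proof -
    show "inj_on var C" "var ` C \<subseteq> X" using that by (auto simp: Om_def clauses3_def)
    show "finite C" by (rule card_ge_0_finite) (use that in \<open>simp add: Om_def clauses3_def\<close>)
  qed
  have IX: "I \<subseteq> A \<union> B" by (auto simp: I_def B_def Z_def)
  have sub: "W \<subseteq> L" "L \<subseteq> Om" by (auto simp: W_def L_def)
  have fI: "finite I" using fin by (simp add: I_def Z_def)
  have two: "2 \<le> card {l\<in>C. var l \<notin> A}" if C: "C \<in> Om" "l \<in> C" "var l \<notin> A" "\<not> var ` C \<subseteq> insert (var l) A" for C l
  proof -
    obtain l' where l': "l' \<in> C" "var l' \<notin> A" "var l' \<noteq> var l" using C(4) by auto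
    have "card {l, l'} \<le> card {l\<in>C. var l \<notin> A}"
      using C l' Om3(1)[OF C(1)] by (intro card_mono) auto
    moreover have "l \<noteq> l'" using l' by blast
    ultimately show ?thesis by simp
  qed
  have S_sub: "S ws x \<subseteq> L - W" if x: "x \<in> I" for ws x
  proof
    fix C assume C: "C \<in> S ws x"
    let ?g = "fill (A \<union> B) b ws"
    have COm: "C \<in> Om" and sole: "sole_true ?g x C"
      and out: "x \<notin> A \<Longrightarrow> \<not> var ` C \<subseteq> insert x A"
      using C by (auto simp: S_def Let_def split: if_splits)
    obtain l where l: "l \<in> C" "var l = x" "lit_true ?g l" using sole by (auto simp: sole_true_def)
    have xAB: "x \<in> A \<union> B" using x IX by blast
    have "lit_true ?g l = lit_true b l" using l(2) xAB by (intro lit_true_cong) (simp add: fill_def)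
    then have lb: "lit_true b l" using l by simp
    have "\<not> wild (A \<union> B) b C" using l lb xAB by (auto simp: wild_def)
    moreover have "admissible A B b C"
    proof (cases "x \<in> A")
      case True
      then show ?thesis using l lb by (auto simp: admissible_def)
    next
      case False
      then have "2 \<le> card {l\<in>C. var l \<notin> A}" using two[OF COm l(1)] l(2) out by blast
      then show ?thesis using l lb xAB False by (auto simp: admissible_def)
    qed
    ultimately show "C \<in> L - W" using COm by (auto simp: L_def W_def)
  qed
  have S_card: "card (S ws x) = s x" if x: "x \<in> I" for ws x
  proof -
    let ?g = "fill (A \<union> B) b ws"
    consider "x \<in> A" | "x \<notin> A" "x \<in> R" | "x \<notin> A" "x \<notin> R" "x \<in> T" using x by (auto simp: I_def Z_def)
    then show ?thesis
    proof cases
      case 1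
      then show ?thesis using card_sole_true_within[OF X(1), of "A - {x}" x ?g] A fin
        by (auto simp: S_def s_def Om_def k_def card_Diff_singleton)
    next
      case 2
      have "x \<in> A \<union> B" "x \<in> X" using 2 R by (auto simp: B_def)
      then show ?thesis
        using 2 card_sole_true_outside[OF X(1), of A "A \<union> B - {x}" x ?g] AB fin cAB
        by (auto simp: S_def s_def Om_def k_def[symmetric] card_Diff_singleton)
    next
      case 3
      then have "x \<in> X" using T by blast
      then show ?thesis
        using 3 card_sole_true_outside[OF X(1), of A "X - {x}" x ?g] A X
        by (auto simp: S_def s_def Om_def k_def[symmetric] n_def[symmetric] card_Diff_singleton)
    qed
  qed
  have disj: "disjoint_family_on (S ws) I" for ws
    unfolding disjoint_family_on_def
  proof (intro ballI impI, rule ccontr)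
    fix x y assume "x \<noteq> y" and "S ws x \<inter> S ws y \<noteq> {}"
    then obtain C where "C \<in> S ws x" "C \<in> S ws y" by blast
    then have "sole_true (fill (A \<union> B) b ws) x C" "sole_true (fill (A \<union> B) b ws) y C"
      by (auto simp: S_def Let_def split: if_splits)
    from sole_true_unique[OF this] show False using \<open>x \<noteq> y\<close> by simp
  qed
  let ?P = "replicate_pmf m (pmf_of_set Om)"
  let ?E = "{F. set F \<subseteq> L \<and> (\<forall>x\<in>I. set F \<inter> S (filter (\<lambda>C. C \<in> W) F) x \<noteq> {})}"
  have "measure_pmf.prob ?P {F. frame F A T R b} \<le> measure_pmf.prob ?P ?E"
  proof (rule prob_mono_on_support)
    fix F assume F: "F \<in> set_pmf ?P" and fr: "F \<in> {F. frame F A T R b}"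
    have FOm: "set F \<subseteq> Om" using F fOm neOm by (auto simp: set_replicate_pmf)
    have FL: "set F \<subseteq> L" using FOm fr by (auto simp: L_def frame_def Let_def B_def)
    \<comment> \<open>All clauses of \<open>F\<close> are in \<open>L\<close>, so being wild is the
      same as membership in \<open>W\<close>, and the list from which the frame fills is the subword
      of letters in \<open>W\<close>.\<close>
    have fW: "filter (wild (A \<union> B) b) F = filter (\<lambda>C. C \<in> W) F"
      using FL by (intro filter_cong) (auto simp: W_def)
    let ?g = "fill (A \<union> B) b (filter (\<lambda>C. C \<in> W) F)"
    have hA: "\<exists>C\<in>set F. sole_true ?g x C \<and> var ` C \<subseteq> A" if "x \<in> A" for x
      using fr that fW by (simp add: frame_def Let_def B_def[symmetric])
    have hR: "\<exists>C\<in>set F. sole_true ?g x C \<and> var ` C \<subseteq> A \<union> B" if "x \<in> R" for x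
      using fr that fW by (simp add: frame_def Let_def B_def[symmetric])
    have hZ: "\<exists>C\<in>set F. sole_true ?g x C" if "x \<in> Z" for x
      using fr that fW by (simp add: frame_def Let_def B_def[symmetric] Z_def)
    have nA: "\<not> var ` C \<subseteq> insert x A" if C: "C \<in> L" "sole_true ?g x C" and x: "x \<in> B" for x C
    proof
      assume vC: "var ` C \<subseteq> insert x A"
      obtain l where l: "l \<in> C" "var l = x" "lit_true ?g l" "\<And>l'. l' \<in> C - {l} \<Longrightarrow> \<not> lit_true ?g l'"
        using C by (auto simp: sole_true_def)
      have COm: "C \<in> Om" using C sub by blast
      have xA: "x \<notin> A" using x AB by blast
      have "var l' \<in> A" if "l' \<in> C" "l' \<noteq> l" for l'
        using vC that inj_onD[OF Om3(2)[OF COm], of l' l] l by auto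
      then have "{l'\<in>C. var l' \<notin> A} \<subseteq> {l}" by blast
      then have c1: "card {l'\<in>C. var l' \<notin> A} \<le> 1" using card_mono[of "{l}"] by fastforce
      have "\<not> (\<exists>l'\<in>C. var l' \<in> A \<and> lit_true b l')"
      proof
        assume "\<exists>l'\<in>C. var l' \<in> A \<and> lit_true b l'"
        then obtain l' where l': "l' \<in> C" "var l' \<in> A" "lit_true b l'" by blast
        have "lit_true ?g l' = lit_true b l'" using l'(2) by (intro lit_true_cong) (simp add: fill_def)
        then show False using l(4)[of l'] l' l(2) xA by auto
      qed
      then show False using C(1) c1 by (auto simp: L_def admissible_def)
    qed
    have "set F \<inter> S (filter (\<lambda>C. C \<in> W) F) x \<noteq> {}" if x: "x \<in> I" for x
    proof -
      consider "x \<in> A" | "x \<notin> A" "x \<in> R" | "x \<notin> A" "x \<notin> R" "x \<in> Z" using x by (auto simp: I_def)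
      then show ?thesis
      proof cases
        case 1
        then obtain C where "C \<in> set F" "sole_true ?g x C" "var ` C \<subseteq> A" using hA by blast
        then have "C \<in> S (filter (\<lambda>C. C \<in> W) F) x" using 1 FOm by (auto simp: S_def Let_def)
        then show ?thesis using \<open>C \<in> set F\<close> by blast
      next
        case 2
        then obtain C where C: "C \<in> set F" "sole_true ?g x C" "var ` C \<subseteq> A \<union> B" using hR by blast
        then have "\<not> var ` C \<subseteq> insert x A" using nA FL 2 by (auto simp: B_def)
        then have "C \<in> S (filter (\<lambda>C. C \<in> W) F) x" using 2 C FOm by (auto simp: S_def Let_def)
        then show ?thesis using C(1) by blast
      next
        case 3
        then obtain C where C: "C \<in> set F" "sole_true ?g x C" using hZ by blast
        have "x \<in> B" using 3 by (auto simp: B_def Z_def)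
        then have nC: "\<not> var ` C \<subseteq> insert x A" using nA[of C x] C FL by blast
        have "var ` C \<subseteq> X" using C FOm Om3(3) by blast
        then have "C \<in> S (filter (\<lambda>C. C \<in> W) F) x" using 3 C nC FOm by (auto simp: S_def Let_def)
        then show ?thesis using C(1) by blast
      qed
    qed
    then show "F \<in> ?E" using FL by blast
  qed
  also have "\<dots> \<le> fact m / \<mu> ^ m * exp (\<mu> * (card L / card Om)) * (\<Prod>x\<in>I. 1 - exp (- (\<mu> * (s x / card Om))))"
    by (rule prob_hitting_le[OF fOm neOm sub fI S_sub S_card disj mu])
  also have "(\<Prod>x\<in>I. 1 - exp (- (\<mu> * (s x / card Om))))
    = (1 - exp (- (\<mu> * (real (k - 1 choose 2) / \<Omega>)))) ^ k
      * (1 - exp (- (\<mu> * (real ((k + c - 1 choose 2) - (k choose 2)) / \<Omega>)))) ^ card R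
      * (1 - exp (- (\<mu> * (real ((n - 1 choose 2) - (k choose 2)) / \<Omega>)))) ^ card Z"
    (is "_ = ?pA ^ k * ?pR ^ card R * ?pT ^ card Z")
  proof -
    let ?f = "\<lambda>x. 1 - exp (- (\<mu> * (s x / card Om)))"
    have dis: "A \<inter> R = {}" "(A \<union> R) \<inter> Z = {}" using T R TR by (auto simp: Z_def)
    have fZ: "finite Z" using fin by (simp add: Z_def)
    have "(\<Prod>x\<in>I. ?f x) = (\<Prod>x\<in>A. ?f x) * (\<Prod>x\<in>R. ?f x) * (\<Prod>x\<in>Z. ?f x)"
      unfolding I_def using fin fZ dis by (simp add: prod.union_disjoint)
    moreover have "(\<Prod>x\<in>A. ?f x) = (\<Prod>x\<in>A. ?pA)"
      by (intro prod.cong) (auto simp: s_def cOm)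
    moreover have "(\<Prod>x\<in>R. ?f x) = (\<Prod>x\<in>R. ?pR)"
      using dis by (intro prod.cong) (auto simp: s_def cOm)
    moreover have "(\<Prod>x\<in>Z. ?f x) = (\<Prod>x\<in>Z. ?pT)"
      using dis by (intro prod.cong) (auto simp: s_def cOm)
    ultimately show ?thesis by (simp add: k_def)
  qed
  finally have main: "measure_pmf.prob ?P {F. frame F A T R b}
      \<le> fact m / \<mu> ^ m * exp (\<mu> * (card L / card Om)) * (?pA ^ k * ?pR ^ card R * ?pT ^ card Z)" .
  have "card L / card Om \<le> 1 - real bad / \<Omega>"
  proof -
    have "L = Om - {C\<in>clauses3 X. \<not> admissible A B b C}" by (auto simp: L_def Om_def)
    then have "card L = card Om - card {C\<in>clauses3 X. \<not> admissible A B b C}"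
      using fOm by (simp add: card_Diff_subset Om_def)
    moreover have "card {C\<in>clauses3 X. \<not> admissible A B b C} \<le> card Om"
      using fOm by (intro card_mono) (auto simp: Om_def)
    moreover have "bad \<le> card {C\<in>clauses3 X. \<not> admissible A B b C}"
      using card_inadmissible_ge[OF X(1) AB, of b] by (simp add: bad_def k_def n_def cB)
    ultimately have "real (card L) \<le> \<Omega> - real bad" using cOm by simp
    then show ?thesis using Opos cOm by (simp add: field_simps)
  qed
  then have "exp (\<mu> * (card L / card Om)) \<le> exp (\<mu> * (1 - real bad / \<Omega>))"
    using mu by (simp only: exp_le_cancel_iff mult_le_cancel_left_pos)
  moreover have "0 \<le> ?pA ^ k * ?pR ^ card R * ?pT ^ card Z"
    using mu Opos by (intro mult_nonneg_nonneg zero_le_power) auto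
  ultimately have "fact m / \<mu> ^ m * exp (\<mu> * (card L / card Om)) * (?pA ^ k * ?pR ^ card R * ?pT ^ card Z)
      \<le> fact m / \<mu> ^ m * exp (\<mu> * (1 - real bad / \<Omega>)) * (?pA ^ k * ?pR ^ card R * ?pT ^ card Z)"
    using mu by (intro mult_right_mono mult_left_mono) auto
  then show ?thesis using main unfolding Om_def Z_def mult.assoc by linarith
qed

section \<open>Union bound over frames\<close>

text \<open>\<open>G\<close> is the set of true variables. A variable of \<open>S\<close>
  contributes \<open>1 + 1\<close>, a variable of \<open>T\<close> contributes 1 if true and
  \<open>q\<close> if false; this is the gain from maximality on \<open>T\<close>.\<close>

lemma sum_subsets_card_Diff:
  fixes q :: "'a :: comm_ring_1"
  assumes "finite S" "finite T" "S \<inter> T = {}"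
  shows "(\<Sum>G\<in>Pow (S \<union> T). q ^ card (T - G)) = 2 ^ card S * (1 + q) ^ card T"
  using assms(1,3)
proof (induction S rule: finite_induct)
  case empty
  show ?case using assms(2)
  proof (induction T rule: finite_induct)
    case (insert x T)
    have inj: "inj_on (insert x) (Pow T)" using insert(2) by (auto simp: inj_on_def)
    have "insert x T - G = insert x (T - G)" if "G \<in> Pow T" for G using insert(2) that by auto
    then have 1: "card (insert x T - G) = Suc (card (T - G))" if "G \<in> Pow T" for G
      using insert(1,2) that by simp
    have "insert x T - insert x G = T - G" for G using insert(2) by auto
    moreover have "Pow T \<inter> insert x ` Pow T = {}" using insert(2) by auto
    ultimately show ?case
      using insert 1 by (simp add: Pow_insert sum.union_disjoint sum.reindex[OF inj] sum_distrib_left[symmetric] algebra_simps)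
  qed simp
next
  case (insert x S)
  have x: "x \<notin> S \<union> T" using insert by auto
  have inj: "inj_on (insert x) (Pow (S \<union> T))" using x by (auto simp: inj_on_def)
  have "T - insert x G = T - G" for G using x by auto
  moreover have "Pow (S \<union> T) \<inter> insert x ` Pow (S \<union> T) = {}" using x by auto
  ultimately show ?case
    using insert assms(2) by (simp add: Pow_insert sum.union_disjoint sum.reindex[OF inj])
qed

lemma sum_Sigma_pairs:
  assumes "finite A" "\<And>x. x \<in> A \<Longrightarrow> finite (B x)"
  shows "(\<Sum>i\<in>Sigma A B. f i) = (\<Sum>x\<in>A. \<Sum>y\<in>B x. f (x, y))"
  using assms by (simp add: sum.Sigma)

text \<open>Allows the values in the union bound to range over the finitely many subsets of
  \<open>A \<union> T \<union> R\<close>.\<close>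

lemma frame_cong:
  assumes "\<And>x. x \<in> A \<union> T \<union> R \<Longrightarrow> b x = b' x"
  shows "frame F A T R b = frame F A T R b'"
proof -
  have lit: "lit_true b l = lit_true b' l" if "var l \<in> A \<union> (T \<union> R)" for l
    using assms that by (intro lit_true_cong) auto
  have "wild (A \<union> (T \<union> R)) b = wild (A \<union> (T \<union> R)) b'"
    using lit by (auto simp: wild_def fun_eq_iff)
  moreover have "fill (A \<union> (T \<union> R)) b ws = fill (A \<union> (T \<union> R)) b' ws" for ws
    using assms by (auto simp: fill_def fun_eq_iff)
  moreover have "admissible A (T \<union> R) b = admissible A (T \<union> R) b'"
    using lit by (auto simp: admissible_def fun_eq_iff)
  moreover have "b x = b' x" if "x \<in> T" for x using assms that by simp
  ultimately show ?thesis by (simp add: frame_def Let_def)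
qed

definition self_factor :: "nat \<Rightarrow> real \<Rightarrow> nat \<Rightarrow> real" where
  "self_factor n \<mu> k = 1 - exp (- (\<mu> * (real (k - 1 choose 2) / (8 * real (n choose 3)))))"

text \<open>Serves two kinds of witnesses: \<open>j = k + c\<close> for propagated variables, whose
  clauses stay inside \<open>A \<union> T \<union> R\<close>, and \<open>j = n\<close> for false
  variables of \<open>T\<close>, whose clauses range over all variables.\<close>

definition outer_factor :: "nat \<Rightarrow> real \<Rightarrow> nat \<Rightarrow> nat \<Rightarrow> real" where
  "outer_factor n \<mu> k j = 1 - exp (- (\<mu> * (real ((j - 1 choose 2) - (k choose 2)) / (8 * real (n choose 3)))))"

definition bad_count :: "nat \<Rightarrow> nat \<Rightarrow> nat \<Rightarrow> nat" where
  "bad_count n k c = (k + c choose 3) + (k choose 2) * c + 2 * (n - k - c) * (k + c choose 2)"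

definition frame_sum :: "nat \<Rightarrow> nat \<Rightarrow> real \<Rightarrow> nat \<Rightarrow> nat \<Rightarrow> nat \<Rightarrow> real" where
  "frame_sum n m \<mu> k D r = real (n choose k) * real (n - k - D choose r) * 2 ^ k * 2 ^ r
     * (1 + outer_factor n \<mu> k n) ^ D
     * (fact m / \<mu> ^ m * exp (\<mu> * (1 - real (bad_count n k (D + r)) / (8 * real (n choose 3))))
        * self_factor n \<mu> k ^ k * outer_factor n \<mu> k (k + (D + r)) ^ r)"

text \<open>\<open>T\<close> is chosen once for each \<open>A\<close>, so the sum runs over
  \<open>A\<close>, \<open>R\<close> and the values only. At depth 0 nothing is propagated and
  \<open>r = 0\<close> is the only term.\<close>

lemma prob_cover_le:
  assumes X: "finite X" "card X = n" "n \<ge> 3" and mu: "\<mu> > 0" and D: "k + D \<le> n"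
  shows "measure_pmf.prob (replicate_pmf m (pmf_of_set (clauses3 X))) {F. \<exists>A g. A \<subseteq> X \<and> card A = k \<and> cover F A g}
    \<le> (\<Sum>r\<in>(if D = 0 then {0} else {..n - k - D}). frame_sum n m \<mu> k D r)"
proof -
  define P where "P = replicate_pmf m (pmf_of_set (clauses3 X))"
  define rs where "rs = (if D = 0 then {0} else {..n - k - D})"
  define As where "As = {A. A \<subseteq> X \<and> card A = k}"
  have fA: "finite As" using X by (simp add: As_def)
  have "\<exists>T. T \<subseteq> X - A \<and> card T = D" if "A \<in> As" for A
  proof -
    have "finite A" using that X finite_subset by (auto simp: As_def)
    then have "card (X - A) = n - k" using that X by (simp add: As_def card_Diff_subset)
    then show ?thesis using obtain_subset_with_card_n[of D "X - A"] D by (metis add_le_imp_le_diff add.commute)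
  qed
  then obtain T where T: "\<And>A. A \<in> As \<Longrightarrow> T A \<subseteq> X - A \<and> card (T A) = D" by metis
  define Rs where "Rs A r = {R. R \<subseteq> X - A - T A \<and> card R = r}" for A r
  have fR: "finite (Rs A r)" for A r using X by (simp add: Rs_def)
  have fin: "finite A" "finite (T A)" if "A \<in> As" for A
    using that T[OF that] X finite_subset[of _ X] by (auto simp: As_def)
  have finR: "finite R" if "R \<in> Rs A r" for A R r
    using that X finite_subset[of R X] by (auto simp: Rs_def)
  define I where "I = (SIGMA r:rs. SIGMA A:As. SIGMA R:Rs A r. Pow (A \<union> R \<union> T A))"
  have frs: "finite rs" by (simp add: rs_def)
  have fI: "finite I"
    unfolding I_def using fA fR fin finR by (intro finite_SigmaI) (auto simp: rs_def)
  define E where "E = (\<lambda>(r::nat, A, R, G). {F. frame F A (T A) R (\<lambda>x. x \<in> G)})"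
  have "measure_pmf.prob P {F. \<exists>A g. A \<subseteq> X \<and> card A = k \<and> cover F A g} \<le> measure_pmf.prob P (\<Union>i\<in>I. E i)"
  proof (rule prob_mono_on_support)
    fix F assume F: "F \<in> set_pmf P" and "F \<in> {F. \<exists>A g. A \<subseteq> X \<and> card A = k \<and> cover F A g}"
    then obtain A g where A: "A \<subseteq> X" "A \<in> As" and cov: "cover F A g" by (auto simp: As_def)
    have "clauses3 X \<noteq> {}"
    proof -
      have "card (clauses3 X) > 0" using X by (simp add: card_clauses3 zero_less_binomial_iff)
      then show ?thesis by auto
    qed
    then have "set F \<subseteq> clauses3 X"
      using F finite_clauses3[OF X(1)] by (auto simp: P_def set_replicate_pmf lists_eq_set)
    then obtain R b where R: "R \<subseteq> X - A - T A" "T A = {} \<longrightarrow> R = {}" and fr: "frame F A (T A) R b"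
      by (rule cover_frame[OF _ X(1) cov conjunct1[OF T[OF A(2)]] A(1)]) blast
    have "card R \<in> rs"
    proof (cases "D = 0")
      case True
      then have "T A = {}" using T[OF A(2)] fin[OF A(2)] by simp
      then show ?thesis using R(2) True by (simp add: rs_def)
    next
      case False
      have "card R \<le> card (X - A - T A)" using R(1) X by (intro card_mono) auto
      also have "\<dots> = n - k - D"
        using A T[OF A(2)] fin[OF A(2)] X by (simp add: card_Diff_subset As_def)
      finally show ?thesis using False by (simp add: rs_def)
    qed
    define G where "G = {x \<in> A \<union> R \<union> T A. b x}"
    have "frame F A (T A) R (\<lambda>x. x \<in> G)"
      using fr by (subst frame_cong[where b' = b]) (auto simp: G_def)
    moreover have "(card R, A, R, G) \<in> I"
      using \<open>card R \<in> rs\<close> A R(1) by (auto simp: I_def Rs_def G_def)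
    ultimately show "F \<in> (\<Union>i\<in>I. E i)" by (auto simp: E_def intro!: bexI[of _ "(card R, A, R, G)"])
  qed
  also have "\<dots> \<le> (\<Sum>i\<in>I. measure_pmf.prob P (E i))"
    by (rule measure_pmf.finite_measure_subadditive_finite[OF fI]) auto
  also have "\<dots> = (\<Sum>r\<in>rs. \<Sum>A\<in>As. \<Sum>R\<in>Rs A r. \<Sum>G\<in>Pow (A \<union> R \<union> T A). measure_pmf.prob P (E (r, A, R, G)))"
    unfolding I_def using frs fA fR fin finR by (simp add: sum_Sigma_pairs finite_SigmaI cong: sum.cong)
  also have "\<dots> \<le> (\<Sum>r\<in>rs. frame_sum n m \<mu> k D r)"
  proof (rule sum_mono)
    fix r assume "r \<in> rs"
    define W where "W = fact m / \<mu> ^ m * exp (\<mu> * (1 - real (bad_count n k (D + r)) / (8 * real (n choose 3))))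
        * self_factor n \<mu> k ^ k * outer_factor n \<mu> k (k + (D + r)) ^ r"
    define q where "q = outer_factor n \<mu> k n"
    have "(\<Sum>A\<in>As. \<Sum>R\<in>Rs A r. \<Sum>G\<in>Pow (A \<union> R \<union> T A). measure_pmf.prob P (E (r, A, R, G)))
        \<le> (\<Sum>A\<in>As. \<Sum>R\<in>Rs A r. 2 ^ (k + r) * (1 + q) ^ D * W)"
    proof (intro sum_mono)
      fix A R assume A: "A \<in> As" and R: "R \<in> Rs A r"
      have cA: "A \<subseteq> X" "card A = k" and cR: "R \<subseteq> X - A - T A" "card R = r"
        using A R by (auto simp: As_def Rs_def)
      have "measure_pmf.prob P (E (r, A, R, G)) \<le> W * q ^ card (T A - G)" for G
      proof -
        have "{x\<in>T A. x \<notin> G} = T A - G" by auto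
        then show ?thesis
          using prob_frame_le[OF X(1) _ cA(1) conjunct1[OF T[OF A]] cR(1) mu, of m "\<lambda>x. x \<in> G"] X(2,3) T[OF A] cA cR
          by (simp add: E_def P_def W_def q_def self_factor_def outer_factor_def bad_count_def)
      qed
      then have "(\<Sum>G\<in>Pow (A \<union> R \<union> T A). measure_pmf.prob P (E (r, A, R, G)))
          \<le> (\<Sum>G\<in>Pow (A \<union> R \<union> T A). W * q ^ card (T A - G))" by (intro sum_mono)
      also have "\<dots> = W * (2 ^ card (A \<union> R) * (1 + q) ^ card (T A))"
        using T[OF A] cR fin[OF A] finR[OF R]
        by (subst sum_distrib_left[symmetric], subst sum_subsets_card_Diff) auto
      also have "card (A \<union> R) = k + r"
        using cA cR fin[OF A] finR[OF R] by (subst card_Un_disjoint) auto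
      finally show "(\<Sum>G\<in>Pow (A \<union> R \<union> T A). measure_pmf.prob P (E (r, A, R, G))) \<le> 2 ^ (k + r) * (1 + q) ^ D * W"
        using T[OF A] by (simp add: mult_ac)
    qed
    also have "\<dots> = frame_sum n m \<mu> k D r"
    proof -
      have "card (Rs A r) = (n - k - D choose r)" if "A \<in> As" for A
      proof -
        have "card (X - A - T A) = n - k - D"
          using that T[OF that] fin[OF that] X by (simp add: card_Diff_subset As_def)
        then show ?thesis unfolding Rs_def using X by (subst n_subsets) auto
      qed
      moreover have "card As = (n choose k)" unfolding As_def using X by (simp add: n_subsets)
      ultimately show ?thesis by (simp add: frame_sum_def W_def q_def power_add mult_ac)
    qed
    finally show "(\<Sum>A\<in>As. \<Sum>R\<in>Rs A r. \<Sum>G\<in>Pow (A \<union> R \<union> T A). measure_pmf.prob P (E (r, A, R, G))) \<le> frame_sum n m \<mu> k D r" .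
  qed
  finally show ?thesis by (simp add: P_def rs_def)
qed

section \<open>A checker for exponential rate bounds\<close>

definition coarse_lo :: "int list" where "coarse_lo =
   [5516561,6737944,8229744,10051833,12277337,14995574,18315636,22370769,27323720,33373268,
    40762202,49787066,60810060,74273576,90717951,110803156,135335281,165298886,201896516,246596962,
    301194210,367879440,449328963,548811635,670320045,818730753,1000000000,1221402758,1491824697,
    1822118799,2225540926,2718281825,3320116918,4055199960,4953032415,6049647452,7389056082,
    9025013477,11023176351,13463737997,16444646722,20085536860,24532530116,29964099944,36598234312,
    44701184326,54598149821,66686330773,81450868327,99484315216,121510416982,148413158427,
    181272241026]"
definition coarse_hi :: "int list" where "coarse_hi =
   [5516567,6737949,8229749,10051838,12277342,14995579,18315641,22370774,27323725,33373273,
    40762207,49787072,60810066,74273582,90717957,110803162,135335287,165298892,201896522,246596968,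
    301194216,367879445,449328968,548811639,670320048,818730754,1000000000,1221402759,1491824700,
    1822118805,2225540936,2718281840,3320116940,4055199991,4953032458,6049647510,7389056160,
    9025013581,11023176488,13463738176,16444646955,20085537162,24532530506,29964100446,36598234956,
    44701185150,54598150873,66686332113,81450870031,99484317379,121510419724,148413161899,
    181272245416]"
definition fine_lo :: "int list" where "fine_lo =
   [1000000000,1010050167,1020201339,1030454532,1040810772,1051271094,1061836544,1072508178,
    1083287064,1094174279,1105170913,1116278065,1127496845,1138828376,1150273791,1161834234,
    1173510862,1185304842,1197217353,1209249587]"
definition fine_hi :: "int list" where "fine_hi =
   [1000000000,1010050168,1020201342,1030454537,1040810779,1051271103,1061836555,1072508191,
    1083287079,1094174297,1105170933,1116278087,1127496870,1138828403,1150273820,1161834266,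
    1173510896,1185304878,1197217392,1209249628]"

type_synonym index = "nat \<times> nat"

text \<open>The index \<open>(q, r)\<close> stands for the exponent
  \<open>(q - 26) / 5 + r / 100\<close>. The coarse lists enclose \<open>10^9\<close> times the
  exponentials of the multiples of 1/5 from -5.2 to 5.2, the fine lists those of the hundredths
  below 0.2; products are thus scaled by \<open>10^18\<close>.\<close>

definition hundredths :: "index \<Rightarrow> int" where
  "hundredths p = 20 * int (fst p) - 520 + int (snd p)"

definition exp_lo :: "index \<Rightarrow> int" where
  "exp_lo p = coarse_lo ! fst p * fine_lo ! snd p"

definition exp_hi :: "index \<Rightarrow> int" where
  "exp_hi p = coarse_hi ! fst p * fine_hi ! snd p"

definition in_table :: "index \<Rightarrow> bool" where
  "in_table p \<longleftrightarrow> fst p < 53 \<and> snd p < 20"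

fun geo_below :: "int \<Rightarrow> int list \<Rightarrow> bool" where
  "geo_below c (x # y # xs) \<longleftrightarrow> y * 1000000000 \<le> x * c \<and> geo_below c (y # xs)"
| "geo_below c xs \<longleftrightarrow> True"

fun geo_above :: "int \<Rightarrow> int list \<Rightarrow> bool" where
  "geo_above c (x # y # xs) \<longleftrightarrow> x * c \<le> y * 1000000000 \<and> geo_above c (y # xs)"
| "geo_above c xs \<longleftrightarrow> True"

text \<open>Only ratios of neighbours have to be checked: if each is at most a lower bound of
  \<open>e\<close>, the entries stay below the powers of \<open>e\<close>.\<close>

lemma geo_below_nth:
  assumes "geo_below c xs" "real_of_int c / 10^9 \<le> e" "0 \<le> c" "i < length xs" "0 \<le> hd xs"
  shows "real_of_int (xs ! i) \<le> real_of_int (hd xs) * e ^ i"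
  using assms
proof (induction i)
  case 0 then show ?case by (cases xs) auto
next
  case (Suc i)
  have "xs ! Suc i * 10^9 \<le> xs ! i * c"
    using Suc.prems(1,4)
  proof (induction c xs arbitrary: i rule: geo_below.induct)
    case (1 c x y xs) then show ?case by (cases i) auto
  qed auto
  then have "real_of_int (xs ! Suc i) * 10^9 \<le> real_of_int (xs ! i) * real_of_int c"
    by (metis of_int_le_iff of_int_mult of_int_numeral of_int_power)
  then have "real_of_int (xs ! Suc i) \<le> real_of_int (xs ! i) * (real_of_int c / 10^9)"
    by simp
  also have "\<dots> \<le> real_of_int (hd xs) * e ^ i * (real_of_int c / 10^9)"
    using Suc by (intro mult_right_mono) auto
  also have "\<dots> \<le> real_of_int (hd xs) * e ^ i * e"
  proof (intro mult_left_mono)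
    have "0 \<le> e" using Suc.prems(2,3) by (smt (verit) divide_nonneg_nonneg of_int_0_le_iff zero_le_power)
    then show "0 \<le> real_of_int (hd xs) * e ^ i" using Suc.prems(5) by simp
  qed (use Suc.prems in auto)
  finally show ?case by (simp add: mult_ac)
qed

lemma geo_above_nth:
  assumes "geo_above c xs" "e \<le> real_of_int c / 10^9" "0 \<le> e" "i < length xs" "0 \<le> hd xs"
  shows "real_of_int (hd xs) * e ^ i \<le> real_of_int (xs ! i)"
  using assms
proof (induction i)
  case 0 then show ?case by (cases xs) auto
next
  case (Suc i)
  have "xs ! i * c \<le> xs ! Suc i * 10^9"
    using Suc.prems(1,4)
  proof (induction c xs arbitrary: i rule: geo_above.induct)
    case (1 c x y xs) then show ?case by (cases i) auto
  qed auto
  then have "real_of_int (xs ! i) * real_of_int c \<le> real_of_int (xs ! Suc i) * 10^9"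
    by (metis of_int_le_iff of_int_mult of_int_numeral of_int_power)
  then have "real_of_int (xs ! i) * (real_of_int c / 10^9) \<le> real_of_int (xs ! Suc i)"
    by simp
  moreover have "real_of_int (hd xs) * e ^ i * e \<le> real_of_int (xs ! i) * (real_of_int c / 10^9)"
  proof (intro mult_mono)
    show IH: "real_of_int (hd xs) * e ^ i \<le> real_of_int (xs ! i)" using Suc by auto
    show "0 \<le> real_of_int (xs ! i)"
      by (rule order.trans[OF _ IH]) (use Suc.prems in simp)
  qed (use Suc.prems in auto)
  ultimately show ?case by (simp add: mult_ac)
qed

text \<open>Order 8 is accurate enough to enclose the three base values of the tables between
  neighbouring multiples of \<open>10^-9\<close>.\<close>

lemma exp_taylor8:
  fixes x :: real
  assumes x: "\<bar>x\<bar> \<le> 1"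
  shows "(\<Sum>m<8. x ^ m / fact m) \<le> exp x" "exp x \<le> (\<Sum>m<8. x ^ m / fact m) + 3 / fact 8 * x ^ 8"
proof -
  obtain t where t: "\<bar>t\<bar> \<le> \<bar>x\<bar>" and e: "exp x = (\<Sum>m<8. x ^ m / fact m) + exp t / fact 8 * x ^ 8"
    using Maclaurin_exp_le[of x 8] by blast
  have "exp t \<le> exp 1" using t x by simp
  then have "exp t \<le> 3" using exp_le by linarith
  then have "exp t / fact 8 * x ^ 8 \<le> 3 / fact 8 * x ^ 8"
    by (intro mult_right_mono divide_right_mono) auto
  moreover have "0 \<le> exp t / fact 8 * x ^ 8" by simp
  ultimately show "(\<Sum>m<8. x ^ m / fact m) \<le> exp x" "exp x \<le> (\<Sum>m<8. x ^ m / fact m) + 3 / fact 8 * x ^ 8"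
    using e by simp_all
qed

lemma exp_hundredth: "1010050167 / 10^9 \<le> exp (1/100 :: real)" "exp (1/100 :: real) \<le> 1010050168 / 10^9"
  and exp_fifth: "1221402758 / 10^9 \<le> exp (1/5 :: real)" "exp (1/5 :: real) \<le> 1221402759 / 10^9"
  and exp_minus_fifth: "818730753 / 10^9 \<le> exp (- (1/5) :: real)" "exp (- (1/5) :: real) \<le> 818730754 / 10^9"
proof -
  show "1010050167 / 10^9 \<le> exp (1/100 :: real)" "exp (1/100 :: real) \<le> 1010050168 / 10^9"
    using exp_taylor8[of "1/100"] by (auto simp: fact_numeral lessThan_nat_numeral power_divide)
  show "1221402758 / 10^9 \<le> exp (1/5 :: real)" "exp (1/5 :: real) \<le> 1221402759 / 10^9"
    using exp_taylor8[of "1/5"] by (auto simp: fact_numeral lessThan_nat_numeral power_divide)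
  show "818730753 / 10^9 \<le> exp (- (1/5) :: real)" "exp (- (1/5) :: real) \<le> 818730754 / 10^9"
    using exp_taylor8[of "-(1/5)"] by (auto simp: fact_numeral lessThan_nat_numeral power_divide)
qed

text \<open>The coarse lists contain the exact value of \<open>exp 0\<close> at index 26 and are
  checked outwards from there, downwards on the reversed initial segment.\<close>

definition tables_ok :: bool where
  "tables_ok \<longleftrightarrow> geo_below 1221402758 (drop 26 coarse_lo) \<and> geo_above 1221402759 (drop 26 coarse_hi)
    \<and> geo_below 818730753 (rev (take 27 coarse_lo)) \<and> geo_above 818730754 (rev (take 27 coarse_hi))
    \<and> geo_below 1010050167 fine_lo \<and> geo_above 1010050168 fine_hi"

lemma tables_ok: tables_ok
  by code_simp

lemma table_length:
  "length coarse_lo = 53" "length coarse_hi = 53" "length fine_lo = 20" "length fine_hi = 20"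
  "coarse_lo ! 26 = 1000000000" "coarse_hi ! 26 = 1000000000" "hd fine_lo = 1000000000" "hd fine_hi = 1000000000"
  by (simp_all add: coarse_lo_def coarse_hi_def fine_lo_def fine_hi_def)

lemma table_nonneg: "\<forall>x\<in>set (coarse_lo @ coarse_hi @ fine_lo @ fine_hi). 0 < x"
  by (simp add: coarse_lo_def coarse_hi_def fine_lo_def fine_hi_def)

lemma exp_table:
  assumes "in_table p"
  shows "real_of_int (exp_lo p) \<le> 10^18 * exp (hundredths p / 100)"
    and "10^18 * exp (hundredths p / 100) \<le> real_of_int (exp_hi p)"
    and "0 < exp_lo p"
proof -
  obtain q r where p: "p = (q, r)" by (cases p)
  have q: "q < 53" and r: "r < 20" using assms by (auto simp: p in_table_def)
  have pos: "0 < coarse_lo ! q" "0 < coarse_hi ! q" "0 < fine_lo ! r" "0 < fine_hi ! r"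
    using table_nonneg q r table_length by (auto simp: all_set_conv_all_nth nth_append dest: bspec)
  have c: "real_of_int (coarse_lo ! q) \<le> 10^9 * exp ((real q - 26) / 5) \<and>
      10^9 * exp ((real q - 26) / 5) \<le> real_of_int (coarse_hi ! q)"
  proof (cases "26 \<le> q")
    case True
    have "real_of_int (drop 26 coarse_lo ! (q - 26)) \<le> real_of_int (hd (drop 26 coarse_lo)) * exp (1/5) ^ (q - 26)"
      by (rule geo_below_nth[of 1221402758]) (use tables_ok exp_fifth q True table_length in \<open>auto simp: tables_ok_def hd_drop_conv_nth\<close>)
    moreover have "real_of_int (hd (drop 26 coarse_hi)) * exp (1/5) ^ (q - 26) \<le> real_of_int (drop 26 coarse_hi ! (q - 26))"
      by (rule geo_above_nth[of 1221402759]) (use tables_ok exp_fifth q True table_length in \<open>auto simp: tables_ok_def hd_drop_conv_nth\<close>)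
    moreover have "exp (1/5) ^ (q - 26) = exp ((real q - 26) / 5)"
      using True by (simp add: exp_of_nat_mult[symmetric] of_nat_diff)
    ultimately show ?thesis using True q table_length by (simp add: hd_drop_conv_nth)
  next
    case False
    have rl: "rev (take 27 coarse_lo) ! (26 - q) = coarse_lo ! q" "rev (take 27 coarse_hi) ! (26 - q) = coarse_hi ! q"
      "hd (rev (take 27 coarse_lo)) = 1000000000" "hd (rev (take 27 coarse_hi)) = 1000000000"
    proof -
      have "last (take 27 xs) = xs ! 26" if "length xs = 53" for xs :: "int list"
        using that by (subst last_conv_nth) (auto simp: take_eq_Nil2)
      then show "rev (take 27 coarse_lo) ! (26 - q) = coarse_lo ! q" "rev (take 27 coarse_hi) ! (26 - q) = coarse_hi ! q"
        "hd (rev (take 27 coarse_lo)) = 1000000000" "hd (rev (take 27 coarse_hi)) = 1000000000"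
        using False table_length by (simp_all add: rev_nth hd_rev)
    qed
    have "real_of_int (rev (take 27 coarse_lo) ! (26 - q)) \<le> real_of_int (hd (rev (take 27 coarse_lo))) * exp (- (1/5)) ^ (26 - q)"
      by (rule geo_below_nth[of 818730753]) (use tables_ok exp_minus_fifth rl table_length in \<open>auto simp: tables_ok_def\<close>)
    moreover have "real_of_int (hd (rev (take 27 coarse_hi))) * exp (- (1/5)) ^ (26 - q) \<le> real_of_int (rev (take 27 coarse_hi) ! (26 - q))"
      by (rule geo_above_nth[of 818730754]) (use tables_ok exp_minus_fifth rl table_length in \<open>auto simp: tables_ok_def\<close>)
    moreover have "exp (- (1/5)) ^ (26 - q) = exp ((real q - 26) / 5)"
      using False by (simp add: exp_of_nat_mult[symmetric] of_nat_diff algebra_simps)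
    ultimately show ?thesis using rl by simp
  qed
  have f: "real_of_int (fine_lo ! r) \<le> 10^9 * exp (real r / 100) \<and>
      10^9 * exp (real r / 100) \<le> real_of_int (fine_hi ! r)"
  proof -
    have "real_of_int (fine_lo ! r) \<le> real_of_int (hd fine_lo) * exp (1/100) ^ r"
      by (rule geo_below_nth[of 1010050167]) (use tables_ok exp_hundredth r table_length in \<open>auto simp: tables_ok_def\<close>)
    moreover have "real_of_int (hd fine_hi) * exp (1/100) ^ r \<le> real_of_int (fine_hi ! r)"
      by (rule geo_above_nth[of 1010050168]) (use tables_ok exp_hundredth r table_length in \<open>auto simp: tables_ok_def\<close>)
    moreover have "exp (1/100) ^ r = exp (real r / 100)"
      by (simp add: exp_of_nat_mult[symmetric])
    ultimately show ?thesis using table_length by simp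
  qed
  have e: "exp (hundredths p / 100) = exp ((real q - 26) / 5) * exp (real r / 100)"
    by (simp add: exp_add[symmetric] hundredths_def p field_simps)
  have "real_of_int (coarse_lo ! q) * real_of_int (fine_lo ! r)
      \<le> (10^9 * exp ((real q - 26) / 5)) * (10^9 * exp (real r / 100))"
    using c f pos by (intro mult_mono) auto
  then show "real_of_int (exp_lo p) \<le> 10^18 * exp (hundredths p / 100)"
    unfolding e by (simp add: exp_lo_def p)
  have "(10^9 * exp ((real q - 26) / 5)) * (10^9 * exp (real r / 100))
      \<le> real_of_int (coarse_hi ! q) * real_of_int (fine_hi ! r)"
    using c f pos by (intro mult_mono) auto
  then show "10^18 * exp (hundredths p / 100) \<le> real_of_int (exp_hi p)"
    unfolding e by (simp add: exp_hi_def p)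
  show "0 < exp_lo p" using pos by (simp add: exp_lo_def p)
qed

text \<open>An \<open>ival\<close> describes the interval of \<open>a\<close> with centre \<open>A\<close> and half-width \<open>HA\<close>, and the depth
  \<open>D\<close> of \<open>T\<close>, all in units of 1/20000; a \<open>cell\<close> describes an interval of \<open>u\<close> likewise.  The other
  fields are the points where the tangent bounds are taken (exponents in hundredths, as indices
  into the tables) and roundings of the corresponding exponentials, in units of \<open>10^-6\<close>.\<close>

datatype ival = Ival int int int int index int index int index index int int index int index
datatype cell = Cell int int index index index int int int

section \<open>Bounding a cubic on a box in integer arithmetic\<close>

definition cubic_ok :: "int \<Rightarrow> int \<Rightarrow> int \<Rightarrow> int \<Rightarrow> int \<Rightarrow> int \<Rightarrow> int \<Rightarrow> int \<Rightarrow> int \<Rightarrow> int \<Rightarrow> int \<Rightarrow> int \<Rightarrow> bool" where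
  "cubic_ok cb th A1 Gx G0 G2 h A HA D V HV = (let
     S = 20000; B = 59125000000000000; k = S - A - D; w = A + V; s = 2*A*V + V*V;
     c00 = (cb*S + th*D)*(S*S) + A1*A*(S*S) + Gx*(A*A*A) + k*(G0*(S*S) + G2* s) - h*(V - D)*(S*S)
           - B*(6*w*w*S - 5*w*w*w + 3*A*A*V);
     c10 = A1*(S*S) + 3*Gx*(A*A) - (G0*(S*S) + G2* s) + 2*k*G2*V - B*(12*w*S - 15*w*w + 6*A*V);
     c01 = 2*k*G2*w - h*(S*S) - B*(12*w*S - 15*w*w + 3*A*A);
     c20 = 3*Gx*A - 2*V*G2 - B*(6*S - 15*w + 3*V);
     c11 = 2*k*G2 - 2*G2*w - B*(12*S - 30*w + 6*A);
     c02 = k*G2 - B*(6*S - 15*w)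
   in c00 + \<bar>c10\<bar>*HA + \<bar>c01\<bar>*HV + max c20 0*(HA*HA) + \<bar>c11\<bar>*(HA*HV) + max c02 0*(HV*HV)
      + (Gx + 5*B)*(HA*HA*HA) + \<bar>12*B - 2*G2\<bar>*(HA*HA*HV) + \<bar>15*B - G2\<bar>*(HA*HV*HV) + 5*B*(HV*HV*HV)
      + (th + \<bar>h\<bar> + \<bar>G0\<bar> + 3*G2)*8000000 + 5000000000000*(S*S*S) \<le> 0)"

definition cubic :: "real \<Rightarrow> real \<Rightarrow> real \<Rightarrow> real \<Rightarrow> real \<Rightarrow> real \<Rightarrow> real \<Rightarrow> real \<Rightarrow> real \<Rightarrow> real \<Rightarrow> real" where
  "cubic cb th A1 Gx G0 G2 h a u d = cb + th * d + A1 * a + Gx * a^3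
     + (1 - a - d) * (G0 + G2 * (2*a*u + u^2)) - h * (u - d)
     - 59125000000000000 * (6*(a+u)^2 - 5*(a+u)^3 + 3*a^2*u)"

text \<open>The cubic times \<open>20000^3\<close> is expanded at the centre \<open>(A, V)\<close>,
  with \<open>c00\<close> to \<open>c02\<close> as the coefficients up to second order. Each term is
  bounded at the half-widths; the squares are non-negative, so only the positive parts of
  \<open>c20\<close> and \<open>c02\<close> count. The shortfall of \<open>20000 * d\<close> below
  \<open>D\<close>, at most 2/100, gives \<open>8000000 = 2 / 100 * 20000^2\<close> times a bound on
  the slope in \<open>d\<close>. All coefficients carry a factor \<open>10^17\<close>, so the
  conclusion stands for a rate of at most -1/20000.\<close>

lemma cubic_ok_sound:
  assumes ok: "cubic_ok cb th A1 Gx G0 G2 h A HA D V HV"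
    and pos: "0 \<le> th" "0 \<le> Gx" "0 \<le> G2"
    and a: "\<bar>20000 * a - real_of_int A\<bar> \<le> real_of_int HA" and u: "\<bar>20000 * u - real_of_int V\<bar> \<le> real_of_int HV"
    and d: "20000 * d \<le> real_of_int D" "real_of_int D - 2 / 100 \<le> 20000 * d"
    and au: "0 \<le> a" "0 \<le> u" "a + u \<le> 1"
  shows "cubic cb th A1 Gx G0 G2 h a u d \<le> - 5000000000000"
proof -
  define S :: real where "S = 20000"
  define B :: real where "B = 59125000000000000"
  define x where "x = 20000 * a - real_of_int A"
  define y where "y = 20000 * u - real_of_int V"
  define e where "e = real_of_int D - 20000 * d"
  define k where "k = S - A - D"
  define w where "w = real_of_int (A + V)"
  define s where "s = 2 * real_of_int A * V + real_of_int V * V"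
  define c10 where "c10 = A1*(S*S) + 3*Gx*(real_of_int A*A) - (G0*(S*S) + G2* s) + 2*k*G2*V - B*(12*w*S - 15*w*w + 6*A*V)"
  define c01 where "c01 = 2*k*G2*w - h*(S*S) - B*(12*w*S - 15*w*w + 3*real_of_int A*A)"
  define c20 where "c20 = 3*Gx*real_of_int A - 2*V*G2 - B*(6*S - 15*w + 3*V)"
  define c11 where "c11 = 2*k*G2 - 2*G2*w - B*(12*S - 30*w + 6*A)"
  define c02 where "c02 = k*G2 - B*(6*S - 15*w)"
  define c00 where "c00 = (cb*S + th*D)*(S*S) + A1*A*(S*S) + Gx*(real_of_int A*A*A) + k*(G0*(S*S) + G2* s) - h*(V - D)*(S*S)
           - B*(6*w*w*S - 5*w*w*w + 3*A*A*V)"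
  define t where "t = th + h - G0 - G2 * (2*a*u + u^2)"
  have "S^3 * cubic cb th A1 Gx G0 G2 h a u d
      = c00 + c10 * x + c01 * y + c20 * (x*x) + c11 * (x*y) + c02 * (y*y)
      + (Gx + 5*B) * (x*x*x) + (12*B - 2*G2) * (x*x*y) + (15*B - G2) * (x*y*y) + 5*B*(y*y*y) - e * (S * S) * t"
    unfolding cubic_def c00_def c10_def c01_def c20_def c11_def c02_def t_def x_def y_def e_def k_def w_def s_def S_def B_def
    by (simp add: algebra_simps power2_eq_square power3_eq_cube)
  also have "\<dots> \<le> c00 + \<bar>c10\<bar>*HA + \<bar>c01\<bar>*HV + max c20 0*(real_of_int HA*HA) + \<bar>c11\<bar>*(real_of_int HA*HV) + max c02 0*(real_of_int HV*HV)
      + (Gx + 5*B)*(real_of_int HA*HA*HA) + \<bar>12*B - 2*G2\<bar>*(real_of_int HA*HA*HV) + \<bar>15*B - G2\<bar>*(real_of_int HA*HV*HV) + 5*B*(real_of_int HV*HV*HV)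
      + (th + \<bar>h\<bar> + \<bar>G0\<bar> + 3*G2)*8000000"
  proof -
    have X: "\<bar>x\<bar> \<le> HA" and Y: "\<bar>y\<bar> \<le> HV" using a u by (auto simp: x_def y_def)
    have H0: "0 \<le> real_of_int HA" "0 \<le> real_of_int HV" using X Y by linarith+
    have p: "c * z \<le> \<bar>c\<bar> * Z" if "\<bar>z\<bar> \<le> Z" for c z Z :: real
    proof -
      have "c * z \<le> \<bar>c\<bar> * \<bar>z\<bar>" by (metis abs_ge_self abs_mult)
      also have "\<dots> \<le> \<bar>c\<bar> * Z" using that by (intro mult_left_mono) auto
      finally show ?thesis .
    qed
    have q: "c * z \<le> max c 0 * Z" if "0 \<le> z" "z \<le> Z" for c z Z :: real
    proof -
      have "c * z \<le> max c 0 * z" using that by (intro mult_right_mono) auto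
      also have "\<dots> \<le> max c 0 * Z" using that by (intro mult_left_mono) auto
      finally show ?thesis .
    qed
    have xx: "\<bar>x*x\<bar> \<le> real_of_int HA*HA" and xy: "\<bar>x*y\<bar> \<le> real_of_int HA*HV" and yy: "\<bar>y*y\<bar> \<le> real_of_int HV*HV"
      unfolding abs_mult by (intro mult_mono X Y H0 abs_ge_zero)+
    have x3: "\<bar>x*x*x\<bar> \<le> real_of_int HA*HA*HA" "\<bar>x*x*y\<bar> \<le> real_of_int HA*HA*HV" "\<bar>x*y*y\<bar> \<le> real_of_int HA*HV*HV" "\<bar>y*y*y\<bar> \<le> real_of_int HV*HV*HV"
      unfolding abs_mult by (intro mult_mono X Y H0 abs_ge_zero mult_nonneg_nonneg)+
    have "- (e * (S * S) * t) \<le> (th + \<bar>h\<bar> + \<bar>G0\<bar> + 3*G2)*8000000"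
    proof -
      have "\<bar>e\<bar> \<le> 2/100" using d by (simp add: e_def)
      then have e1: "\<bar>e * (S * S)\<bar> \<le> 8000000" by (simp add: S_def abs_mult)
      have "2*a*u + u^2 \<le> 3" "0 \<le> 2*a*u + u^2"
      proof -
        have "a * u \<le> 1 * 1" "u * u \<le> 1 * 1" using au by (intro mult_mono; simp)+
        then show "2*a*u + u^2 \<le> 3" by (simp add: power2_eq_square)
        show "0 \<le> 2*a*u + u^2" using au by simp
      qed
      then have "\<bar>G2 * (2*a*u + u^2)\<bar> \<le> 3 * real_of_int G2"
        using pos mult_left_mono[of "2*a*u + u^2" 3 "real_of_int G2"] by (simp add: abs_mult mult.commute)
      then have "\<bar>t\<bar> \<le> th + \<bar>h\<bar> + \<bar>G0\<bar> + 3*G2" unfolding t_def using pos by linarith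
      then have "\<bar>e * (S * S)\<bar> * \<bar>t\<bar> \<le> 8000000 * real_of_int (th + \<bar>h\<bar> + \<bar>G0\<bar> + 3*G2)"
        using e1 by (intro mult_mono) auto
      then have "\<bar>e * (S * S) * t\<bar> \<le> 8000000 * real_of_int (th + \<bar>h\<bar> + \<bar>G0\<bar> + 3*G2)" by (simp add: abs_mult)
      then show ?thesis by (simp add: abs_le_iff mult.commute)
    qed
    moreover have "(Gx + 5*B) * (x*x*x) \<le> (Gx + 5*B) * (real_of_int HA*HA*HA)" "5*B*(y*y*y) \<le> 5*B*(real_of_int HV*HV*HV)"
      using x3 pos by (auto intro!: mult_left_mono simp: B_def abs_le_iff)
    moreover have "c20 * (x*x) \<le> max c20 0 * (real_of_int HA*HA)" "c02 * (y*y) \<le> max c02 0 * (real_of_int HV*HV)"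
      using xx yy by (auto intro!: q simp: abs_le_iff)
    ultimately show ?thesis
      using p[OF X, of c10] p[OF Y, of c01] p[OF xy, of c11] p[OF x3(2), of "12*B - 2*G2"] p[OF x3(3), of "15*B - G2"]
      unfolding of_int_mult of_int_add of_int_diff of_int_numeral by linarith
  qed
  also have "\<dots> \<le> - 5000000000000 * S^3"
  proof -
    have "real_of_int (let
     S = 20000; B = 59125000000000000; k = S - A - D; w = A + V; s = 2*A*V + V*V;
     c00 = (cb*S + th*D)*(S*S) + A1*A*(S*S) + Gx*(A*A*A) + k*(G0*(S*S) + G2* s) - h*(V - D)*(S*S)
           - B*(6*w*w*S - 5*w*w*w + 3*A*A*V);
     c10 = A1*(S*S) + 3*Gx*(A*A) - (G0*(S*S) + G2* s) + 2*k*G2*V - B*(12*w*S - 15*w*w + 6*A*V);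
     c01 = 2*k*G2*w - h*(S*S) - B*(12*w*S - 15*w*w + 3*A*A);
     c20 = 3*Gx*A - 2*V*G2 - B*(6*S - 15*w + 3*V);
     c11 = 2*k*G2 - 2*G2*w - B*(12*S - 30*w + 6*A);
     c02 = k*G2 - B*(6*S - 15*w)
   in c00 + \<bar>c10\<bar>*HA + \<bar>c01\<bar>*HV + max c20 0*(HA*HA) + \<bar>c11\<bar>*(HA*HV) + max c02 0*(HV*HV)
      + (Gx + 5*B)*(HA*HA*HA) + \<bar>12*B - 2*G2\<bar>*(HA*HA*HV) + \<bar>15*B - G2\<bar>*(HA*HV*HV) + 5*B*(HV*HV*HV)
      + (th + \<bar>h\<bar> + \<bar>G0\<bar> + 3*G2)*8000000 + 5000000000000*(S*S*S)) \<le> real_of_int 0"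
      using ok unfolding cubic_ok_def Let_def by (simp only: of_int_le_iff)
    moreover have "X \<le> - 5000000000000 * 20000^3" if "X + 5000000000000 * (20000 * 20000 * 20000) \<le> 0" for X :: real
      using that by simp
    ultimately show ?thesis
      unfolding c00_def c10_def c01_def c20_def c11_def c02_def k_def w_def s_def S_def B_def
      by (simp only: Let_def of_int_add of_int_diff of_int_mult of_int_abs of_int_max of_int_numeral of_int_0)
  qed
  finally have "S^3 * cubic cb th A1 Gx G0 G2 h a u d \<le> S^3 * (- 5000000000000)" by (simp add: mult.commute)
  then show ?thesis by (simp add: S_def)
qed


section \<open>Integer side conditions for the tangent parameters\<close>

definition ival_theta :: "index \<Rightarrow> int \<Rightarrow> int" where
  "ival_theta pt tt = (hundredths pt * 10000 + tt) * 100000000000"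

definition ival_const :: "index \<Rightarrow> int \<Rightarrow> int" where
  "ival_const pc tc = ((tc - hundredths pc * 10000) * 10 + 104600) * 10000000000"

text \<open>The part of the bound for \<open>10^17 * ival_rate\<close> that is linear in
  \<open>a\<close>, apart from the forbidden clauses: \<open>b - c\<close>, then 0.69315 for
  \<open>ln 2\<close>, then \<open>l - 1\<close>, then \<open>M\<close> times the constant term of
  the line that replaces \<open>1 - exp (- (1.77375 * a^2))\<close>.\<close>

definition ival_slope :: "index \<Rightarrow> int \<Rightarrow> index \<Rightarrow> int \<Rightarrow> index \<Rightarrow> index \<Rightarrow> int \<Rightarrow> int \<Rightarrow> int" where
  "ival_slope pb tb pc tc px pj M E =
     (((tb - hundredths pb * 10000) - (tc - hundredths pc * 10000)) * 10 + 6931500) * 10000000000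
     - (hundredths pj + 100) * 1000000000000000 + M * (100000000 - E * (100 - hundredths px)) * 1000"

definition half_exp_bound :: "index \<Rightarrow> int \<Rightarrow> int \<Rightarrow> bool" where
  "half_exp_bound p t c \<longleftrightarrow> in_table p \<and> 0 \<le> t \<and>
     exp_hi p * (2000000000000 - 2000000 * t + t * t) \<le> c * 2000000000000000000000000"

text \<open>\<open>p\<close> divides 1 between \<open>exp (- b)\<close> and
  \<open>exp (- c)\<close>; in the certificate it is the centre of the interval, where the tangent
  to the entropy is taken. \<open>M\<close> is rounded upwards and \<open>E\<close> downwards. The
  last line bounds \<open>1.77375 * (1 - a^2)\<close> at the left end, where it is largest.\<close>

fun ival_ok :: "ival \<Rightarrow> bool" where
  "ival_ok (Ival A HA D p pb tb pc tc px pj M E pt tt pz) \<longleftrightarrow>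
     half_exp_bound pb tb p \<and> half_exp_bound pc tc (1000000 - p) \<and>
     in_table px \<and> in_table pj \<and> in_table pt \<and> in_table pz \<and> 0 \<le> tt \<and> 0 \<le> E \<and> HA \<le> A \<and> 0 \<le> D \<and>
     0 \<le> ival_theta pt tt \<and>
     exp_hi pj \<le> M * 1000000000000 \<and> E * 1000000000000 \<le> exp_lo px \<and>
     2000000000000000000000000 \<le> exp_lo pt * (1000000 + tt) + exp_lo pz * 1000000 \<and>
     (D = 0 \<or> 177375 * (400000000 - (A - HA) * (A - HA)) \<le> - hundredths pz * 400000000000)"

text \<open>The tangent points are \<open>l = - hundredths p1 / 100\<close> and
  \<open>h - l = hundredths p2 / 100\<close>. \<open>M2\<close> includes the factor 2 for the two
  values of a propagated variable.\<close>

fun cell_ok :: "ival \<Rightarrow> cell \<Rightarrow> bool" where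
  "cell_ok (Ival A HA D p pb tb pc tc px pj M E pt tt pz) (Cell V HV p1 p2 p3 M1 M2 F) \<longleftrightarrow>
     in_table p1 \<and> in_table p2 \<and> in_table p3 \<and> 0 \<le> F \<and>
     exp_hi p1 \<le> M1 * 1000000000000 \<and> 2 * exp_hi p2 \<le> M2 * 1000000000000 \<and> F * 1000000000000 \<le> exp_lo p3 \<and>
     cubic_ok (ival_const pc tc) (ival_theta pt tt) (ival_slope pb tb pc tc px pj M E) (177375 * M * E)
       (- (hundredths p1 + 100) * 1000000000000000 + M1 * 100000000000
          + M2 * (100000000 - F * (100 - hundredths p3)) * 1000)
       (177375 * M2 * F) ((hundredths p2 - hundredths p1) * 1000000000000000) A HA D V HV"

fun bare_ok :: "ival \<Rightarrow> bool" where
  "bare_ok (Ival A HA D p pb tb pc tc px pj M E pt tt pz) \<longleftrightarrow> D = 0 \<and>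
     cubic_ok (ival_const pc tc) (ival_theta pt tt) (ival_slope pb tb pc tc px pj M E) (177375 * M * E)
       0 0 0 A HA 0 0 0"

text \<open>The logarithm of a term of the union bound is at most \<open>n\<close> times the sum of the following
  two rates, for \<open>a\<close>, \<open>u\<close>, \<open>d\<close> as above and any tangent parameters \<open>b\<close>, \<open>c\<close>, \<open>t\<close>, \<open>l\<close>, \<open>h\<close> subject to the
  side conditions of \<open>rate_negative\<close>.  All constants come from the Poisson parameter \<open>4.73 n\<close>:
  \<open>1.77375 = 4.73 * 3/8\<close>, \<open>0.59125 = 4.73 / 8\<close>, and 0.01046 bounds the contribution of the
  number of clauses.\<close>

definition cell_rate :: "real \<Rightarrow> real \<Rightarrow> real \<Rightarrow> real \<Rightarrow> real \<Rightarrow> real" where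
  "cell_rate l h a u d = (1 - a - d) * (l - 1 + exp (- l)
     + 2 * exp (h - l) * (1 - exp (- (1.77375 * (2*a*u + u^2))))) - h * (u - d)"

definition ival_rate :: "real \<Rightarrow> real \<Rightarrow> real \<Rightarrow> real \<Rightarrow> real \<Rightarrow> real \<Rightarrow> real \<Rightarrow> real" where
  "ival_rate b c t l a u d = b * a + c * (1 - a) + a * ln 2 + d * t + 0.01046
     - 0.59125 * (6*(a+u)^2 - 5*(a+u)^3 + 3*a^2*u)
     + a * (l - 1 + exp (- l) * (1 - exp (- (1.77375 * a^2))))"

section \<open>Soundness of the certificate checker\<close>

lemma half_exp_bound:
  assumes "half_exp_bound p t c"
  shows "exp (- (t / 10^6 - hundredths p / 100)) \<le> c / 10^6"
proof -
  have tab: "in_table p" and t: "0 \<le> t"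
    and c: "exp_hi p * (2000000000000 - 2000000 * t + t * t) \<le> c * 2000000000000000000000000"
    using assms by (auto simp: half_exp_bound_def)
  let ?x = "real_of_int t / 10^6"
  have x0: "0 \<le> ?x" using t by simp
  have q: "0 \<le> 1 - ?x + ?x^2 / 2"
  proof -
    have "0 \<le> (?x - 1)^2 + 1" by (simp add: add_nonneg_nonneg)
    then show ?thesis by (simp add: power2_eq_square algebra_simps)
  qed
  \<comment> \<open>The quadratic upper bound on \<open>exp (- x)\<close> follows from the quadratic
    lower bound on \<open>exp x\<close>, because the product of the two quadratics is
    \<open>1 + (x^2 / 2)^2\<close>.\<close>
  have "exp (- ?x) \<le> 1 - ?x + ?x^2 / 2"
  proof -
    have "(1 - x + x^2 / 2) * (1 + x + x^2 / 2) = 1 + (x^2 / 2)^2" for x :: real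
      by (simp add: power2_eq_square algebra_simps)
    then have "1 \<le> (1 - ?x + ?x^2 / 2) * (1 + ?x + ?x^2 / 2)"
      by (simp only:) simp
    also have "\<dots> \<le> (1 - ?x + ?x^2 / 2) * exp ?x"
      using exp_lower_Taylor_quadratic[OF x0] q by (intro mult_left_mono) auto
    finally show ?thesis by (simp add: exp_minus field_simps)
  qed
  then have "10^18 * exp (hundredths p / 100) * exp (- ?x) \<le> real_of_int (exp_hi p) * (1 - ?x + ?x^2 / 2)"
    using exp_table[OF tab] q by (intro mult_mono) auto
  moreover have "real_of_int (exp_hi p * (2000000000000 - 2000000 * t + t * t)) \<le> real_of_int (c * 2000000000000000000000000)"
    using c by (simp only: of_int_le_iff)
  then have "real_of_int (exp_hi p) * (1 - ?x + ?x^2 / 2) \<le> real_of_int c * 10^12"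
    by (simp add: power2_eq_square field_simps)
  ultimately have "10^18 * (exp (hundredths p / 100) * exp (- ?x)) \<le> real_of_int c * 10^12"
    by linarith
  moreover have "exp (hundredths p / 100) * exp (- ?x) = exp (- (?x - hundredths p / 100))"
    by (simp add: exp_add[symmetric])
  ultimately show ?thesis by simp
qed

text \<open>The tangent line at \<open>y0\<close> with its factor \<open>exp (- y0)\<close> rounded
  down to \<open>E\<close>. Where the line is negative, rounding lifts it, but there the claim is
  trivial.\<close>

lemma exp_tangent:
  assumes "0 \<le> E" "E \<le> exp (- y0)"
  shows "E * (1 + y0 - y) \<le> exp (- y :: real)"
proof (cases "0 \<le> 1 + y0 - y")
  case True
  have "E * (1 + y0 - y) \<le> exp (- y0) * (1 + y0 - y)" using assms True by (intro mult_right_mono)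
  also have "\<dots> \<le> exp (- y0) * exp (y0 - y)"
    using exp_ge_add_one_self[of "y0 - y"] by (intro mult_left_mono) (auto simp: algebra_simps)
  finally show ?thesis by (simp add: exp_add[symmetric])
next
  case False
  then have "E * (1 + y0 - y) \<le> 0" using assms by (simp add: mult_nonneg_nonpos)
  then show ?thesis by (smt (verit) exp_gt_zero)
qed

text \<open>Replacing \<open>1 - exp (- y)\<close> by a line in \<open>y\<close> is what makes the
  rates polynomial. Used with \<open>c = 1\<close> for the witnesses of \<open>A\<close> and with
  \<open>c = 2\<close> for propagated variables.\<close>

lemma scaled_factor:
  fixes y :: real
  assumes "in_table p" "in_table q" "0 \<le> F" "c * exp_hi p \<le> M * 1000000000000" "F * 1000000000000 \<le> exp_lo q"
    and "0 \<le> y" "0 \<le> (c::int)"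
  shows "c * exp (hundredths p / 100) * (1 - exp (- y))
    \<le> M / 10^6 * (1 - F / 10^6 * (1 - hundredths q / 100 - y))" "0 \<le> M"
proof -
  have 1: "c * exp (hundredths p / 100) \<le> M / 10^6"
  proof -
    have "real_of_int c * (10^18 * exp (hundredths p / 100)) \<le> real_of_int c * real_of_int (exp_hi p)"
      using exp_table(2)[OF assms(1)] assms(7) by (intro mult_left_mono) auto
    also have "\<dots> \<le> real_of_int (M * 1000000000000)" using assms(4) by (simp only: of_int_mult[symmetric] of_int_le_iff)
    finally show ?thesis by simp
  qed
  have "real_of_int (F * 1000000000000) \<le> real_of_int (exp_lo q)" using assms(5) by (simp only: of_int_le_iff)
  then have "F / 10^6 \<le> exp (- (- (hundredths q / 100)))" using exp_table(1)[OF assms(2)] by simp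
  then have 2: "F / 10^6 * (1 + - (hundredths q / 100) - y) \<le> exp (- y)"
    using assms(3) by (intro exp_tangent) auto
  have "0 \<le> real_of_int c * exp (hundredths p / 100)" using assms(7) by simp
  then have M: "0 \<le> real_of_int M / 10^6" using 1 by linarith
  then show "0 \<le> M" by simp
  have "c * exp (hundredths p / 100) * (1 - exp (- y)) \<le> M / 10^6 * (1 - exp (- y))"
    using 1 assms(6) by (intro mult_right_mono) auto
  also have "\<dots> \<le> M / 10^6 * (1 - F / 10^6 * (1 - hundredths q / 100 - y))"
    using 2 M by (intro mult_left_mono) auto
  finally show "c * exp (hundredths p / 100) * (1 - exp (- y))
    \<le> M / 10^6 * (1 - F / 10^6 * (1 - hundredths q / 100 - y))" .
qed

text \<open>0.69315 is split into the table exponent 0.69 and a rest that is small enough for the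
  quadratic Taylor bound.\<close>

lemma ln2_le: "ln 2 \<le> (0.69315 :: real)"
proof -
  have "in_table (29, 9)" by (simp add: in_table_def)
  then have "real_of_int (exp_lo (29, 9)) \<le> 10^18 * exp (0.69 :: real)"
    using exp_table(1)[of "(29, 9)"] by (simp add: hundredths_def)
  moreover have "exp_lo (29, 9) = coarse_lo ! 29 * fine_lo ! 9" by (simp add: exp_lo_def)
  moreover have "coarse_lo ! 29 = 1822118799" "1094174279 \<le> fine_lo ! 9"
    by (simp_all add: coarse_lo_def fine_lo_def)
  ultimately have "1.9937155 \<le> exp (0.69 :: real)" by simp
  moreover have "1.00315495 \<le> exp (0.00315 :: real)"
    using exp_lower_Taylor_quadratic[of "0.00315"] by (simp add: power2_eq_square)
  ultimately have "1.9937155 * 1.00315495 \<le> exp 0.69 * exp (0.00315 :: real)" by (intro mult_mono) auto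
  then have "2 \<le> exp (0.69315 :: real)" by (simp add: exp_add[symmetric])
  then show ?thesis using ln_le_cancel_iff[of 2 "exp 0.69315"] by simp
qed

lemma ival_rate_le:
  fixes a u d :: real
  assumes ok: "ival_ok (Ival A HA D p pb tb pc tc px pj M E pt tt pz)"
    and a: "0 \<le> a"
  defines "b \<equiv> tb / 10^6 - hundredths pb / 100" and "c \<equiv> tc / 10^6 - hundredths pc / 100"
    and "t \<equiv> hundredths pt / 100 + tt / 10^6" and "l \<equiv> - (hundredths pj / 100)"
  shows "10^17 * ival_rate b c t l a u d \<le> real_of_int (ival_const pc tc) + real_of_int (ival_theta pt tt) * d
      + real_of_int (ival_slope pb tb pc tc px pj M E) * a + real_of_int (177375 * M * E) * a^3
      - 59125000000000000 * (6*(a+u)^2 - 5*(a+u)^3 + 3*a^2*u)"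
    and "exp (- b) + exp (- c) \<le> 1"
    and "D \<noteq> 0 \<Longrightarrow> real_of_int A - real_of_int HA \<le> 20000 * a \<Longrightarrow> 2 \<le> exp t + exp (- (1.77375 * (1 - a^2)))"
    and "0 \<le> M" "0 \<le> E" "0 \<le> ival_theta pt tt"
proof -
  have f: "1 * exp_hi pj \<le> M * 1000000000000" "E * 1000000000000 \<le> exp_lo px" "0 \<le> E" "in_table px" "in_table pj"
    using ok by auto
  show "0 \<le> E" "0 \<le> ival_theta pt tt" using ok by auto
  have x: "0 \<le> 1.77375 * a^2" by simp
  note sf = scaled_factor[OF f(5) f(4) f(3) f(1) f(2) x]
  show "0 \<le> M" using sf by simp
  have "exp (- l) * (1 - exp (- (1.77375 * a^2))) \<le> M / 10^6 * (1 - E / 10^6 * (1 - hundredths px / 100 - 1.77375 * a^2))"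
    using sf(1) by (simp add: l_def)
  from mult_left_mono[OF this a] mult_left_mono[OF ln2_le a]
  have "ival_rate b c t l a u d \<le> b * a + c * (1 - a) + a * 0.69315 + d * t + 0.01046
     - 0.59125 * (6*(a+u)^2 - 5*(a+u)^3 + 3*a^2*u)
     + (a * (l - 1) + a * (M / 10^6 * (1 - E / 10^6 * (1 - hundredths px / 100 - 1.77375 * a^2))))"
    unfolding ival_rate_def distrib_left by linarith
  then have "10^17 * ival_rate b c t l a u d \<le> 10^17 * (b * a + c * (1 - a) + a * 0.69315 + d * t + 0.01046
     - 0.59125 * (6*(a+u)^2 - 5*(a+u)^3 + 3*a^2*u)
     + (a * (l - 1) + a * (M / 10^6 * (1 - E / 10^6 * (1 - hundredths px / 100 - 1.77375 * a^2)))))"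
    by (intro mult_left_mono) auto
  also have "\<dots> = ival_const pc tc + ival_theta pt tt * d
      + ival_slope pb tb pc tc px pj M E * a + (177375 * M * E) * a^3
      - 59125000000000000 * (6*(a+u)^2 - 5*(a+u)^3 + 3*a^2*u)"
    unfolding ival_const_def ival_theta_def ival_slope_def b_def c_def t_def l_def
    by (simp add: field_simps power2_eq_square power3_eq_cube)
  finally show "10^17 * ival_rate b c t l a u d \<le> real_of_int (ival_const pc tc) + real_of_int (ival_theta pt tt) * d
      + real_of_int (ival_slope pb tb pc tc px pj M E) * a + real_of_int (177375 * M * E) * a^3
      - 59125000000000000 * (6*(a+u)^2 - 5*(a+u)^3 + 3*a^2*u)" .
  have "exp (- b) \<le> p / 10^6" "exp (- c) \<le> real_of_int (1000000 - p) / 10^6"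
    using half_exp_bound[of pb tb p] half_exp_bound[of pc tc "1000000 - p"] ok by (auto simp: b_def c_def)
  then show "exp (- b) + exp (- c) \<le> 1" by (simp add: field_simps)
  show "2 \<le> exp t + exp (- (1.77375 * (1 - a^2)))" if D: "D \<noteq> 0" and aA: "real_of_int A - real_of_int HA \<le> 20000 * a"
  proof -
    have z: "177375 * (400000000 - (A - HA) * (A - HA)) \<le> - hundredths pz * 400000000000" "HA \<le> A"
      and tab: "in_table pt" "in_table pz" "0 \<le> tt"
      and s: "2000000000000000000000000 \<le> exp_lo pt * (1000000 + tt) + exp_lo pz * 1000000"
      using ok D by auto
    have "real_of_int (A - HA) * real_of_int (A - HA) \<le> (20000 * a) * (20000 * a)"
      using aA z(2) by (intro mult_mono) auto
    then have Z: "real_of_int (A - HA) * real_of_int (A - HA) \<le> 400000000 * a^2"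
      unfolding power2_eq_square by linarith
    have "real_of_int (177375 * (400000000 - (A - HA) * (A - HA))) \<le> real_of_int (- hundredths pz * 400000000000)"
      using z(1) by (simp only: of_int_le_iff)
    then have P: "177375 * (400000000 - real_of_int (A - HA) * real_of_int (A - HA)) \<le> - real_of_int (hundredths pz) * 400000000000"
      by (simp only: of_int_mult of_int_diff of_int_numeral of_int_minus)
    have "1.77375 * (1 - q) \<le> - (y / 100)"
      if "Z \<le> 400000000 * q" "177375 * (400000000 - Z) \<le> - y * 400000000000" for Z q y :: real
      using that by (simp add: field_simps)
    from this[OF Z P] have "1.77375 * (1 - a^2) \<le> - (hundredths pz / 100)" .
    then have "exp (hundredths pz / 100) \<le> exp (- (1.77375 * (1 - a^2)))"
      unfolding exp_le_cancel_iff by linarith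
    moreover have "exp (hundredths pt / 100) * (1 + tt / 10^6) \<le> exp t"
      unfolding t_def exp_add using exp_ge_add_one_self[of "tt / 10^6"] by (intro mult_left_mono) auto
    moreover have "real_of_int (exp_lo pt) * (1 + tt / 10^6) \<le> 10^18 * (exp (hundredths pt / 100) * (1 + tt / 10^6))"
      unfolding mult.assoc[symmetric] using exp_table(1)[OF tab(1)] tab(3) by (intro mult_right_mono) auto
    moreover have "real_of_int 2000000000000000000000000 \<le> real_of_int (exp_lo pt * (1000000 + tt) + exp_lo pz * 1000000)"
      using s by (simp only: of_int_le_iff)
    then have "2 * 10^18 \<le> real_of_int (exp_lo pt) * (1 + tt / 10^6) + real_of_int (exp_lo pz)"
      by (simp add: field_simps)
    moreover have "2 \<le> y + z"
      if "v \<le> z" "x \<le> y" "w \<le> 10^18 * x" "2 * 10^18 \<le> w + r" "r \<le> 10^18 * v" for v w x y z r :: real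
      using that by simp
    ultimately show ?thesis using exp_table(1)[OF tab(2)] by blast
  qed
qed

lemma cell_rate_le:
  fixes a u d :: real
  assumes ok: "in_table p1" "in_table p2" "in_table p3" "0 \<le> F"
     "exp_hi p1 \<le> M1 * 1000000000000" "2 * exp_hi p2 \<le> M2 * 1000000000000" "F * 1000000000000 \<le> exp_lo p3"
    and au: "0 \<le> a" "0 \<le> u" "0 \<le> 1 - a - d"
  defines "l \<equiv> - (hundredths p1 / 100)" and "h \<equiv> hundredths p2 / 100 - hundredths p1 / 100"
  shows "10^17 * cell_rate l h a u d \<le> (1 - a - d) * (real_of_int (- (hundredths p1 + 100) * 1000000000000000 + M1 * 100000000000
          + M2 * (100000000 - F * (100 - hundredths p3)) * 1000)
       + real_of_int (177375 * M2 * F) * (2*a*u + u^2)) - real_of_int ((hundredths p2 - hundredths p1) * 1000000000000000) * (u - d)"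
    and "0 \<le> M2"
proof -
  have y: "0 \<le> 1.77375 * (2*a*u + u^2)" using au by simp
  note sf = scaled_factor[OF ok(2) ok(3) ok(4) ok(6) ok(7) y]
  show "0 \<le> M2" using sf by simp
  have "real_of_int (exp_hi p1) \<le> real_of_int (M1 * 1000000000000)" using ok(5) by (simp only: of_int_le_iff)
  then have "exp (- l) \<le> M1 / 10^6" using exp_table(2)[OF ok(1)] by (simp add: l_def)
  moreover have "h - l = hundredths p2 / 100" by (simp add: h_def l_def)
  ultimately have "l - 1 + exp (- l) + 2 * exp (h - l) * (1 - exp (- (1.77375 * (2*a*u + u^2))))
     \<le> l - 1 + M1 / 10^6 + M2 / 10^6 * (1 - F / 10^6 * (1 - hundredths p3 / 100 - 1.77375 * (2*a*u + u^2)))"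
    using sf(1) by (simp only: of_int_numeral) linarith
  from mult_left_mono[OF this au(3)]
  have "10^17 * cell_rate l h a u d \<le> 10^17 * ((1 - a - d) * (l - 1 + M1 / 10^6 + M2 / 10^6 * (1 - F / 10^6 * (1 - hundredths p3 / 100 - 1.77375 * (2*a*u + u^2)))) - h * (u - d))"
    unfolding cell_rate_def by (intro mult_left_mono) auto
  also have "\<dots> = (1 - a - d) * (10^17 * (l - 1 + M1 / 10^6 + M2 / 10^6 * (1 - F / 10^6 * (1 - hundredths p3 / 100 - 1.77375 * (2*a*u + u^2))))) - (10^17 * h) * (u - d)"
  proof -
    have "10^17 * (k * x - h * v) = k * (10^17 * x) - (10^17 * h) * v" for k x h v :: real
      by (simp add: algebra_simps)
    then show ?thesis .
  qed
  also have "10^17 * (l - 1 + M1 / 10^6 + M2 / 10^6 * (1 - F / 10^6 * (1 - hundredths p3 / 100 - 1.77375 * (2*a*u + u^2))))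
    = real_of_int (- (hundredths p1 + 100) * 1000000000000000 + M1 * 100000000000
          + M2 * (100000000 - F * (100 - hundredths p3)) * 1000) + real_of_int (177375 * M2 * F) * (2*a*u + u^2)"
    unfolding l_def by (simp add: field_simps)
  also have "10^17 * h = (hundredths p2 - hundredths p1) * 1000000000000000"
    unfolding h_def by (simp add: field_simps)
  finally show "10^17 * cell_rate l h a u d \<le> (1 - a - d) * (real_of_int (- (hundredths p1 + 100) * 1000000000000000 + M1 * 100000000000
          + M2 * (100000000 - F * (100 - hundredths p3)) * 1000)
       + real_of_int (177375 * M2 * F) * (2*a*u + u^2)) - real_of_int ((hundredths p2 - hundredths p1) * 1000000000000000) * (u - d)" .
qed

definition in_ival :: "ival \<Rightarrow> real \<Rightarrow> bool" where
  "in_ival I a \<longleftrightarrow> (case I of Ival A HA D p pb tb pc tc px pj M E pt tt pz \<Rightarrow> \<bar>20000 * a - A\<bar> \<le> HA)"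

definition in_cell :: "cell \<Rightarrow> real \<Rightarrow> bool" where
  "in_cell c u \<longleftrightarrow> (case c of Cell V HV p1 p2 p3 M1 M2 F \<Rightarrow> \<bar>20000 * u - V\<bar> \<le> HV)"

definition ival_depth :: "ival \<Rightarrow> int" where
  "ival_depth I = (case I of Ival A HA D p pb tb pc tc px pj M E pt tt pz \<Rightarrow> D)"

lemma cell_sound:
  fixes a u d :: real
  assumes I: "ival_ok I" "cell_ok I C" and a: "in_ival I a" and u: "in_cell C u"
    and d: "20000 * d \<le> ival_depth I" "ival_depth I - 2 / 100 \<le> 20000 * d" and D: "ival_depth I \<noteq> 0"
    and au: "0 \<le> a" "0 \<le> u" "a + u \<le> 1" "a + d \<le> 1"
  obtains b c t l l' h where "exp (- b) + exp (- c) \<le> 1" "2 \<le> exp t + exp (- (1.77375 * (1 - a^2)))"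
    "ival_rate b c t l a u d + cell_rate l' h a u d \<le> - (1/20000)"
proof -
  obtain A HA D p pb tb pc tc px pj M E pt tt pz where Ie: "I = Ival A HA D p pb tb pc tc px pj M E pt tt pz" by (cases I)
  obtain V HV p1 p2 p3 M1 M2 F where Ce: "C = Cell V HV p1 p2 p3 M1 M2 F" by (cases C)
  have ok: "ival_ok (Ival A HA D p pb tb pc tc px pj M E pt tt pz)" using I(1) Ie by simp
  have aa: "\<bar>20000 * a - A\<bar> \<le> HA" using a by (simp add: in_ival_def Ie)
  have uu: "\<bar>20000 * u - V\<bar> \<le> HV" using u by (simp add: in_cell_def Ce)
  have dd: "20000 * d \<le> D" "D - 2 / 100 \<le> 20000 * d" "D \<noteq> 0" using d D by (auto simp: ival_depth_def Ie)
  note r = ival_rate_le(2-6)[OF ok au(1)] and r1 = ival_rate_le(1)[OF ok au(1), of u d]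
  have c: "in_table p1" "in_table p2" "in_table p3" "0 \<le> F"
     "exp_hi p1 \<le> M1 * 1000000000000" "2 * exp_hi p2 \<le> M2 * 1000000000000" "F * 1000000000000 \<le> exp_lo p3"
    using I(2) by (auto simp: Ie Ce)
  have kd: "0 \<le> 1 - a - d" using au by simp
  note s = cell_rate_le[OF c au(1,2) kd]
  have "cubic_ok (ival_const pc tc) (ival_theta pt tt) (ival_slope pb tb pc tc px pj M E) (177375 * M * E)
       (- (hundredths p1 + 100) * 1000000000000000 + M1 * 100000000000
          + M2 * (100000000 - F * (100 - hundredths p3)) * 1000)
       (177375 * M2 * F) ((hundredths p2 - hundredths p1) * 1000000000000000) A HA D V HV"
    using I(2) by (simp add: Ie Ce)
  from cubic_ok_sound[OF this _ _ _ aa uu dd(1,2) au(1-3)]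
  have cub: "cubic (ival_const pc tc) (ival_theta pt tt) (ival_slope pb tb pc tc px pj M E) (real_of_int (177375 * M * E))
       (real_of_int (- (hundredths p1 + 100) * 1000000000000000 + M1 * 100000000000
          + M2 * (100000000 - F * (100 - hundredths p3)) * 1000))
       (real_of_int (177375 * M2 * F)) (real_of_int ((hundredths p2 - hundredths p1) * 1000000000000000)) a u d \<le> - 5000000000000"
    using r(3-5) s(2) c(4) by simp
  let ?b = "tb / 10^6 - hundredths pb / 100" and ?c = "tc / 10^6 - hundredths pc / 100"
    and ?t = "hundredths pt / 100 + tt / 10^6" and ?l = "- (hundredths pj / 100)"
    and ?l' = "- (hundredths p1 / 100)" and ?h = "hundredths p2 / 100 - hundredths p1 / 100"
  have "10^17 * ival_rate ?b ?c ?t ?l a u d + 10^17 * cell_rate ?l' ?h a u d \<le> - 5000000000000"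
    using r1 s(1) cub unfolding cubic_def by (simp only: of_int_mult of_int_numeral)
  then have rate: "ival_rate ?b ?c ?t ?l a u d + cell_rate ?l' ?h a u d \<le> - (1/20000)" by simp
  have "real_of_int A - real_of_int HA \<le> 20000 * a" using aa by (simp add: abs_le_iff)
  from that[OF r(1) r(2)[OF dd(3) this] rate] show thesis .
qed

lemma bare_sound:
  fixes a :: real
  assumes I: "ival_ok I" "bare_ok I" and a: "in_ival I a" and au: "0 \<le> a" "a \<le> 1"
  obtains b c l where "exp (- b) + exp (- c) \<le> 1" "ival_rate b c 0 l a 0 0 \<le> - (1/20000)"
proof -
  obtain A HA D p pb tb pc tc px pj M E pt tt pz where Ie: "I = Ival A HA D p pb tb pc tc px pj M E pt tt pz" by (cases I)
  have ok: "ival_ok (Ival A HA D p pb tb pc tc px pj M E pt tt pz)" using I(1) Ie by simp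
  have aa: "\<bar>20000 * a - A\<bar> \<le> HA" using a by (simp add: in_ival_def Ie)
  note r = ival_rate_le(2-6)[OF ok au(1)] and r1 = ival_rate_le(1)[OF ok au(1), of 0 0]
  have "cubic_ok (ival_const pc tc) (ival_theta pt tt) (ival_slope pb tb pc tc px pj M E) (177375 * M * E)
       0 0 0 A HA 0 0 0"
    using I(2) by (simp add: Ie)
  from cubic_ok_sound[OF this _ _ _ aa, of 0 0]
  have "cubic (ival_const pc tc) (ival_theta pt tt) (ival_slope pb tb pc tc px pj M E) (real_of_int (177375 * M * E)) 0 0 0 a 0 0 \<le> - 5000000000000"
    using r(3-5) au by simp
  moreover have ce: "cubic cb th A1 Gx 0 0 0 a 0 0 = cb + th * 0 + A1 * a + Gx * a^3
      - 59125000000000000 * (6*(a+0)^2 - 5*(a+0)^3 + 3*a^2*0)" for cb th A1 Gx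
    by (simp add: cubic_def)
  ultimately have "10^17 * ival_rate (tb / 10^6 - hundredths pb / 100) (tc / 10^6 - hundredths pc / 100)
     (hundredths pt / 100 + tt / 10^6) (- (hundredths pj / 100)) a 0 0 \<le> - 5000000000000"
    using r1 unfolding ce by linarith
  then have "ival_rate (tb / 10^6 - hundredths pb / 100) (tc / 10^6 - hundredths pc / 100)
     (hundredths pt / 100 + tt / 10^6) (- (hundredths pj / 100)) a 0 0 \<le> - (1/20000)" by simp
  \<comment> \<open>\<open>t\<close> enters through the product with \<open>d = 0\<close>, so it can
    be replaced by 0.\<close>
  then have "ival_rate (tb / 10^6 - hundredths pb / 100) (tc / 10^6 - hundredths pc / 100)
     0 (- (hundredths pj / 100)) a 0 0 \<le> - (1/20000)"
    unfolding ival_rate_def mult_zero_left .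
  then show thesis using that r(1) by blast
qed

section \<open>The certificate\<close>

fun ival_lo :: "ival \<Rightarrow> int" where
  "ival_lo (Ival A HA D p pb tb pc tc px pj M E pt tt pz) = A - HA"

fun ival_hi :: "ival \<Rightarrow> int" where
  "ival_hi (Ival A HA D p pb tb pc tc px pj M E pt tt pz) = A + HA"

fun cells_cover :: "int \<Rightarrow> cell list \<Rightarrow> int \<Rightarrow> bool" where
  "cells_cover lo [] hi \<longleftrightarrow> hi \<le> lo"
| "cells_cover lo (Cell V HV p1 p2 p3 M1 M2 F # cs) hi \<longleftrightarrow> V - HV \<le> lo \<and> cells_cover (V + HV) cs hi"

text \<open>The cells start 2 units below the depth, since \<open>20000 * d\<close> may fall short
  of \<open>D\<close> by 2/100 and \<open>cells_cover_obtain\<close> asks for a strict inequality.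
  They end at 20000 minus the left end of the interval because \<open>a + u \<le> 1\<close>.\<close>

fun certified :: "ival \<Rightarrow> cell list \<Rightarrow> bool" where
  "certified I cs \<longleftrightarrow> ival_ok I \<and> 0 \<le> ival_depth I \<and> ival_hi I + ival_depth I \<le> 20000 \<and>
     (if ival_depth I = 0 then bare_ok I
      else cells_cover (ival_depth I - 2) cs (20000 - ival_lo I) \<and> list_all (cell_ok I) cs)"

fun ivals_cover :: "int \<Rightarrow> (ival \<times> cell list) list \<Rightarrow> bool" where
  "ivals_cover lo [] \<longleftrightarrow> 20000 \<le> lo"
| "ivals_cover lo ((I, cs) # xs) \<longleftrightarrow> ival_lo I \<le> lo \<and> ivals_cover (ival_hi I) xs"

text \<open>Up to \<open>a = 15360 / 20000\<close> the depth is positive and the range of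
  \<open>u\<close> is cut into cells. From there on depth 0 already gives a negative rate.\<close>

definition certificate :: "(ival \<times> cell list) list" where "certificate =
  [(Ival 1480 300 6031 74000 (13,0) 3691 (25,13) 6882 (25,19) (49,4) 103544350 990049 (29,0) 4143 (17,3), [Cell 9029 3000 (24,13) (20,5) (23,12) 763380 633274 618783,
 Cell 14145 2116 (20,15) (22,9) (20,13) 349938 983289 343008,Cell 17541 1280 (13,5) (23,5) (18,1) 78082 1153900 203925]),
 (Ival 2180 400 4825 109000 (14,19) 6408 (25,9) 5411 (25,18) (45,7) 47942388 980198 (29,0) 3204 (17,4), [Cell 7823 3000 (24,14) (20,11) (23,18) 771052 672434 657046,
 Cell 13081 2258 (20,19) (22,10) (20,19) 364219 993171 364218,Cell 16780 1441 (13,7) (23,5) (18,3) 79660 1153900 208045]),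
 (Ival 2980 400 4175 149000 (16,10) 3810 (25,4) 1344 (25,16) (42,5) 25790341 960789 (29,0) 2255 (17,5), [Cell 7173 3000 (24,13) (20,12) (23,18) 763380 679192 657046,
 Cell 12425 2252 (20,17) (22,11) (20,19) 357007 1003153 364218,Cell 16049 1372 (13,2) (23,6) (18,3) 75775 1165497 208045]),
 (Ival 3780 400 3658 189000 (17,14) 6009 (25,0) 9488 (25,14) (39,19) 16281021 941764 (29,0) 328 (17,7), [Cell 6656 3000 (24,13) (20,15) (23,18) 763380 699876 657046,
 Cell 11777 2121 (20,16) (22,12) (20,19) 353455 1013235 364218,Cell 15259 1361 (13,3) (23,7) (18,6) 76536 1177210 214381]),
 (Ival 4580 400 3610 229000 (18,13) 4034 (24,14) 67 (25,11) (38,2) 11245860 913931 (28,19) 7389 (17,10), [Cell 6608 3000 (24,11) (20,13) (23,14) 748264 686018 631283,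
 Cell 11460 1852 (20,11) (22,13) (20,15) 336217 1023418 349937,Cell 14566 1254 (12,17) (23,7) (18,7) 72079 1177210 216535]),
 (Ival 5280 300 2699 264000 (19,7) 1807 (24,10) 6526 (25,8) (36,15) 8584859 886920 (28,19) 4305 (17,13), [Cell 5399 2702 (24,15) (20,16) (24,2) 778801 706910 683861,
 Cell 10135 2034 (21,4) (22,13) (21,7) 382893 1023418 394553,Cell 13595 1426 (14,3) (23,7) (18,14) 93481 1177210 232236]),
 (Ival 5880 300 3135 294000 (19,18) 4176 (24,6) 8141 (25,5) (35,15) 7028688 860707 (28,19) 1127 (17,16), [Cell 5969 2836 (24,10) (20,13) (23,13) 740819 686018 625002,
 Cell 10458 1653 (20,10) (22,14) (20,17) 332872 1033703 357006,Cell 13266 1155 (13,5) (23,9) (18,13) 78082 1200992 229925]),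
 (Ival 6430 250 3248 321500 (20,7) 4758 (24,2) 7871 (25,2) (34,19) 5989453 835270 (28,18) 7880 (17,19), [Cell 5913 2667 (24,10) (20,10) (23,11) 740819 665743 612626,
 Cell 10108 1528 (20,11) (22,14) (20,17) 336217 1033703 357006,Cell 12728 1092 (13,9) (23,9) (18,16) 81269 1200992 236927]),
 (Ival 6930 250 1654 346500 (20,15) 9873 (23,18) 5413 (24,19) (34,5) 5206980 810584 (28,18) 4472 (18,2), [Cell 3578 1926 (25,2) (20,15) (24,12) 835271 699876 755783,
 Cell 7379 1875 (22,10) (22,10) (22,11) 496586 993171 501576,Cell 10636 1382 (18,5) (23,4) (20,4) 212248 1142419 313486,
 Cell 12669 651 (9,5) (23,13) (18,11) 35085 1250005 225372]),
 (Ival 7430 250 1753 371500 (21,1) 207 (23,14) 4420 (24,16) (33,13) 4618177 786627 (28,18) 960 (18,5), [Cell 3775 2024 (24,19) (20,14) (24,9) 810585 692912 733446,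
 Cell 7543 1744 (22,3) (22,12) (22,5) 463014 1013235 472366,Cell 10549 1262 (17,12) (23,6) (20,1) 186374 1165497 304221,
 Cell 12316 505 (7,5) (23,14) (18,12) 23518 1262568 227637]),
 (Ival 7930 250 2067 396500 (21,8) 5080 (23,10) 5010 (24,12) (33,1) 4095956 755783 (28,17) 7364 (18,8), [Cell 4263 2198 (24,15) (20,14) (24,2) 778801 692912 683861,
 Cell 7875 1414 (21,13) (22,14) (21,17) 418952 1033703 436049,Cell 10391 1102 (17,2) (23,8) (19,19) 168639 1189042 298197,
 Cell 11907 414 (5,8) (23,15) (18,13) 16245 1275257 229925]),
 (Ival 8380 200 1672 419000 (21,14) 9885 (23,6) 3005 (24,9) (32,12) 3743422 733446 (28,17) 2316 (18,12), [Cell 3636 1966 (24,18) (20,16) (24,7) 802519 706910 718923,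
 Cell 7063 1461 (22,2) (22,14) (22,5) 458407 1033703 472366,Cell 9606 1082 (18,0) (23,7) (20,8) 201897 1177210 326279,
 Cell 11254 566 (9,10) (23,16) (19,0) 36884 1288073 246596]),
 (Ival 8780 200 934 439000 (21,18) 3256 (23,3) 8035 (24,6) (32,4) 3455614 711770 (28,16) 8430 (18,15), [Cell 1978 1046 (25,9) (20,6) (25,3) 895835 639639 843664,
 Cell 4220 1196 (24,2) (22,7) (23,19) 683862 963818 663650,Cell 6766 1350 (21,16) (22,19) (22,7) 431711 1086702 481908,
 Cell 9194 1078 (17,18) (23,10) (20,11) 197899 1213062 336216,Cell 10846 574 (9,9) (23,17) (19,3) 36517 1301019 254106]),
 (Ival 9180 200 1033 459000 (22,3) 8706 (22,19) 4337 (24,3) (31,17) 3221993 690734 (28,16) 4349 (18,18), [Cell 2283 1252 (25,6) (20,11) (24,19) 869359 672434 810584,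
 Cell 4852 1317 (23,11) (22,10) (23,10) 612627 993171 606530,Cell 7227 1058 (21,0) (23,3) (21,18) 367880 1131051 440431,
 Cell 9175 890 (17,2) (23,12) (20,8) 168639 1237567 326279,Cell 10543 478 (8,4) (23,18) (19,5) 28439 1314094 259240]),
 (Ival 9580 200 771 479000 (22,7) 6055 (22,15) 2006 (23,19) (31,10) 3004167 663650 (28,16) 145 (19,1), [Cell 1578 809 (25,11) (20,2) (25,5) 913932 614558 860707,
 Cell 3312 925 (24,9) (22,4) (24,7) 733447 935333 718923,Cell 5451 1214 (22,14) (22,19) (23,1) 516852 1086702 554327,
 Cell 7566 901 (19,18) (23,8) (21,10) 295231 1189042 406569,Cell 9208 741 (15,13) (23,15) (20,4) 126186 1275257 313486,
 Cell 10285 336 (4,13) (23,19) (19,6) 13982 1327301 261845]),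
 (Ival 9930 150 1001 496500 (22,10) 172 (22,12) 6172 (23,16) (31,4) 2829218 644036 (28,15) 4332 (19,5), [Cell 2290 1291 (25,5) (20,16) (24,18) 860708 706910 802518,
 Cell 4837 1256 (23,5) (22,13) (23,7) 576950 1023418 588604,Cell 6958 865 (20,13) (23,6) (21,17) 343009 1165497 436049,
 Cell 8563 740 (17,1) (23,15) (20,12) 166961 1275257 339595,Cell 9762 459 (9,2) (24,0) (19,12) 34048 1340641 278037]),
 (Ival 10230 150 784 511500 (22,13) 408 (22,9) 6416 (23,14) (30,19) 2691235 631283 (28,15) 1310 (19,7), [Cell 1752 970 (25,9) (20,12) (25,3) 895835 679192 843664,
 Cell 3769 1047 (24,0) (22,11) (24,0) 670321 1003153 670320,Cell 5776 960 (21,19) (23,3) (22,13) 444859 1131051 511708,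
 Cell 7518 782 (19,2) (23,12) (21,7) 251579 1237567 394553,Cell 8881 581 (14,9) (23,18) (20,4) 99262 1314094 313486,
 Cell 9691 229 (2,7) (24,2) (19,10) 8827 1367723 272531]),
 (Ival 10530 150 719 526500 (22,16) 1504 (22,6) 7604 (23,11) (30,15) 2585710 612626 (28,14) 6680 (19,10), [Cell 1591 874 (25,10) (20,12) (25,4) 904838 679192 852143,
 Cell 3399 934 (24,3) (22,10) (24,3) 690735 993171 690734,Cell 5282 949 (22,6) (23,3) (22,18) 477114 1131051 537944,
 Cell 6937 706 (19,16) (23,11) (21,14) 289385 1225253 423162,Cell 8243 600 (16,4) (23,18) (20,13) 140859 1314094 343008,
 Cell 9232 389 (8,0) (24,3) (19,16) 27324 1381469 289384]),
 (Ival 10830 150 768 541500 (22,19) 3413 (22,3) 9796 (23,8) (30,10) 2459604 594520 (28,14) 1843 (19,13), [Cell 1776 1010 (25,7) (20,16) (25,2) 878096 706910 835270,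
 Cell 3785 999 (23,16) (22,14) (23,17) 644037 1033703 650509,Cell 5544 760 (21,16) (23,6) (22,13) 431711 1165497 511708,
 Cell 6953 649 (19,7) (23,14) (21,12) 264478 1262568 414782,Cell 8113 511 (15,13) (23,19) (20,13) 126186 1327301 343008,
 Cell 8972 348 (7,5) (24,3) (19,18) 23518 1381469 295230]),
 (Ival 11130 150 588 556500 (23,2) 6089 (21,19) 3058 (23,5) (30,6) 2363161 576949 (28,13) 6877 (19,16), [Cell 1220 634 (25,12) (20,6) (25,7) 923117 639639 878095,
 Cell 2583 729 (24,12) (22,7) (24,12) 755784 963818 755783,Cell 4200 888 (23,3) (23,2) (23,11) 565526 1119797 612626,
 Cell 5725 637 (21,3) (23,10) (22,9) 379084 1213062 491644,Cell 6945 583 (18,14) (23,16) (21,10) 232237 1288073 406569,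
 Cell 8006 478 (14,14) (24,1) (20,13) 104351 1354114 343008,Cell 8752 268 (4,15) (24,5) (20,0) 14265 1409377 301194]),
 (Ival 11430 150 627 571500 (23,5) 9491 (21,16) 7465 (23,2) (30,2) 2270500 559898 (28,13) 1690 (19,19), [Cell 1447 822 (25,9) (20,17) (25,4) 895835 714014 852143,
 Cell 3085 816 (24,3) (22,14) (24,5) 690735 1033703 704688,Cell 4597 696 (22,11) (23,6) (23,4) 501577 1165497 571209,
 Cell 5813 520 (20,14) (23,13) (22,6) 346456 1250005 477113,Cell 6824 491 (18,9) (23,19) (21,10) 220910 1327301 406569,
 Cell 7747 432 (14,13) (24,2) (20,15) 103313 1367723 349937,Cell 8450 271 (5,1) (24,6) (20,3) 15147 1423541 310366]),
 (Ival 11700 120 572 585000 (23,7) 6144 (21,13) 9477 (22,19) (29,19) 2203397 543350 (28,12) 6358 (20,2), [Cell 1297 727 (25,10) (20,16) (25,6) 904838 706910 869358,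
 Cell 2797 773 (24,6) (22,14) (24,8) 711771 1033703 726149,Cell 4257 687 (22,15) (23,6) (23,8) 522046 1165497 594520,
 Cell 5451 507 (21,0) (23,13) (22,10) 367880 1250005 496585,Cell 6441 483 (18,18) (23,19) (21,15) 241715 1327301 427414,
 Cell 7364 440 (15,9) (24,3) (21,0) 121238 1381469 367879,Cell 8112 308 (7,8) (24,7) (20,7) 24234 1437848 323033]),
 (Ival 11970 150 518 598500 (23,9) 3329 (21,9) 2548 (22,16) (29,15) 2117001 527292 (28,12) 2668 (20,4), [Cell 983 467 (25,14) (20,0) (25,9) 941765 602389 895834,
 Cell 2082 632 (24,17) (22,8) (24,16) 794534 973505 786627,Cell 3417 703 (23,11) (23,3) (23,19) 612627 1131051 663650,
 Cell 4611 491 (22,1) (23,11) (23,2) 453845 1225253 559898,Cell 5513 411 (20,11) (23,17) (22,8) 336217 1301019 486752,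
 Cell 6328 404 (18,12) (24,1) (21,15) 227638 1354114 427414,Cell 7123 391 (15,9) (24,5) (21,2) 121238 1409377 375311,
 Cell 7847 333 (7,9) (24,9) (20,9) 24478 1466894 329558]),
 (Ival 12240 120 467 612000 (23,11) 1024 (21,6) 6751 (22,14) (29,12) 2054434 516851 (28,11) 7012 (20,7), [Cell 944 479 (25,13) (20,7) (25,9) 932394 646067 895834,
 Cell 2001 578 (24,16) (22,11) (24,17) 786628 1003153 794533,Cell 3242 663 (23,12) (23,5) (24,0) 618784 1153900 670320,
 Cell 4375 470 (22,3) (23,13) (23,4) 463014 1250005 571209,Cell 5238 393 (20,14) (23,18) (22,11) 346456 1314094 501576,
 Cell 6023 392 (18,17) (24,2) (21,19) 239309 1367723 444858,Cell 6811 396 (15,16) (24,6) (21,5) 130029 1423541 386741,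
 Cell 7544 337 (8,8) (24,10) (20,13) 29600 1481637 343008]),
 (Ival 12510 150 353 625500 (23,14) 9205 (21,2) 2164 (22,11) (29,9) 1993716 501576 (28,11) 1104 (20,10), [Cell 496 145 (25,18) (17,11) (25,14) 980199 369040 941764,
 Cell 931 290 (25,12) (21,8) (25,9) 923117 797039 895834,Cell 1617 396 (25,1) (22,13) (25,1) 826960 1023418 826959,
 Cell 2574 561 (24,3) (23,5) (24,9) 690735 1153900 733446,Cell 3620 485 (22,19) (23,13) (23,14) 543351 1250005 631283,
 Cell 4465 360 (21,14) (23,17) (23,2) 423163 1301019 559898,Cell 5188 363 (20,7) (24,1) (22,11) 323034 1354114 501576,
 Cell 5898 347 (18,10) (24,4) (21,19) 223131 1395353 444858,Cell 6629 384 (15,9) (24,8) (21,7) 121238 1452299 394553,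
 Cell 7327 314 (7,2) (24,11) (20,15) 22823 1496528 349937]),
 (Ival 12810 150 306 640500 (23,16) 5507 (20,18) 3042 (22,7) (29,6) 1934793 481908 (28,10) 5017 (20,13), [Cell 419 115 (25,18) (17,5) (25,15) 980199 347548 951229,
 Cell 713 179 (25,14) (21,1) (25,12) 941765 743154 923116,Cell 1137 245 (25,7) (22,6) (25,7) 878096 954228 878095,
 Cell 1801 419 (24,16) (23,1) (24,18) 786628 1108655 802518,Cell 2731 511 (23,17) (23,10) (24,6) 650510 1213062 711770,
 Cell 3631 389 (22,14) (23,16) (23,13) 516852 1288073 625002,Cell 4336 316 (21,12) (24,0) (23,2) 414783 1340641 559898,
 Cell 4975 323 (20,7) (24,3) (22,13) 323034 1381469 511708,Cell 5611 313 (18,13) (24,6) (22,2) 229926 1423541 458406,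
 Cell 6290 366 (15,17) (24,10) (21,11) 131336 1481637 410655,Cell 6998 342 (8,2) (24,13) (20,19) 27876 1526760 364218]),
 (Ival 13110 150 268 655500 (23,18) 2358 (20,14) 5662 (22,4) (29,3) 1877611 467666 (28,9) 6541 (20,17), [Cell 372 106 (25,18) (17,10) (25,16) 980199 365368 960789,
 Cell 652 174 (25,14) (21,5) (25,12) 941765 773483 923116,Cell 1046 220 (25,8) (22,10) (25,7) 886921 993171 878095,
 Cell 1630 364 (24,17) (23,3) (25,0) 794534 1131051 818730,Cell 2434 440 (24,0) (23,11) (24,9) 670321 1225253 733446,
 Cell 3225 351 (23,1) (23,17) (23,18) 554328 1301019 657046,Cell 3846 270 (22,2) (24,0) (23,9) 458407 1340641 600495,
 Cell 4388 272 (21,3) (24,4) (23,0) 379084 1395353 548811,Cell 4955 295 (19,17) (24,6) (22,12) 292293 1423541 506616,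
 Cell 5559 309 (18,0) (24,10) (22,2) 201897 1481637 458406,Cell 6248 380 (14,7) (24,13) (21,10) 97296 1526760 406569,
 Cell 6834 206 (2,3) (24,16) (21,0) 8481 1573256 367879]),
 (Ival 13410 150 270 670500 (24,1) 9732 (20,9) 179 (22,0) (29,0) 1822119 449328 (28,8) 9930 (21,0), [Cell 422 154 (25,18) (18,19) (25,15) 980199 488287 951229,
 Cell 874 298 (25,10) (22,4) (25,9) 904838 935333 895834,Cell 1543 371 (24,18) (23,4) (25,1) 802519 1142419 826959,
 Cell 2307 393 (24,1) (23,13) (24,10) 677057 1250005 740818,Cell 2977 277 (23,4) (23,18) (24,1) 571210 1314094 677056,
 Cell 3471 217 (22,9) (24,1) (23,13) 491645 1354114 625002,Cell 3871 183 (21,16) (24,4) (23,7) 431711 1395353 588604,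
 Cell 4253 199 (21,1) (24,6) (23,1) 371577 1423541 554327,Cell 4676 224 (20,1) (24,9) (22,15) 304222 1466894 522045,
 Cell 5172 272 (18,11) (24,11) (22,7) 225373 1496528 481908,Cell 5796 352 (15,13) (24,14) (21,16) 126186 1542104 431710,
 Cell 6444 296 (7,3) (24,17) (21,5) 23053 1589068 386741]),
 (Ival 13710 150 227 685500 (24,3) 7607 (20,5) 6772 (21,17) (28,17) 1768268 436049 (28,8) 640 (21,4), [Cell 360 135 (25,18) (19,3) (25,16) 980199 508214 960789,
 Cell 768 273 (25,11) (22,8) (25,10) 913932 973505 904837,Cell 1350 309 (25,0) (23,7) (25,3) 818731 1177210 843664,
 Cell 1993 334 (24,6) (23,15) (24,14) 711771 1275257 771051,Cell 2579 252 (23,11) (24,0) (24,6) 612627 1340641 711770,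
 Cell 3021 190 (22,18) (24,2) (23,19) 537945 1367723 663650,Cell 3366 155 (22,7) (24,5) (23,14) 481909 1409377 631283,
 Cell 3681 160 (21,16) (24,7) (23,9) 431711 1437848 600495,Cell 4025 184 (21,2) (24,9) (23,4) 375312 1466894 571209,
 Cell 4425 216 (20,2) (24,10) (22,18) 307279 1481637 537944,Cell 4914 273 (18,12) (24,13) (22,10) 227638 1526760 496585,
 Cell 5543 356 (15,11) (24,17) (21,19) 123688 1589068 444858,Cell 6170 271 (6,8) (25,0) (21,8) 19842 1637462 398519]),
 (Ival 14010 150 160 700500 (24,5) 5961 (20,0) 5641 (21,13) (28,14) 1716007 418951 (28,7) 3408 (21,7), [Cell 232 74 (25,19) (18,7) (25,17) 990050 433072 970445,
 Cell 402 96 (25,16) (21,14) (25,15) 960790 846325 951229,Cell 635 137 (25,12) (22,16) (25,12) 923117 1054585 923116,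
 Cell 997 225 (25,5) (23,9) (25,7) 860708 1200992 878095,Cell 1517 295 (24,14) (23,17) (25,0) 771052 1301019 818730,
 Cell 2093 281 (24,0) (24,2) (24,12) 670321 1367723 755783,Cell 2591 217 (23,6) (24,5) (24,5) 582749 1409377 704688,
 Cell 2984 176 (22,14) (24,7) (23,19) 516852 1437848 663650,Cell 3345 185 (22,1) (24,9) (23,13) 453845 1466894 625002,
 Cell 3741 211 (21,5) (24,11) (23,7) 386742 1496528 588604,Cell 4171 219 (20,4) (24,14) (23,0) 313487 1542104 548811,
 Cell 4669 279 (18,12) (24,16) (22,12) 227638 1573256 506616,Cell 5319 371 (15,4) (24,19) (22,1) 115326 1621169 453844,
 Cell 5915 225 (4,5) (25,3) (21,11) 12907 1687330 410655]),
 (Ival 14310 150 151 715500 (24,7) 4774 (19,15) 7023 (21,9) (28,12) 1682028 402524 (28,6) 3328 (21,11), [Cell 255 106 (25,18) (19,17) (25,17) 980199 584586 970445,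
 Cell 579 218 (25,12) (22,17) (25,13) 923117 1065184 932393,Cell 1040 243 (25,3) (23,14) (25,6) 843665 1262568 869358,
 Cell 1533 250 (24,11) (24,0) (25,0) 748264 1340641 818730,Cell 1987 204 (24,0) (24,5) (24,13) 670321 1409377 763379,
 Cell 2340 149 (23,10) (24,7) (24,8) 606531 1437848 726149,Cell 2617 128 (23,1) (24,9) (24,4) 554328 1466894 697676,
 Cell 2873 128 (22,12) (24,10) (24,0) 506618 1481637 670320,Cell 3144 143 (22,2) (24,12) (23,16) 458407 1511568 644036,
 Cell 3471 184 (21,9) (24,14) (23,11) 402525 1542104 612626,Cell 3854 199 (20,10) (24,16) (23,5) 332872 1573256 576949,
 Cell 4317 264 (19,1) (24,19) (22,17) 249076 1621169 532591,Cell 4939 358 (16,0) (25,1) (22,7) 135336 1653919 481908,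
 Cell 5569 272 (6,18) (25,5) (21,16) 21928 1721416 431710]),
 (Ival 14610 150 81 730500 (24,9) 4027 (19,9) 1187 (21,5) (28,9) 1632317 386741 (28,5) 2725 (21,15), [Cell 125 46 (25,19) (19,4) (25,18) 990050 513322 980198,
 Cell 251 80 (25,17) (22,10) (25,17) 970446 993171 970445,Cell 464 133 (25,13) (23,11) (25,14) 932394 1225253 941764,
 Cell 824 227 (25,5) (24,0) (25,9) 860708 1340641 895834,Cell 1319 268 (24,13) (24,6) (25,2) 763380 1423541 835270,
 Cell 1830 243 (24,0) (24,10) (24,15) 670321 1481637 778800,Cell 2289 216 (23,6) (24,12) (24,8) 582749 1511568 726149,
 Cell 2718 213 (22,11) (24,14) (24,2) 501577 1542104 683861,Cell 3133 202 (21,14) (24,16) (23,15) 423163 1573256 637628,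
 Cell 3559 224 (20,14) (25,0) (23,8) 346456 1637462 594520,Cell 4079 296 (19,0) (25,1) (23,0) 246597 1653919 548811,
 Cell 4762 387 (15,7) (25,5) (22,8) 118838 1721416 486752,Cell 5345 196 (2,3) (25,8) (21,18) 8481 1773841 440431]),
 (Ival 14910 150 71 745500 (24,11) 3701 (19,4) 8455 (21,1) (28,7) 1599995 371576 (28,4) 1569 (21,19), [Cell 222 153 (25,17) (22,14) (25,17) 970446 1033703 970445,
 Cell 605 230 (25,9) (24,1) (25,12) 895835 1354114 923116,Cell 1082 247 (24,18) (24,9) (25,5) 802519 1466894 860707,
 Cell 1556 227 (24,5) (24,13) (24,18) 704689 1526760 802518,Cell 1980 197 (23,12) (24,15) (24,12) 618784 1557602 755783,
 Cell 2376 199 (22,19) (24,18) (24,6) 543351 1605038 711770,Cell 2777 202 (22,3) (25,0) (24,0) 463014 1637462 670320,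
 Cell 3196 217 (21,3) (25,2) (23,13) 379084 1670541 625002,Cell 3697 284 (19,12) (25,4) (23,5) 278038 1704288 576949,
 Cell 4357 376 (16,8) (25,8) (22,14) 146607 1773841 516851,Cell 4987 254 (6,11) (25,10) (22,3) 20446 1809675 463013]),
 (Ival 15210 150 55 760500 (24,13) 3780 (18,18) 9203 (20,17) (28,4) 1552708 357006 (28,2) 9873 (22,3), [Cell 268 215 (25,15) (23,13) (25,16) 951230 1250005 960789,
 Cell 734 251 (25,5) (24,11) (25,10) 860708 1496528 904837,Cell 1218 233 (24,12) (24,16) (25,3) 755784 1573256 843664,
 Cell 1662 211 (23,19) (24,19) (24,16) 663651 1621169 786627,Cell 2071 198 (23,5) (25,1) (24,10) 576950 1653919 740818,
 Cell 2450 181 (22,10) (25,3) (24,4) 496586 1687330 697676,Cell 2835 204 (21,12) (25,5) (23,18) 414783 1721416 657046,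
 Cell 3309 270 (20,4) (25,7) (23,11) 313487 1756191 612626,Cell 3946 367 (17,8) (25,11) (23,0) 179067 1827863 548811,
 Cell 4627 314 (9,3) (25,14) (22,8) 34390 1883530 486752]),
 (Ival 15640 280 0 782000 (24,16) 5901 (18,8) 3261 (20,12) (28,1) 1506818 339595 (26,0) 0 (26,0), []),
 (Ival 16240 320 0 812000 (25,0) 8256 (17,13) 1314 (20,3) (27,17) 1447735 310366 (26,0) 0 (26,0), []),
 (Ival 16880 320 0 844000 (25,4) 9603 (16,15) 7900 (19,14) (27,13) 1390969 283654 (26,0) 0 (26,0), []),
 (Ival 17520 320 0 876000 (25,7) 2390 (15,12) 7474 (19,4) (27,10) 1349859 256660 (26,0) 0 (26,0), []),
 (Ival 18200 360 0 910000 (25,11) 4311 (14,0) 7946 (18,13) (27,6) 1296931 229925 (26,0) 0 (26,0), []),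
 (Ival 19050 490 0 952500 (25,16) 8666 (10,16) 7026 (17,19) (27,2) 1246077 199887 (26,0) 0 (26,0), []),
 (Ival 19770 230 0 988500 (25,19) 1567 (3,14) 5409 (17,7) (26,19) 1209250 177284 (26,0) 0 (26,0), [])]"

lemma certificate_ok: "list_all (\<lambda>(I, cs). certified I cs) certificate"
  by code_simp

lemma certificate_cover: "ivals_cover 1200 certificate"
  by code_simp

lemma cells_cover_obtain:
  fixes u :: real
  assumes "cells_cover lo cs hi" "lo < 20000 * u" "20000 * u \<le> hi"
  obtains C where "C \<in> set cs" "in_cell C u"
proof -
  have "\<exists>C\<in>set cs. in_cell C u"
    using assms
  proof (induction lo cs hi rule: cells_cover.induct)
    case (2 lo V HV p1 p2 p3 M1 M2 F cs hi)
    show ?case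
    proof (cases "20000 * u \<le> V + HV")
      case True
      then have "in_cell (Cell V HV p1 p2 p3 M1 M2 F) u"
        using 2 by (simp add: in_cell_def abs_le_iff)
      then show ?thesis by auto
    next
      case False
      then show ?thesis using 2 by auto
    qed
  qed auto
  then show thesis using that by blast
qed

lemma ivals_cover_obtain:
  fixes a :: real
  assumes "ivals_cover lo xs" "lo < 20000 * a" "a \<le> 1"
  obtains I cs where "(I, cs) \<in> set xs" "in_ival I a"
proof -
  have "\<exists>(I, cs)\<in>set xs. in_ival I a"
    using assms
  proof (induction lo xs rule: ivals_cover.induct)
    case (2 lo I cs xs)
    obtain A HA D p pb tb pc tc px pj M E pt tt pz where I: "I = Ival A HA D p pb tb pc tc px pj M E pt tt pz" by (cases I)
    show ?case
    proof (cases "20000 * a \<le> A + HA")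
      case True
      then have "in_ival I a"
        using 2 by (simp add: in_ival_def I abs_le_iff)
      then show ?thesis by auto
    next
      case False
      then show ?thesis using 2 by (auto simp: I)
    qed
  qed auto
  then show thesis using that by blast
qed

text \<open>The slack \<open>2 / 100\<close> absorbs the rounding of \<open>D * n / 20000\<close> to an integer.\<close>

lemma rate_negative:
  fixes a :: real
  assumes a: "0.06 < a" "a \<le> 1"
  obtains D :: int where "0 \<le> D" "20000 * a + D \<le> 20000"
    and "D = 0 \<Longrightarrow> \<exists>b c l. exp (- b) + exp (- c) \<le> 1 \<and> ival_rate b c 0 l a 0 0 \<le> - (1/20000)"
    and "\<And>u d :: real. D \<noteq> 0 \<Longrightarrow> 20000 * d \<le> D \<Longrightarrow> D - 2 / 100 \<le> 20000 * d \<Longrightarrow> 0 \<le> d \<Longrightarrow> d \<le> u \<Longrightarrow> a + u \<le> 1 \<Longrightarrow>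
      \<exists>b c t l l' h. exp (- b) + exp (- c) \<le> 1 \<and> 2 \<le> exp t + exp (- (1.77375 * (1 - a^2))) \<and>
        ival_rate b c t l a u d + cell_rate l' h a u d \<le> - (1/20000)"
proof -
  obtain I cs where I: "(I, cs) \<in> set certificate" "in_ival I a"
    using ivals_cover_obtain[OF certificate_cover, of a] a by auto
  then have c: "certified I cs" using certificate_ok by (auto simp: list_all_iff)
  have lohi: "ival_lo I \<le> 20000 * a" "20000 * a \<le> ival_hi I"
    using I(2) by (cases I; simp add: in_ival_def abs_le_iff)+
  show thesis
  proof (rule that[of "ival_depth I"])
    show "0 \<le> ival_depth I" using c by simp
    have "ival_hi I + ival_depth I \<le> 20000" using c by simp
    then have "real_of_int (ival_hi I) + real_of_int (ival_depth I) \<le> 20000" by linarith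
    then show "20000 * a + ival_depth I \<le> 20000" using lohi by linarith
    show "\<exists>b c l. exp (- b) + exp (- c) \<le> 1 \<and> ival_rate b c 0 l a 0 0 \<le> - (1/20000)" if "ival_depth I = 0"
    proof -
      have "ival_ok I" "bare_ok I" using c that by auto
      moreover have "0 \<le> a" using a by simp
      ultimately obtain b c l where "exp (- b) + exp (- c) \<le> 1" "ival_rate b c 0 l a 0 0 \<le> - (1/20000)"
        using bare_sound[OF _ _ I(2) _ a(2)] by blast
      then show ?thesis by blast
    qed
    fix u d :: real
    assume D: "ival_depth I \<noteq> 0" and d: "20000 * d \<le> ival_depth I" "ival_depth I - 2 / 100 \<le> 20000 * d" "0 \<le> d"
      and u: "d \<le> u" "a + u \<le> 1"
    have cc: "cells_cover (ival_depth I - 2) cs (20000 - ival_lo I)" and ok: "ival_ok I" "list_all (cell_ok I) cs"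
      using c D by auto
    have "real_of_int (ival_depth I - 2) < 20000 * u" "20000 * u \<le> real_of_int (20000 - ival_lo I)"
      using d u lohi(1) by (simp_all add: algebra_simps)
    from cells_cover_obtain[OF cc this] obtain C where C: "C \<in> set cs" "in_cell C u" .
    have "cell_ok I C" using ok(2) C(1) unfolding list_all_iff by blast
    moreover have "0 \<le> a" "0 \<le> u" "a + d \<le> 1" using a d u by auto
    ultimately obtain b c t l l' h where "exp (- b) + exp (- c) \<le> 1" "2 \<le> exp t + exp (- (1.77375 * (1 - a^2)))"
        "ival_rate b c t l a u d + cell_rate l' h a u d \<le> - (1/20000)"
      using cell_sound[OF ok(1) _ I(2) C(2) d(1,2) D _ _ u(2)] by blast
    then show "\<exists>b c t l l' h. exp (- b) + exp (- c) \<le> 1 \<and> 2 \<le> exp t + exp (- (1.77375 * (1 - a^2))) \<and>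
        ival_rate b c t l a u d + cell_rate l' h a u d \<le> - (1/20000)"
      by blast
  qed
qed

section \<open>From frame probabilities to exponential rates\<close>

text \<open>Stirling's bound up to a factor of order \<open>sqrt m\<close>, by induction from
  \<open>((m + 1) / m) ^ (m + 1) \<ge> exp 1\<close>. Polynomial factors are harmless next to the
  exponential decay.\<close>

lemma fact_le_power:
  assumes "m \<ge> 1"
  shows "fact m \<le> exp 1 * real m * (real m / exp 1) ^ m"
  using assms
proof (induction m rule: nat_induct_at_least)
  case (Suc m)
  have m: "0 < real m" using Suc by simp
  have "1 / real (Suc m) \<le> - ln (1 - 1 / real (Suc m))"
    using ln_le_minus_one[of "1 - 1 / real (Suc m)"] m by (simp add: field_simps)
  also have "\<dots> = ln (real (Suc m) / real m)"
    using m by (simp add: ln_div field_simps)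
  finally have "1 \<le> real (Suc m) * ln (real (Suc m) / real m)"
    by (simp add: field_simps)
  then have "exp 1 \<le> exp (real (Suc m) * ln (real (Suc m) / real m))" by simp
  also have "\<dots> = (real (Suc m) / real m) ^ Suc m"
    using m by (subst exp_of_nat_mult) simp
  finally have "real m ^ Suc m * exp 1 \<le> real (Suc m) ^ Suc m"
    using m by (simp add: power_divide field_simps)
  then have "real m ^ Suc m / exp 1 ^ m \<le> real (Suc m) ^ Suc m / exp 1 ^ Suc m"
    by (simp add: field_simps)
  then have step: "real m * (real m / exp 1) ^ m \<le> (real (Suc m) / exp 1) ^ Suc m"
    by (simp add: power_divide)
  have "fact (Suc m) \<le> real (Suc m) * (exp 1 * real m * (real m / exp 1) ^ m)"
    unfolding fact_Suc of_nat_mult using Suc.IH by (intro mult_left_mono) auto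
  also have "\<dots> = exp 1 * real (Suc m) * (real m * (real m / exp 1) ^ m)" by (simp only: mult_ac)
  also have "\<dots> \<le> exp 1 * real (Suc m) * (real (Suc m) / exp 1) ^ Suc m"
    using step by (intro mult_left_mono) auto
  finally show ?case .
qed simp

lemma choose_two_real: "2 * real (j choose 2) = real j * (real j - 1)"
  by (cases j) (simp_all add: choose_two algebra_simps real_of_nat_div)

lemma choose_three_real: "6 * real (j choose 3) = real j * (real j - 1) * (real j - 2)"
proof (induction j)
  case (Suc j)
  have "Suc j choose 3 = (j choose 2) + (j choose 3)" by (simp add: numeral_3_eq_3 numeral_2_eq_2)
  then show ?case using Suc choose_two_real[of j] by (simp add: algebra_simps)
qed simp

text \<open>One term of the expansion of \<open>(exp (- b) + exp (- c)) ^ n\<close>. As a function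
  of \<open>k / n\<close>, the exponent per variable is a linear upper bound on the entropy.\<close>

lemma choose_le_exp:
  assumes bc: "exp (- b) + exp (- c) \<le> (1::real)" and k: "k \<le> n"
  shows "real (n choose k) \<le> exp (b * real k + c * real (n - k))"
proof -
  have "real (n choose k) * exp (- b) ^ k * exp (- c) ^ (n - k)
      \<le> (\<Sum>j\<le>n. real (n choose j) * exp (- b) ^ j * exp (- c) ^ (n - j))"
    using k by (intro member_le_sum) auto
  also have "\<dots> = (exp (- b) + exp (- c)) ^ n" by (simp add: binomial_ring)
  also have "\<dots> \<le> 1" using bc by (intro power_le_one) (auto simp: add_nonneg_nonneg)
  finally show ?thesis
    by (simp add: exp_of_nat_mult[symmetric] exp_add[symmetric] exp_minus field_simps)
qed

text \<open>The tangent line to \<open>ln\<close> at the point \<open>exp l\<close>.\<close>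

lemma le_exp_tangent: "z \<le> exp (l - 1 + z * exp (- l))" for z :: real
proof -
  have "z * exp (- l) \<le> exp (z * exp (- l) - 1)"
    using exp_ge_add_one_self[of "z * exp (- l) - 1"] by simp
  then have "z * exp (- l) * exp l \<le> exp (z * exp (- l) - 1) * exp l" by (intro mult_right_mono) auto
  then show ?thesis by (simp add: exp_minus exp_add[symmetric] algebra_simps)
qed

text \<open>A Chernoff bound: give each chosen element the weight \<open>exp h\<close>, complete the
  binomial sum to \<open>(q * exp h + 1) ^ j\<close>, and replace the logarithm by its tangent at
  \<open>exp l\<close>. This is the origin of \<open>cell_rate\<close>.\<close>

lemma choose_power_le_exp:
  fixes q h l :: real
  assumes q: "0 \<le> q" and r: "r \<le> j"
  shows "real (j choose r) * q ^ r \<le> exp (real j * (l - 1 + exp (- l) + q * exp (h - l)) - h * real r)"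
proof -
  have "real (j choose r) * (q * exp h) ^ r * 1 ^ (j - r) \<le> (\<Sum>i\<le>j. real (j choose i) * (q * exp h) ^ i * 1 ^ (j - i))"
    using r q by (intro member_le_sum) auto
  also have "\<dots> = (q * exp h + 1) ^ j" by (subst binomial_ring) simp
  also have "\<dots> \<le> exp (l - 1 + (q * exp h + 1) * exp (- l)) ^ j"
    using q by (intro power_mono le_exp_tangent) auto
  also have "l - 1 + (q * exp h + 1) * exp (- l) = l - 1 + exp (- l) + q * exp (h - l)"
    by (simp add: algebra_simps exp_diff exp_minus divide_inverse)
  finally have "real (j choose r) * (q * exp h) ^ r \<le> exp (real j * (l - 1 + exp (- l) + q * exp (h - l)))"
    by (simp add: exp_of_nat_mult[symmetric])
  then have "real (j choose r) * (q * exp h) ^ r * exp (- (h * real r))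
      \<le> exp (real j * (l - 1 + exp (- l) + q * exp (h - l))) * exp (- (h * real r))"
    by (intro mult_right_mono) auto
  moreover have "(q * exp h) ^ r * exp (- (h * real r)) = q ^ r"
    by (simp add: power_mult_distrib exp_of_nat_mult[symmetric] exp_minus mult.commute)
  ultimately show ?thesis
    unfolding diff_conv_add_uminus[of _ "h * real r"] exp_add mult.assoc by simp
qed

text \<open>The cost per variable of the parameter 4.73 at density \<open>x\<close>. It decreases in
  \<open>x\<close> below 4.73, so the worst case is 4.419, and the value there is the source of
  0.01046. The bound \<open>x / 4.419 - 1\<close> for \<open>ln (x / 4.419)\<close> is good enough
  because \<open>4.7 / 4.419 \<le> 1 + L\<close>.\<close>

lemma density_rate_le:
  assumes x: "4.419 \<le> x" "x \<le> (4.7::real)"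
  shows "x * (ln (x / 4.73) - 1) + 4.73 \<le> 0.01046"
proof -
  define L :: real where "L = ln (4.73 / 4.419)"
  have "exp (0.06801087 :: real) \<le> 4.73 / 4.419"
    using exp_taylor8(2)[of "0.06801087"] by (simp add: fact_numeral lessThan_nat_numeral power_divide)
  then have L: "0.06801087 \<le> L" unfolding L_def by (subst ln_ge_iff) auto
  have "ln (x / 4.73) = ln (x / 4.419) - L"
  proof -
    have "x / 4.73 = (x / 4.419) / (4.73 / 4.419)" by simp
    then show ?thesis unfolding L_def using x by (simp only: ln_div) simp
  qed
  moreover have "x * ln (x / 4.419) \<le> x * (x / 4.419 - 1)"
    using x by (intro mult_left_mono ln_le_minus_one) auto
  moreover have "x * (x / 4.419 - 1) \<le> (x - 4.419) * (1 + L)"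
  proof -
    have "x * (x / 4.419 - 1) = (x - 4.419) * (x / 4.419)" by (simp add: field_simps)
    also have "\<dots> \<le> (x - 4.419) * (1 + L)" using x L by (intro mult_left_mono) auto
    finally show ?thesis .
  qed
  moreover have "x * (ln (x / 4.419) - L - 1) = x * ln (x / 4.419) - x * (1 + L)"
    "(x - 4.419) * (1 + L) = x * (1 + L) - 4.419 * (1 + L)"
    by (simp_all add: algebra_simps)
  ultimately have "x * (ln (x / 4.73) - 1) + 4.73 \<le> 4.73 - 4.419 * (1 + L)"
    by (simp only:)
  also have "4.73 - 4.419 * (1 + L) \<le> 0.01046" using L by simp
  finally show ?thesis .
qed


text \<open>Slightly less than \<open>4.73 n\<close>, so that the clause counts cancel exactly in \<open>tilt_eq\<close>.\<close>

definition tilt :: "nat \<Rightarrow> real" where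
  "tilt n = 4.73 * (real n - 1) * (real n - 2) / real n"

text \<open>\<open>\<rho>\<close> is the ratio of \<open>tilt n\<close> to \<open>4.73 * n\<close>
  and differs from 1 by a term of order \<open>1 / n\<close>, so its \<open>m\<close>-th power costs
  a constant: \<open>m * (1 / \<rho> - 1)\<close> is at most \<open>4.7 * 20 / 3 \<le> 32\<close>.
  With \<open>exp 1\<close> from \<open>fact_le_power\<close> this makes
  \<open>exp 33\<close>.\<close>

lemma fact_tilt_le:
  assumes n: "n \<ge> 4" and m: "m \<ge> 1" "real m \<le> 4.7 * real n"
  shows "fact m / tilt n ^ m \<le> exp 33 * real m * exp (real m * (ln (real m / real n / 4.73) - 1))"
proof -
  define \<rho> where "\<rho> = (real n - 1) * (real n - 2) / (real n)^2"
  have N: "real n \<ge> 4" using n by simp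
  have p: "0 < \<rho>" using N by (simp add: \<rho>_def)
  have tp: "0 < tilt n" using N by (simp add: tilt_def)
  have tr: "tilt n = 4.73 * real n * \<rho>" using N by (simp add: tilt_def \<rho>_def power2_eq_square)
  have "real m * (1 / \<rho> - 1) \<le> 32"
  proof -
    have e: "1 / \<rho> - 1 = (3 * real n - 2) / ((real n - 1) * (real n - 2))"
    proof -
      have "(real n)^2 / P - 1 = ((real n)^2 - P) / P" if "P \<noteq> 0" for P
        using that by (simp add: diff_divide_distrib)
      moreover have "(real n - 1) * (real n - 2) \<noteq> 0" using N by auto
      ultimately have "(real n)^2 / ((real n - 1) * (real n - 2)) - 1
          = ((real n)^2 - (real n - 1) * (real n - 2)) / ((real n - 1) * (real n - 2))" by blast
      moreover have "(real n)^2 - (real n - 1) * (real n - 2) = 3 * real n - 2"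
        by (simp add: power2_eq_square algebra_simps)
      ultimately show ?thesis by (simp add: \<rho>_def)
    qed
    \<comment> \<open>The product equals
      \<open>20 * (n - 1) * (n - 2) - 3 * n * (3 * n - 2)\<close>.\<close>
    have "0 \<le> (real n - 4) * (11 * real n - 10)" using N by (intro mult_nonneg_nonneg) auto
    then have "real n * (3 * real n - 2) \<le> 20 / 3 * ((real n - 1) * (real n - 2))"
      by (simp add: algebra_simps)
    then have "real n * (1 / \<rho> - 1) \<le> 20 / 3"
      unfolding e using N by (simp add: divide_simps)
    moreover have "real m * (1 / \<rho> - 1) \<le> 4.7 * real n * (1 / \<rho> - 1)"
      using m(2) N unfolding e by (intro mult_right_mono) auto
    ultimately show ?thesis by simp
  qed
  moreover have "- ln \<rho> \<le> 1 / \<rho> - 1"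
    using ln_le_minus_one[of "1 / \<rho>"] p by (simp add: ln_div)
  then have "real m * (- ln \<rho>) \<le> real m * (1 / \<rho> - 1)" by (intro mult_left_mono) auto
  ultimately have corr: "real m * (- ln \<rho>) \<le> 32" by linarith
  have "fact m / tilt n ^ m \<le> exp 1 * real m * (real m / exp 1) ^ m / tilt n ^ m"
    using fact_le_power[OF m(1)] tp by (intro divide_right_mono) auto
  also have "\<dots> = exp 1 * real m * (real m / exp 1 / tilt n) ^ m"
    by (simp add: power_divide power_mult_distrib)
  also have "real m / exp 1 / tilt n = exp (ln (real m / real n / 4.73) - 1 + - ln \<rho>)"
    using m N p by (simp add: exp_add exp_diff exp_minus tr divide_simps)
  also have "\<dots> ^ m = exp (real m * (ln (real m / real n / 4.73) - 1) + real m * (- ln \<rho>))"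
    by (simp only: exp_of_nat_mult[symmetric] distrib_left)
  also have "exp 1 * real m * \<dots> \<le> exp 1 * real m * exp (real m * (ln (real m / real n / 4.73) - 1) + 32)"
    using corr by (intro mult_left_mono) auto
  also have "\<dots> = (exp 1 * exp 32) * real m * exp (real m * (ln (real m / real n / 4.73) - 1))"
    by (simp only: exp_add mult_ac)
  also have "exp 1 * exp (32 :: real) = exp 33" by (simp add: exp_add[symmetric])
  finally show ?thesis .
qed

lemma tilt_eq:
  assumes "n \<ge> 4"
  shows "tilt n * (real x / (8 * real (n choose 3))) = 4.73 * (3 / 4) * real x / (real n)^2"
proof -
  have N: "real n \<ge> 4" using assms by simp
  have C: "8 * real (n choose 3) = 4 / 3 * (real n * (real n - 1) * (real n - 2))"
    using choose_three_real[of n] by simp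
  have "4.73 * p * q / N * (y / (4 / 3 * (N * p * q))) = 4.73 * (3 / 4) * y / N^2"
    if "p \<noteq> 0" "q \<noteq> 0" "N \<noteq> 0" for p q N y :: real
    using that by (simp add: field_simps power2_eq_square)
  from this[of "real n - 1" "real n - 2" "real n" "real x"] show ?thesis
    unfolding tilt_def C using N by simp
qed

lemma self_factor_le:
  assumes n: "n \<ge> 4"
  shows "self_factor n (tilt n) k \<le> 1 - exp (- (1.77375 * (real k / real n)^2))" "0 \<le> self_factor n (tilt n) k"
proof -
  have "2 * real (k - 1 choose 2) \<le> (real k)^2"
    unfolding choose_two_real by (cases k) (simp_all add: power2_eq_square algebra_simps)
  then have "4.73 * (3 / 4) * real (k - 1 choose 2) / (real n)^2 \<le> 1.77375 * (real k)^2 / (real n)^2"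
    by (intro divide_right_mono) auto
  then show "self_factor n (tilt n) k \<le> 1 - exp (- (1.77375 * (real k / real n)^2))"
    unfolding self_factor_def tilt_eq[OF n] power_divide by simp
  show "0 \<le> self_factor n (tilt n) k" unfolding self_factor_def tilt_eq[OF n] by simp
qed

lemma outer_factor_le:
  assumes n: "n \<ge> 4" and kj: "k \<le> j"
  shows "outer_factor n (tilt n) k j \<le> 1 - exp (- (1.77375 * ((real j / real n)^2 - (real k / real n)^2)))"
    "0 \<le> outer_factor n (tilt n) k j"
proof -
  have "2 * real ((j - 1 choose 2) - (k choose 2)) \<le> (real j)^2 - (real k)^2"
  \<comment> \<open>The difference of natural numbers may be cut off at 0, for instance when
    \<open>j = k\<close>; then \<open>k \<le> j\<close> is enough.\<close>
  proof (cases "(k choose 2) \<le> (j - 1 choose 2)")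
    case True
    then have "2 * real ((j - 1 choose 2) - (k choose 2)) = 2 * real (j - 1 choose 2) - 2 * real (k choose 2)"
      by (simp add: of_nat_diff)
    also have "\<dots> \<le> (real j)^2 - (real k)^2"
      unfolding choose_two_real using kj by (cases j) (simp_all add: power2_eq_square algebra_simps)
    finally show ?thesis .
  next
    case False
    then show ?thesis using kj by (simp add: power_mono)
  qed
  then have "4.73 * (3 / 4) * real ((j - 1 choose 2) - (k choose 2)) / (real n)^2 \<le> 1.77375 * ((real j)^2 - (real k)^2) / (real n)^2"
    by (intro divide_right_mono) auto
  then show "outer_factor n (tilt n) k j \<le> 1 - exp (- (1.77375 * ((real j / real n)^2 - (real k / real n)^2)))"
    unfolding outer_factor_def tilt_eq[OF n] power_divide diff_divide_distrib[symmetric] by simp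
  show "0 \<le> outer_factor n (tilt n) k j" unfolding outer_factor_def tilt_eq[OF n] by simp
qed

text \<open>The cubic is the leading part of the count. The error \<open>12 * n^2\<close> is a
  constant in the exponent once it is divided by the number of clauses and multiplied by
  \<open>tilt n\<close>.\<close>

lemma bad_count_ge:
  assumes "k + c \<le> n"
  shows "6 * (real k + real c)^2 * real n - 5 * (real k + real c)^3 + 3 * (real k)^2 * real c - 12 * (real n)^2
    \<le> 6 * real (bad_count n k c)"
proof -
  define j where "j = k + c"
  have le: "real k \<le> real j" "real j \<le> real n" "real c = real j - real k" using assms by (auto simp: j_def)
  have "6 * real (bad_count n k c) = 6 * real (j choose 3) + 3 * (2 * real (k choose 2)) * real c
      + 6 * (real n - real j) * (2 * real (j choose 2))"
  proof -
    have "n - k - c = n - j" by (simp add: j_def)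
    then have "real (n - k - c) = real n - real j" using le(2) by (simp add: of_nat_diff)
    then show ?thesis by (simp add: bad_count_def j_def[symmetric])
  qed
  also have "\<dots> = real j * (real j - 1) * (real j - 2) + 3 * (real k * (real k - 1)) * real c
      + 6 * (real n - real j) * (real j * (real j - 1))"
    by (simp only: choose_two_real choose_three_real)
  also have "\<dots> = 6 * (real j)^2 * real n - 5 * (real j)^3 + 3 * (real k)^2 * real c
      - (3 * (real j)^2 - 2 * real j + 3 * real k * real c + 6 * (real n - real j) * real j)"
    by (simp add: power2_eq_square power3_eq_cube algebra_simps)
  finally have e: "6 * real (bad_count n k c) = \<dots>" .
  have "real j * real j \<le> real n * real n" "real k * real c \<le> real n * real n" "(real n - real j) * real j \<le> real n * real n"
    using le by (intro mult_mono; simp)+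
  then have "3 * (real j)^2 - 2 * real j + 3 * real k * real c + 6 * (real n - real j) * real j \<le> 12 * (real n)^2"
    unfolding power2_eq_square mult.assoc by linarith
  then show ?thesis using e by (simp add: j_def)
qed


text \<open>\<open>exp 41\<close> collects 33 from \<open>fact_tilt_le\<close> and
  \<open>7.095 = 4.73 * (3 / 4) * 2\<close> from the lower-order terms of
  \<open>bad_count\<close>.\<close>

lemma frame_weight_le:
  assumes n: "n \<ge> 4" and m: "m \<ge> 1" "4.419 * real n \<le> real m" "real m \<le> 4.7 * real n"
    and kc: "k + c \<le> n"
  defines "a \<equiv> real k / real n" and "u \<equiv> real c / real n"
  shows "fact m / tilt n ^ m * exp (tilt n * (1 - real (bad_count n k c) / (8 * real (n choose 3))))
    \<le> exp 41 * real m * exp (real n * (0.01046 - 0.59125 * (6*(a+u)^2 - 5*(a+u)^3 + 3*a^2*u)))"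
proof -
  have N: "real n \<ge> 4" using n by simp
  have tn: "tilt n \<le> 4.73 * real n"
    using N by (simp add: tilt_def field_simps)
  define b where "b = 6*(a+u)^2 - 5*(a+u)^3 + 3*a^2*u"
  have "real n ^ 3 * b = 6 * (real k + real c)^2 * real n - 5 * (real k + real c)^3 + 3 * (real k)^2 * real c"
    using N by (simp add: b_def a_def u_def add_divide_distrib[symmetric] power_divide field_simps power2_eq_square power3_eq_cube)
  then have "(real n ^ 3 * b - 12 * real n ^ 2) / (6 * real n ^ 2) \<le> 6 * real (bad_count n k c) / (6 * real n ^ 2)"
    using bad_count_ge[OF kc] by (intro divide_right_mono) auto
  then have "real n * b / 6 - 2 \<le> real (bad_count n k c) / real n ^ 2"
    using N by (simp add: diff_divide_distrib power2_eq_square power3_eq_cube)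
  then have "tilt n * (real (bad_count n k c) / (8 * real (n choose 3))) \<ge> 4.73 * (3 / 4) * (real n * b / 6 - 2)"
    unfolding tilt_eq[OF n] times_divide_eq_right[symmetric] by (intro mult_left_mono) simp_all
  moreover have "tilt n * (1 - z) = tilt n - tilt n * z" for z by (simp add: right_diff_distrib)
  moreover have "x - y \<le> w - z" if "z \<le> y" "x \<le> w" for x y z w :: real using that by simp
  ultimately have "tilt n * (1 - real (bad_count n k c) / (8 * real (n choose 3))) \<le> 4.73 * real n - 4.73 * (3 / 4) * (real n * b / 6 - 2)"
    using tn by (simp only:)
  also have "\<dots> = real n * (4.73 - 0.59125 * b) + 7.095" by (simp add: field_simps)
  finally have 1: "tilt n * (1 - real (bad_count n k c) / (8 * real (n choose 3))) \<le> real n * (4.73 - 0.59125 * b) + 7.095" .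
  define x where "x = real m / real n"
  have x: "4.419 \<le> x" "x \<le> 4.7" using m N by (simp_all add: x_def field_simps)
  have mx: "real m = real n * x" using N by (simp add: x_def)
  have "fact m / tilt n ^ m * exp (tilt n * (1 - real (bad_count n k c) / (8 * real (n choose 3))))
      \<le> (exp 33 * real m * exp (real m * (ln (x / 4.73) - 1))) * exp (real n * (4.73 - 0.59125 * b) + 7.095)"
    using fact_tilt_le[OF n m(1,3)] 1 unfolding x_def by (intro mult_mono) auto
  also have "\<dots> = (exp 33 * exp 7.095) * real m * exp (real n * (x * (ln (x / 4.73) - 1) + 4.73 - 0.59125 * b))"
  proof -
    have "exp (real m * z) * exp (real n * w + v) = exp v * exp (real n * (x * z + w))" for z w v
      unfolding mx by (simp add: exp_add[symmetric] algebra_simps)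
    from this[of "ln (x / 4.73) - 1" "4.73 - 0.59125 * b" "7.095"] show ?thesis
      by (simp only: mult.assoc add_diff_eq) (simp only: mult_ac)
  qed
  also have "\<dots> \<le> exp 41 * real m * exp (real n * (0.01046 - 0.59125 * b))"
  proof (intro mult_mono)
    show "exp 33 * exp 7.095 \<le> exp (41::real)" by (simp add: exp_add[symmetric])
    show "exp (real n * (x * (ln (x / 4.73) - 1) + 4.73 - 0.59125 * b)) \<le> exp (real n * (0.01046 - 0.59125 * b))"
      using density_rate_le[OF x] by (simp add: mult_left_mono)
  qed auto
  finally show ?thesis by (simp add: b_def)
qed

text \<open>All factors except the choice of \<open>R\<close>, its values and its witnesses go into
  \<open>ival_rate\<close>. What is left equals 1 for \<open>r = 0\<close>, so the lemma serves
  depth 0 as well.\<close>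

lemma frame_sum_bare_part:
  assumes n: "n \<ge> 4" and m: "m \<ge> 1" "4.419 * real n \<le> real m" "real m \<le> 4.7 * real n"
    and kc: "k + D + r \<le> n"
  defines "a \<equiv> real k / real n" and "d \<equiv> real D / real n" and "u \<equiv> real (D + r) / real n"
  assumes bc: "exp (- b) + exp (- c) \<le> 1" and t: "D = 0 \<or> 2 \<le> exp t + exp (- (1.77375 * (1 - a^2)))"
  shows "frame_sum n m (tilt n) k D r \<le> exp 41 * real m * exp (real n * ival_rate b c t l a u d)
     * (real (n - k - D choose r) * (2 * outer_factor n (tilt n) k (k + (D + r))) ^ r)"
proof -
  have N: "real n \<ge> 4" using n by simp
  have ka: "real k = real n * a" "real D = real n * d" using N by (simp_all add: a_def d_def)
  have nn: "real n / real n = 1" using N by simp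
  have o: "0 \<le> outer_factor n (tilt n) k (k + (D + r))" "0 \<le> outer_factor n (tilt n) k n" "0 \<le> self_factor n (tilt n) k"
    using outer_factor_le(2)[OF n] self_factor_le(2)[OF n] kc by auto
  have 1: "real (n choose k) \<le> exp (real n * (b * a + c * (1 - a)))"
  proof -
    have "real (n - k) = real n * (1 - a)" using kc N ka(1) by (simp add: of_nat_diff algebra_simps)
    then show ?thesis using choose_le_exp[OF bc, of k n] kc by (simp add: ka(1) algebra_simps)
  qed
  have 2: "(2::real) ^ k = exp (real n * (a * ln 2))"
    by (metis exp_ln exp_of_nat_mult ka(1) mult.assoc zero_less_numeral)
  have 3: "(1 + outer_factor n (tilt n) k n) ^ D \<le> exp (real n * (d * t))"
  proof (cases "D = 0")
    case False
    have "1 + outer_factor n (tilt n) k n \<le> exp t"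
      using outer_factor_le(1)[OF n, of k n] t False kc nn by (simp add: a_def)
    then have "(1 + outer_factor n (tilt n) k n) ^ D \<le> exp t ^ D" using o by (intro power_mono) auto
    then show ?thesis by (simp add: exp_of_nat_mult[symmetric] ka(2) mult_ac)
  qed (simp add: d_def)
  have 4: "self_factor n (tilt n) k ^ k \<le> exp (real n * (a * (l - 1 + exp (- l) * (1 - exp (- (1.77375 * a^2))))))"
  proof -
    have "self_factor n (tilt n) k \<le> exp (l - 1 + (1 - exp (- (1.77375 * a^2))) * exp (- l))"
      by (rule order.trans[OF _ le_exp_tangent]) (use self_factor_le(1)[OF n, of k] in \<open>simp add: a_def\<close>)
    then have "self_factor n (tilt n) k ^ k \<le> exp (l - 1 + (1 - exp (- (1.77375 * a^2))) * exp (- l)) ^ k"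
      using o by (intro power_mono) auto
    then show ?thesis by (simp add: exp_of_nat_mult[symmetric] ka(1) mult_ac)
  qed
  have 5: "fact m / tilt n ^ m * exp (tilt n * (1 - real (bad_count n k (D + r)) / (8 * real (n choose 3))))
    \<le> exp 41 * real m * exp (real n * (0.01046 - 0.59125 * (6*(a+u)^2 - 5*(a+u)^3 + 3*a^2*u)))"
    using frame_weight_le[OF n m, of k "D + r"] kc by (simp add: a_def u_def)
  define W where "W = fact m / tilt n ^ m * exp (tilt n * (1 - real (bad_count n k (D + r)) / (8 * real (n choose 3))))"
  have W0: "0 \<le> W" using N by (simp add: W_def tilt_def)
  define P where "P = real (n - k - D choose r) * (2 * outer_factor n (tilt n) k (k + (D + r))) ^ r"
  have P0: "0 \<le> P" using o by (simp add: P_def)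
  have "frame_sum n m (tilt n) k D r = real (n choose k) * 2 ^ k * (1 + outer_factor n (tilt n) k n) ^ D * W * self_factor n (tilt n) k ^ k * P"
    by (simp add: frame_sum_def W_def P_def power_mult_distrib mult_ac)
  also have "\<dots> \<le> exp (real n * (b * a + c * (1 - a))) * exp (real n * (a * ln 2)) * exp (real n * (d * t))
      * (exp 41 * real m * exp (real n * (0.01046 - 0.59125 * (6*(a+u)^2 - 5*(a+u)^3 + 3*a^2*u))))
      * exp (real n * (a * (l - 1 + exp (- l) * (1 - exp (- (1.77375 * a^2)))))) * P"
    using 1 2 3 4 5[folded W_def] o W0 P0
    by (intro mult_right_mono mult_mono) auto
  also have "\<dots> = exp 41 * real m * exp (real n * ival_rate b c t l a u d) * P"
    unfolding ival_rate_def by (simp add: exp_add[symmetric] distrib_left mult_ac add_ac right_diff_distrib)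
  finally show ?thesis by (simp add: P_def)
qed

lemma frame_sum_le:
  assumes n: "n \<ge> 4" and m: "m \<ge> 1" "4.419 * real n \<le> real m" "real m \<le> 4.7 * real n"
    and kc: "k + D + r \<le> n"
  defines "a \<equiv> real k / real n" and "d \<equiv> real D / real n" and "u \<equiv> real (D + r) / real n"
  assumes bc: "exp (- b) + exp (- c) \<le> 1" and t: "2 \<le> exp t + exp (- (1.77375 * (1 - a^2)))"
    and rate: "ival_rate b c t l a u d + cell_rate l' h a u d \<le> - \<epsilon>"
  shows "frame_sum n m (tilt n) k D r \<le> exp 41 * real m * exp (- \<epsilon> * real n)"
proof -
  have N: "real n \<ge> 4" using n by simp
  define y where "y = 1 - exp (- (1.77375 * (2*a*u + u^2)))"
  have au: "0 \<le> a" "0 \<le> u" by (simp_all add: a_def u_def)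
  have o: "0 \<le> outer_factor n (tilt n) k (k + (D + r))" "outer_factor n (tilt n) k (k + (D + r)) \<le> y"
  proof -
    have "(real (k + (D + r)) / real n)^2 - (real k / real n)^2 = 2*a*u + u^2"
      by (simp add: a_def u_def add_divide_distrib power2_eq_square algebra_simps)
    then show "outer_factor n (tilt n) k (k + (D + r)) \<le> y"
      using outer_factor_le(1)[OF n, of k "k + (D + r)"] by (simp only: y_def le_add1)
  qed (use outer_factor_le(2)[OF n] in simp)
  then have y: "0 \<le> y" by linarith
  have "real (n - k - D choose r) * (2 * outer_factor n (tilt n) k (k + (D + r))) ^ r \<le> real (n - k - D choose r) * (2 * y) ^ r"
    using o by (intro mult_left_mono power_mono) auto
  also have "\<dots> \<le> exp (real (n - k - D) * (l' - 1 + exp (- l') + 2 * y * exp (h - l')) - h * real r)"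
    using y kc by (intro choose_power_le_exp) auto
  also have "real (n - k - D) = real n * (1 - a - d)"
    using kc N by (simp add: a_def d_def of_nat_diff field_simps)
  also have "real r = real n * (u - d)"
    using N by (simp add: u_def d_def field_simps)
  also have "real n * (1 - a - d) * (l' - 1 + exp (- l') + 2 * y * exp (h - l')) - h * (real n * (u - d)) = real n * cell_rate l' h a u d"
    by (simp add: cell_rate_def y_def algebra_simps)
  finally have X: "real (n - k - D choose r) * (2 * outer_factor n (tilt n) k (k + (D + r))) ^ r \<le> exp (real n * cell_rate l' h a u d)" .
  have "frame_sum n m (tilt n) k D r \<le> exp 41 * real m * exp (real n * ival_rate b c t l a u d)
     * (real (n - k - D choose r) * (2 * outer_factor n (tilt n) k (k + (D + r))) ^ r)"
    using frame_sum_bare_part[OF n m kc bc] t by (simp add: a_def d_def u_def)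
  also have "\<dots> \<le> exp 41 * real m * exp (real n * ival_rate b c t l a u d) * exp (real n * cell_rate l' h a u d)"
    using X by (intro mult_left_mono) auto
  also have "\<dots> = exp 41 * real m * exp (real n * (ival_rate b c t l a u d + cell_rate l' h a u d))"
    by (simp add: exp_add[symmetric] distrib_left)
  also have "\<dots> \<le> exp 41 * real m * exp (- \<epsilon> * real n)"
    using mult_left_mono[OF rate, of "real n"] by (intro mult_left_mono) (auto simp: mult.commute)
  finally show ?thesis .
qed

lemma frame_sum_bare_le:
  assumes n: "n \<ge> 4" and m: "m \<ge> 1" "4.419 * real n \<le> real m" "real m \<le> 4.7 * real n"
    and k: "k \<le> n"
  defines "a \<equiv> real k / real n"
  assumes bc: "exp (- b) + exp (- c) \<le> 1" and rate: "ival_rate b c 0 l a 0 0 \<le> - \<epsilon>"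
  shows "frame_sum n m (tilt n) k 0 0 \<le> exp 41 * real m * exp (- \<epsilon> * real n)"
proof -
  have "frame_sum n m (tilt n) k 0 0 \<le> exp 41 * real m * exp (real n * ival_rate b c 0 l a 0 0)"
    using frame_sum_bare_part[OF n m, of k 0 0 b c 0 l] k bc by (simp add: a_def)
  also have "\<dots> \<le> exp 41 * real m * exp (- \<epsilon> * real n)"
    using mult_left_mono[OF rate, of "real n"] by (intro mult_left_mono) (auto simp: mult.commute)
  finally show ?thesis .
qed

section \<open>Sublinear covers and dense formulas\<close>

text \<open>Replaces the rates for small \<open>k\<close>, down to constant size. The Poisson
  parameter is \<open>m\<close>, which costs a polynomial factor instead of 0.01046 per variable.
  The bound is of order \<open>n * (9.6 * k / n) ^ k\<close>, where 9.6 bounds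
  \<open>exp 1 * 2 * 1.7625\<close> and \<open>1.7625 = 4.7 * 3 / 8\<close>. For
  \<open>k \<ge> 3\<close> this is of order \<open>1 / n^2\<close>, small enough to be summed over
  all sizes.\<close>

lemma frame_sum_small:
  assumes k: "1 \<le> k" "real k \<le> 0.06 * real n" and m: "1 \<le> m" "real m \<le> 4.7 * real n"
  shows "frame_sum n m (real m) k 0 0 \<le> 100000000 / (real n)^2"
proof -
  have N: "real n \<ge> 16" using k by simp
  have kn: "k < n" using k(2) N by simp
  define W where "W = fact m / real m ^ m * exp (real m * (1 - real (bad_count n k 0) / (8 * real (n choose 3))))"
  have frame_eq: "frame_sum n m (real m) k 0 0 = real (n choose k) * 2 ^ k * W * self_factor n (real m) k ^ k"
    by (simp add: frame_sum_def W_def)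
  show ?thesis
  proof (cases "k < 3")
    case True
    \<comment> \<open>Fewer than three variables leave no room for a witness clause.\<close>
    then have "k - 1 choose 2 = 0" by (intro binomial_eq_0) simp
    then have "self_factor n (real m) k = 0" by (simp only: self_factor_def) simp
    then show ?thesis using k(1) by (simp add: frame_eq power_0_left)
  next
    case False
    have K: "real k \<ge> 3" using False by simp
    have F: "W \<le> exp 1 * real m" "0 \<le> W"
    proof -
      have "fact m / real m ^ m \<le> exp 1 * real m * (real m / exp 1) ^ m / real m ^ m"
        using fact_le_power[OF m(1)] by (intro divide_right_mono) auto
      also have "\<dots> = exp 1 * real m * exp (- real m)"
        using m(1) exp_of_nat_mult[of m "1::real"] by (simp add: power_divide exp_minus field_simps)
      finally have "fact m / real m ^ m \<le> exp 1 * real m * exp (- real m)" .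
      moreover have "real m * (1 - real (bad_count n k 0) / (8 * real (n choose 3))) \<le> real m"
        by (simp add: mult_left_le)
      ultimately have "fact m / real m ^ m * exp (real m * (1 - real (bad_count n k 0) / (8 * real (n choose 3))))
          \<le> exp 1 * real m * exp (- real m) * exp (real m)"
        by (intro mult_mono) auto
      then show "W \<le> exp 1 * real m" unfolding W_def mult.assoc exp_add[symmetric] by simp
      show "0 \<le> W" by (simp add: W_def)
    qed
    have S: "self_factor n (real m) k \<le> 1.7625 * (real k / real n)^2" "0 \<le> self_factor n (real m) k"
    proof -
      let ?x = "real m * (real (k - 1 choose 2) / (8 * real (n choose 3)))"
      have x: "self_factor n (real m) k \<le> ?x"
        unfolding self_factor_def using exp_ge_add_one_self[of "- ?x"] by linarith
      have k2: "real (k - 1 choose 2) = (real k - 1) * (real k - 2) / 2"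
        using choose_two_real[of "k - 1"] False by (simp add: of_nat_diff)
      have n3: "8 * real (n choose 3) = 4 / 3 * (real n * (real n - 1) * (real n - 2))"
        using choose_three_real[of n] by simp
      have "?x = real m * (3 / 8) * ((real k - 1) * (real k - 2)) / (real n * ((real n - 1) * (real n - 2)))"
        unfolding k2 n3 by (simp add: mult.assoc)
      also have "\<dots> \<le> 4.7 * real n * (3 / 8) * ((real k - 1) * (real k - 2)) / (real n * ((real n - 1) * (real n - 2)))"
        using m(2) K N by (intro divide_right_mono mult_right_mono) auto
      also have "\<dots> = 1.7625 * (((real k - 1) / (real n - 1)) * ((real k - 2) / (real n - 2)))"
        using N by simp
      also have "\<dots> \<le> 1.7625 * ((real k / real n) * (real k / real n))"
        using kn K by (intro mult_left_mono mult_mono) (auto simp: field_simps)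
      finally show "self_factor n (real m) k \<le> 1.7625 * (real k / real n)^2" using x by (simp add: power2_eq_square)
      show "0 \<le> self_factor n (real m) k" by (simp add: self_factor_def)
    qed
    have C: "real (n choose k) \<le> (exp 1 * (real n / real k)) ^ k"
    proof -
      define x where "x = real k / real n"
      have x: "0 < x" "x < 1" using K kn by (simp_all add: x_def)
      have "real (n choose k) \<le> exp (- ln x * real k + - ln (1 - x) * real (n - k))"
        using x kn by (intro choose_le_exp) auto
      also have "- ln (1 - x) * real (n - k) \<le> real k"
      proof -
        have "- ln (1 - x) \<le> 1 / (1 - x) - 1"
          using ln_le_minus_one[of "1 / (1 - x)"] x by (simp add: ln_div)
        then have "- ln (1 - x) * real (n - k) \<le> (1 / (1 - x) - 1) * real (n - k)"
          by (intro mult_right_mono) auto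
        also have "\<dots> = (1 / (1 - x) - 1) * (real n * (1 - x))" using kn by (simp add: x_def of_nat_diff right_diff_distrib)
        also have "\<dots> = real n * x" using x by (simp add: field_simps)
        also have "\<dots> = real k" using kn by (simp add: x_def)
        finally show ?thesis .
      qed
      then have "exp (- ln x * real k + - ln (1 - x) * real (n - k)) \<le> exp (real k * (1 - ln x))"
        by (simp add: algebra_simps)
      also have "\<dots> = exp (1 - ln x) ^ k" by (simp add: exp_of_nat_mult)
      also have "exp (1 - ln x) = exp 1 * (real n / real k)"
        using x K N by (simp add: exp_diff x_def field_simps)
      finally show ?thesis .
    qed
    define z where "z = 9.6 * real k / real n"
    have z: "0 \<le> z" "z \<le> 0.576" using k N by (simp_all add: z_def field_simps)
    have "frame_sum n m (real m) k 0 0 \<le> (exp 1 * (real n / real k)) ^ k * 2 ^ k * (exp 1 * real m) * (1.7625 * (real k / real n)^2) ^ k"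
      unfolding frame_eq using F C S m(1) by (intro mult_mono power_mono mult_nonneg_nonneg) auto
    also have "\<dots> = exp 1 * real m * (exp 1 * 3.525 * (real k / real n)) ^ k"
    proof -
      have "(e * (1 / y)) ^ k * 2 ^ k * M * (1.7625 * y^2) ^ k = M * (e * 3.525 * y) ^ k" if "y \<noteq> 0" for e y M :: real
      proof -
        have "(e * (1 / y)) ^ k * 2 ^ k * (1.7625 * y^2) ^ k = (e * (1 / y) * 2 * (1.7625 * y^2)) ^ k"
          by (simp only: power_mult_distrib)
        also have "e * (1 / y) * 2 * (1.7625 * y^2) = e * 3.525 * y" using that by (simp add: power2_eq_square)
        finally show ?thesis by (simp only: mult_ac)
      qed
      from this[of "real k / real n" "exp 1" "exp 1 * real m"] show ?thesis using K N by simp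
    qed
    also have "\<dots> \<le> exp 1 * real m * z ^ k"
    proof -
      have "exp (1::real) \<le> 2.7234"
        using exp_taylor8(2)[of 1] by (simp add: fact_numeral lessThan_nat_numeral)
      then have "exp 1 * 3.525 * (real k / real n) \<le> 2.7234 * 3.525 * (real k / real n)" by (intro mult_right_mono) auto
      also have "\<dots> \<le> 9.6 * (real k / real n)" by (intro mult_right_mono) auto
      finally have "exp 1 * 3.525 * (real k / real n) \<le> z" by (simp add: z_def)
      then show ?thesis by (intro mult_left_mono power_mono) auto
    qed
    also have "\<dots> \<le> 3 * (4.7 * real n) * (5300 * (9.6 / real n) ^ 3)"
    proof (intro mult_mono)
      show "exp 1 \<le> (3::real)" by (rule exp_le)
      \<comment> \<open>Three factors \<open>z\<close> are kept to obtain \<open>1 / n^3\<close>;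
        their \<open>k ^ 3\<close> is absorbed by the other factors, because
        \<open>exp 0.3 \<le> 1.39\<close>, \<open>z \<le> 9.6 * 0.06 = 0.576\<close> and
        \<open>1.39 * 0.576 < 1\<close>.\<close>
      have "real k \<le> 10 * exp (real k / 10)" using exp_ge_add_one_self[of "real k / 10"] by linarith
      then have "real k ^ 3 \<le> (10 * exp (real k / 10)) ^ 3" by (intro power_mono) auto
      also have "\<dots> = 1000 * exp (3 / 10) ^ k"
        by (simp add: power_mult_distrib exp_of_nat_mult[symmetric] mult_ac)
      finally have "real k ^ 3 \<le> 1000 * exp (3 / 10) ^ k" .
      moreover have "exp (3 / 10 :: real) \<le> 1.39" using exp_bound[of "3 / 10 :: real"] by (simp add: power2_eq_square)
      then have "exp (3 / 10 :: real) ^ k \<le> 1.39 ^ k" by (intro power_mono) auto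
      ultimately have k3: "real k ^ 3 \<le> 1000 * 1.39 ^ k" by linarith
      have "z ^ k = z ^ 3 * z ^ (k - 3)" using False by (simp add: power_add[symmetric])
      also have "\<dots> \<le> z ^ 3 * 0.576 ^ (k - 3)" using z by (intro mult_left_mono power_mono) auto
      also have "\<dots> = (9.6 / real n) ^ 3 * (real k ^ 3 * 0.576 ^ (k - 3))"
        by (simp add: z_def power_divide power_mult_distrib)
      also have "real k ^ 3 * 0.576 ^ (k - 3) \<le> 1000 * 1.39 ^ k * 0.576 ^ (k - 3)"
        using k3 by (intro mult_right_mono) auto
      also have "1000 * 1.39 ^ k * 0.576 ^ (k - 3) = (1000 :: real) * 1.39 ^ 3 * (1.39 * 0.576) ^ (k - 3)"
      proof -
        have "(1.39 :: real) ^ k = 1.39 ^ 3 * 1.39 ^ (k - 3)" using False by (simp add: power_add[symmetric])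
        then show ?thesis by (simp only: power_mult_distrib mult.assoc)
      qed
      also have "(1.39 * 0.576 :: real) ^ (k - 3) \<le> 1" by (intro power_le_one) auto
      finally have "z ^ k \<le> (9.6 / real n) ^ 3 * (1000 * 1.39 ^ 3 * 1)" by (simp add: mult_left_mono)
      also have "\<dots> \<le> (9.6 / real n) ^ 3 * 5300"
        by (intro mult_left_mono) (auto simp: power3_eq_cube)
      finally show "z ^ k \<le> 5300 * (9.6 / real n) ^ 3" by (simp add: mult_ac)
    qed (use m z in auto)
    also have "\<dots> \<le> 100000000 / (real n)^2"
      using N by (simp add: power_divide field_simps power2_eq_square power3_eq_cube)
    finally show ?thesis .
  qed
qed

text \<open>The rate of solutions in which every false variable has a witness, with Poisson
  parameter \<open>1.1 * m\<close>: \<open>0.4125 = 1.1 * 3 / 8\<close>, and 7/8 is the proportion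
  of clauses true under a fixed assignment. It is just negative at \<open>x = 4.7\<close>, and the
  bound used here decreases in \<open>x\<close>, since
  \<open>1.1 * 7 / 8 + 0.05 < 1.0953\<close>.\<close>

lemma sat_rate_le:
  assumes x: "4.7 \<le> (x::real)"
  shows "- x * (1 + ln 1.1) + 1.1 * x * (7 / 8) + ln (2 - exp (- (0.4125 * x))) \<le> - 0.004"
proof -
  define s where "s = x - 4.7"
  have s: "0 \<le> s" using x by (simp add: s_def)
  define E where "E = exp (- 1.93875 :: real)"
  \<comment> \<open>Half of \<open>1.93875 = 0.4125 * 4.7\<close>; halving brings the exponent into
    the range of the Taylor bound.\<close>
  have "0.3793 \<le> exp (- 0.969375 :: real)"
    using exp_taylor8(1)[of "- 0.969375"] by (simp add: fact_numeral lessThan_nat_numeral power_divide)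
  then have "0.3793 * 0.3793 \<le> exp (- 0.969375 :: real) * exp (- 0.969375)" by (intro mult_mono) auto
  then have E: "0.1438 \<le> E" by (simp add: E_def exp_add[symmetric])
  have E1: "E \<le> 0.2"
  proof -
    have "exp (- 0.969375 :: real) \<le> 0.4"
      using exp_taylor8(2)[of "- 0.969375"] by (simp add: fact_numeral lessThan_nat_numeral power_divide)
    then have "exp (- 0.969375 :: real) * exp (- 0.969375) \<le> 0.4 * 0.4" by (intro mult_mono) auto
    then show ?thesis by (simp add: E_def exp_add[symmetric])
  qed
  have "exp (- (0.4125 * x)) = E * exp (- (0.4125 * s))"
    by (simp add: E_def s_def exp_add[symmetric] field_simps)
  moreover have "1 - 0.4125 * s \<le> exp (- (0.4125 * s))" using exp_ge_add_one_self[of "- (0.4125 * s)"] by simp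
  then have "E * (1 - 0.4125 * s) \<le> E * exp (- (0.4125 * s))" using E by (intro mult_left_mono) auto
  ultimately have "2 - exp (- (0.4125 * x)) \<le> 2 - E + 0.4125 * E * s" by (simp add: algebra_simps)
  also have "\<dots> \<le> 1.8562 + 0.0825 * s"
    using E mult_right_mono[OF E1 s] by simp
  also have "\<dots> \<le> 1.8562 * (1 + 0.05 * s)" using s by simp
  also have "\<dots> \<le> exp 0.62 * exp (0.05 * s)"
  proof (intro mult_mono)
    show "1.8562 \<le> exp (0.62 :: real)"
      using exp_taylor8(1)[of "0.62"] by (simp add: fact_numeral lessThan_nat_numeral power_divide)
    show "1 + 0.05 * s \<le> exp (0.05 * s)" by (rule exp_ge_add_one_self)
  qed (use s in auto)
  also have "\<dots> = exp (0.62 + 0.05 * s)" by (simp add: exp_add)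
  finally have "2 - exp (- (0.4125 * x)) \<le> exp (0.62 + 0.05 * s)" .
  moreover have "exp (- (0.4125 * x)) \<le> 1" using x by simp
  then have "0 < 2 - exp (- (0.4125 * x))" by linarith
  ultimately have "ln (2 - exp (- (0.4125 * x))) \<le> ln (exp (0.62 + 0.05 * s))"
    using ln_le_cancel_iff[of "2 - exp (- (0.4125 * x))" "exp (0.62 + 0.05 * s)"] exp_gt_zero by blast
  then have 1: "ln (2 - exp (- (0.4125 * x))) \<le> 0.62 + 0.05 * s" by (simp only: ln_exp)
  have "exp (0.0953 :: real) \<le> 1.1"
    using exp_taylor8(2)[of "0.0953"] by (simp add: fact_numeral lessThan_nat_numeral power_divide)
  then have "0.0953 \<le> ln (1.1 :: real)" by (subst ln_ge_iff) auto
  then have "x * (1.0953) \<le> x * (1 + ln 1.1)" using x by (intro mult_left_mono) auto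
  moreover have "- y + 1.1 * x * (7 / 8) + v \<le> - 0.004"
    if "x * 1.0953 \<le> y" "v \<le> 0.62 + 0.05 * (x - 4.7)" for y v
    using that x by (simp add: field_simps)
  ultimately show ?thesis using 1 unfolding s_def minus_mult_left[symmetric] by blast
qed

text \<open>With \<open>A = {}\<close> and all variables in \<open>T\<close>, the forbidden clauses
  are those with three false literals, one eighth of all, and only false variables need
  witnesses.\<close>

lemma frame_sum_sat:
  assumes n: "n \<ge> 3" and m: "4.7 * real n \<le> real m"
  shows "frame_sum n m (1.1 * real m) 0 n 0 \<le> exp 1 * real m * exp (- 0.004 * real n)"
proof -
  have N: "real n \<ge> 3" using n by simp
  have m1: "m \<ge> 1" using m N by (cases m) auto
  define x where "x = real m / real n"
  have x: "4.7 \<le> x" using m N by (simp add: x_def field_simps)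
  have mx: "real m = real n * x" using N by (simp add: x_def)
  have C3: "8 * real (n choose 3) = 4 / 3 * (real n * (real n - 1) * (real n - 2))"
    using choose_three_real[of n] by simp
  have C2: "real (n - 1 choose 2) = (real n - 1) * (real n - 2) / 2"
    using choose_two_real[of "n - 1"] n by (simp add: of_nat_diff)
  have "1.1 * real m * (real (n - 1 choose 2) / (8 * real (n choose 3))) = 0.4125 * x"
  proof -
    have "1.1 * (N * x) * (p * q / 2 / (4 / 3 * (N * p * q))) = 0.4125 * x" if "N \<noteq> 0" "p \<noteq> 0" "q \<noteq> 0" for N p q :: real
      using that by (simp add: field_simps)
    from this[of "real n" "real n - 1" "real n - 2"] show ?thesis
      unfolding C3 C2 mx using N by simp
  qed
  then have O: "1 + outer_factor n (1.1 * real m) 0 n = 2 - exp (- (0.4125 * x))"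
    by (simp add: outer_factor_def binomial_eq_0)
  have "real (n choose 3) > 0" using n by (simp add: zero_less_binomial_iff)
  then have B: "1 - real (bad_count n 0 n) / (8 * real (n choose 3)) = 7 / 8"
    by (simp add: bad_count_def)
  have "frame_sum n m (1.1 * real m) 0 n 0 = (2 - exp (- (0.4125 * x))) ^ n * (fact m / (1.1 * real m) ^ m * exp (1.1 * real m * (7 / 8)))"
    unfolding frame_sum_def by (simp only: O B add_0 add_0_right diff_zero diff_self_eq_0 binomial_n_0 power_0 of_nat_1 mult_1_left mult_1_right)
  also have "\<dots> \<le> exp (ln (2 - exp (- (0.4125 * x)))) ^ n * (exp 1 * real m * exp (- real m * (1 + ln 1.1)) * exp (1.1 * real m * (7 / 8)))"
  proof (intro mult_mono)
    have "exp (- (0.4125 * x)) \<le> 1" using x by simp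
    then have "0 < 2 - exp (- (0.4125 * x))" by linarith
    then show "(2 - exp (- (0.4125 * x))) ^ n \<le> exp (ln (2 - exp (- (0.4125 * x)))) ^ n" by simp
    have "fact m / (1.1 * real m) ^ m \<le> exp 1 * real m * (real m / exp 1) ^ m / (1.1 * real m) ^ m"
      using fact_le_power[OF m1] by (intro divide_right_mono) auto
    also have "\<dots> = exp 1 * real m * (real m / exp 1 / (1.1 * real m)) ^ m"
      by (simp add: power_divide power_mult_distrib)
    also have "real m / exp 1 / (1.1 * real m) = exp (- (1 + ln 1.1))"
      using m1 by (simp add: exp_add exp_minus exp_diff divide_simps)
    also have "\<dots> ^ m = exp (- real m * (1 + ln 1.1))" by (simp add: exp_of_nat_mult[symmetric] algebra_simps)
    finally show "fact m / (1.1 * real m) ^ m \<le> exp 1 * real m * exp (- real m * (1 + ln 1.1))" .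
  qed auto
  also have "\<dots> = exp 1 * real m * exp (real n * (- x * (1 + ln 1.1) + 1.1 * x * (7 / 8) + ln (2 - exp (- (0.4125 * x)))))"
  proof -
    have "exp p ^ n * (M * exp (- real m * q) * exp (1.1 * real m * (7 / 8))) = M * exp (real n * (- x * q + 1.1 * x * (7 / 8) + p))" for p q M
      unfolding mx by (simp add: exp_of_nat_mult[symmetric] exp_add[symmetric] algebra_simps)
    then show ?thesis .
  qed
  also have "\<dots> \<le> exp 1 * real m * exp (- 0.004 * real n)"
    using mult_left_mono[OF sat_rate_le[OF x], of "real n"] by (intro mult_left_mono) (auto simp: mult.commute)
  finally show ?thesis .
qed

section \<open>The limit\<close>

lemma prob_cover_small:
  assumes k: "1 \<le> k" "real k \<le> 0.06 * real n" and m: "1 \<le> m" "real m \<le> 4.7 * real n"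
    and X: "finite X" "card X = n"
  shows "measure_pmf.prob (replicate_pmf m (pmf_of_set (clauses3 X))) {F. \<exists>A g. A \<subseteq> X \<and> card A = k \<and> cover F A g}
    \<le> 100000000 / (real n)^2"
proof -
  have "real n \<ge> 16" using k by simp
  then have "n \<ge> 3" "k \<le> n" using k(2) by simp_all
  then have "measure_pmf.prob (replicate_pmf m (pmf_of_set (clauses3 X))) {F. \<exists>A g. A \<subseteq> X \<and> card A = k \<and> cover F A g}
      \<le> frame_sum n m (real m) k 0 0"
    using prob_cover_le[OF X, of "real m" k 0 m] m by simp
  also have "\<dots> \<le> 100000000 / (real n)^2" by (rule frame_sum_small[OF k m])
  finally show ?thesis .
qed

lemma prob_cover_large:
  assumes n: "n \<ge> 1000000" and k: "0.06 * real n < real k" "k \<le> n"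
    and m: "1 \<le> m" "4.419 * real n \<le> real m" "real m \<le> 4.7 * real n"
    and X: "finite X" "card X = n"
  shows "measure_pmf.prob (replicate_pmf m (pmf_of_set (clauses3 X))) {F. \<exists>A g. A \<subseteq> X \<and> card A = k \<and> cover F A g}
    \<le> (real n + 1) * (exp 41 * real m * exp (- (1 / 20000) * real n))"
proof -
  have n4: "n \<ge> 4" using n by simp
  have N: "real n \<ge> 1000000" using n by simp
  define B where "B = exp 41 * real m * exp (- (1 / 20000) * real n)"
  have B0: "0 \<le> B" by (simp add: B_def)
  define a where "a = real k / real n"
  have a: "0.06 < a" "a \<le> 1" using k N by (simp_all add: a_def field_simps)
  obtain D :: int where D: "0 \<le> D" "20000 * a + D \<le> 20000"
    and bare: "D = 0 \<Longrightarrow> \<exists>b c l. exp (- b) + exp (- c) \<le> 1 \<and> ival_rate b c 0 l a 0 0 \<le> - (1/20000)"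
    and full: "\<And>u d :: real. D \<noteq> 0 \<Longrightarrow> 20000 * d \<le> D \<Longrightarrow> D - 2 / 100 \<le> 20000 * d \<Longrightarrow> 0 \<le> d \<Longrightarrow> d \<le> u \<Longrightarrow> a + u \<le> 1 \<Longrightarrow>
      \<exists>b c t l l' h. exp (- b) + exp (- c) \<le> 1 \<and> 2 \<le> exp t + exp (- (1.77375 * (1 - a^2))) \<and>
        ival_rate b c t l a u d + cell_rate l' h a u d \<le> - (1/20000)"
    using rate_negative[OF a] by metis
  define T where "T = nat \<lfloor>real_of_int D * real n / 20000\<rfloor>"
  have T: "real T \<le> real_of_int D * real n / 20000" "real_of_int D * real n / 20000 - 1 < real T"
  proof -
    define v where "v = real_of_int D * real n / 20000"
    have "0 \<le> v" using D(1) by (simp add: v_def)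
    then have "real T = real_of_int \<lfloor>v\<rfloor>" by (simp add: T_def v_def of_nat_nat)
    then have "real T \<le> v" "v - 1 < real T" by linarith+
    then show "real T \<le> real_of_int D * real n / 20000" "real_of_int D * real n / 20000 - 1 < real T"
      by (simp_all add: v_def)
  qed
  have tilt_pos: "0 < tilt n" using N by (simp add: tilt_def)
  have "20000 * real k + real_of_int D * real n \<le> 20000 * real n"
    using D(2) N mult_right_mono[OF D(2), of "real n"] by (simp add: a_def algebra_simps)
  then have "real k + real T \<le> real n" using T(1) by linarith
  then have kT: "k + T \<le> n" by linarith
  have term_le: "frame_sum n m (tilt n) k T r \<le> B" if r: "r \<in> (if T = 0 then {0} else {..n - k - T})" for r
  proof (cases "D = 0")
    case True
    then have "T = 0" by (simp add: T_def)
    obtain b c l where "exp (- b) + exp (- c) \<le> 1" "ival_rate b c 0 l a 0 0 \<le> - (1/20000)"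
      using bare[OF True] by blast
    then show ?thesis
      using frame_sum_bare_le[OF n4 m k(2), of b c l "1/20000"] r \<open>T = 0\<close> by (simp add: a_def B_def)
  next
    case False
    have kTr: "k + T + r \<le> n" using kT r by (auto split: if_splits)
    define d where "d = real T / real n"
    define u where "u = real (T + r) / real n"
    have d: "20000 * d \<le> D" using T(1) N by (simp add: d_def field_simps)
    \<comment> \<open>Rounding loses less than one variable, which is 20000 in these units, and
      \<open>n \<ge> 1000000\<close> makes this at most \<open>2 / 100 * n\<close>.\<close>
    have "real_of_int D * real n - 2 / 100 * real n \<le> 20000 * real T" using T(2) N by linarith
    then have "D - 2 / 100 \<le> 20000 * d" using N by (simp add: d_def field_simps)
    moreover have "0 \<le> d" "d \<le> u" by (simp_all add: d_def u_def divide_right_mono)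
    moreover have "a + u \<le> 1"
    proof -
      have "real k + real (T + r) \<le> real n" using kTr by linarith
      then show ?thesis using N by (simp add: a_def u_def add_divide_distrib[symmetric])
    qed
    ultimately obtain b c t l l' h where r: "exp (- b) + exp (- c) \<le> 1" "2 \<le> exp t + exp (- (1.77375 * (1 - a^2)))"
        "ival_rate b c t l a u d + cell_rate l' h a u d \<le> - (1/20000)"
      using full[OF False d] by blast
    show ?thesis
      using frame_sum_le[OF n4 m kTr r(1) r(2)[unfolded a_def] r(3)[unfolded a_def d_def u_def]] by (simp add: B_def)
  qed
  have "measure_pmf.prob (replicate_pmf m (pmf_of_set (clauses3 X))) {F. \<exists>A g. A \<subseteq> X \<and> card A = k \<and> cover F A g}
      \<le> (\<Sum>r\<in>(if T = 0 then {0} else {..n - k - T}). frame_sum n m (tilt n) k T r)"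
    using n4 by (intro prob_cover_le[OF X _ tilt_pos kT]) simp
  also have "\<dots> \<le> (\<Sum>r\<in>(if T = 0 then {0} else {..n - k - T}). B)" using term_le by (rule sum_mono)
  also have "\<dots> = real (card (if T = 0 then {0} else {..n - k - T})) * B" by simp
  also have "\<dots> \<le> (real n + 1) * B" using B0 by (intro mult_right_mono) auto
  finally show ?thesis by (simp add: B_def)
qed

lemma clauses3_support:
  assumes "finite X" "card X \<ge> 3" "F \<in> set_pmf (replicate_pmf m (pmf_of_set (clauses3 X)))"
  shows "set F \<subseteq> clauses3 X"
proof -
  have "card (clauses3 X) > 0" using assms by (simp add: card_clauses3 zero_less_binomial_iff)
  then have "clauses3 X \<noteq> {}" by auto
  then show ?thesis using assms(3) finite_clauses3[OF assms(1)] by (auto simp: set_replicate_pmf lists_eq_set)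
qed

lemma prob_core_le_sum:
  assumes X: "finite X" "card X = n" "n \<ge> 3"
  shows "measure_pmf.prob (replicate_pmf m (pmf_of_set (clauses3 X))) {F. \<exists>\<sigma>. nontrivial_core X F \<sigma>}
    \<le> (\<Sum>k=1..n. measure_pmf.prob (replicate_pmf m (pmf_of_set (clauses3 X))) {F. \<exists>A g. A \<subseteq> X \<and> card A = k \<and> cover F A g})"
proof -
  let ?P = "replicate_pmf m (pmf_of_set (clauses3 X))" and ?E = "\<lambda>k. {F. \<exists>A g. A \<subseteq> X \<and> card A = k \<and> cover F A g}"
  have "measure_pmf.prob ?P {F. \<exists>\<sigma>. nontrivial_core X F \<sigma>} \<le> measure_pmf.prob ?P (\<Union>k\<in>{1..n}. ?E k)"
  proof (rule prob_mono_on_support)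
    fix F assume F: "F \<in> set_pmf ?P" and "F \<in> {F. \<exists>\<sigma>. nontrivial_core X F \<sigma>}"
    then obtain \<sigma> where "nontrivial_core X F \<sigma>" by blast
    moreover have "set F \<subseteq> clauses3 X" using F X by (intro clauses3_support) auto
    ultimately obtain A g where A: "A \<noteq> {}" "A \<subseteq> X" "cover F A g" by (rule core_cover)
    have "finite A" using A(2) X(1) by (rule finite_subset)
    then have "card A \<in> {1..n}" using A X card_mono[OF X(1) A(2)] by (simp add: Suc_le_eq card_gt_0_iff)
    then show "F \<in> (\<Union>k\<in>{1..n}. ?E k)" using A by blast
  qed
  also have "\<dots> \<le> (\<Sum>k=1..n. measure_pmf.prob ?P (?E k))"
    by (rule measure_pmf.finite_measure_subadditive_finite) auto
  finally show ?thesis .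
qed

lemma prob_core_le:
  assumes n: "n \<ge> 1000000" and m: "4.419 * real n \<le> real m" "real m \<le> 4.7 * real n"
    and X: "finite X" "card X = n"
  shows "measure_pmf.prob (replicate_pmf m (pmf_of_set (clauses3 X))) {F. \<exists>\<sigma>. nontrivial_core X F \<sigma>}
    \<le> real n * (100000000 / (real n)^2 + (real n + 1) * (exp 41 * (4.7 * real n) * exp (- (1 / 20000) * real n)))"
proof -
  let ?P = "replicate_pmf m (pmf_of_set (clauses3 X))" and ?E = "\<lambda>k. {F. \<exists>A g. A \<subseteq> X \<and> card A = k \<and> cover F A g}"
  have m1: "1 \<le> m" using m n by (cases m) auto
  define B where "B = (real n + 1) * (exp 41 * (4.7 * real n) * exp (- (1 / 20000) * real n))"
  have B0: "0 \<le> B" by (simp add: B_def)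
  have "measure_pmf.prob ?P (?E k) \<le> 100000000 / (real n)^2 + B" if "k \<in> {1..n}" for k
  proof (cases "real k \<le> 0.06 * real n")
    case True
    then show ?thesis using prob_cover_small[OF _ True m1 m(2) X] that B0 by simp
  next
    case False
    have "measure_pmf.prob ?P (?E k) \<le> (real n + 1) * (exp 41 * real m * exp (- (1 / 20000) * real n))"
      using that False by (intro prob_cover_large[OF n _ _ m1 m X]) auto
    also have "\<dots> \<le> B" unfolding B_def using m(2) by (intro mult_left_mono mult_right_mono) auto
    also have "\<dots> \<le> 100000000 / (real n)^2 + B" by simp
    finally show ?thesis .
  qed
  then have "(\<Sum>k=1..n. measure_pmf.prob ?P (?E k)) \<le> (\<Sum>k=1..n. 100000000 / (real n)^2 + B)" by (rule sum_mono)
  also have "\<dots> = real n * (100000000 / (real n)^2 + B)" by simp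
  finally show ?thesis using prob_core_le_sum[OF X, of m] n by (simp add: B_def)
qed

text \<open>Every core comes from a solution, and a solution is a cover of the empty set because
  clauses have three literals. So it is enough to exclude solutions, whatever the size of the
  core.\<close>

lemma prob_core_le_dense:
  assumes n: "n \<ge> 3" and m: "4.7 * real n \<le> real m" and X: "finite X" "card X = n"
  shows "measure_pmf.prob (replicate_pmf m (pmf_of_set (clauses3 X))) {F. \<exists>\<sigma>. nontrivial_core X F \<sigma>}
    \<le> exp 1 * real m * exp (- 0.004 * real n)"
proof -
  let ?P = "replicate_pmf m (pmf_of_set (clauses3 X))"
  have mu: "1.1 * real m > 0" using m n by simp
  have "measure_pmf.prob ?P {F. \<exists>\<sigma>. nontrivial_core X F \<sigma>} \<le> measure_pmf.prob ?P {F. \<exists>A g. A \<subseteq> X \<and> card A = 0 \<and> cover F A g}"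
  proof (rule prob_mono_on_support)
    fix F assume F: "F \<in> set_pmf ?P" and "F \<in> {F. \<exists>\<sigma>. nontrivial_core X F \<sigma>}"
    then obtain \<sigma> where "nontrivial_core X F \<sigma>" by blast
    moreover have F3: "set F \<subseteq> clauses3 X" using F X n by (intro clauses3_support) auto
    ultimately obtain A g where "cover F A g" by (rule core_cover)
    moreover have "card C = 3" if "C \<in> set F" for C using F3 that by (auto simp: clauses3_def)
    ultimately have "cover F {} g" by (auto simp: cover_def)
    then show "F \<in> {F. \<exists>A g. A \<subseteq> X \<and> card A = 0 \<and> cover F A g}" by (auto intro!: exI[of _ "{}"])
  qed
  also have "\<dots> \<le> (\<Sum>r\<in>(if n = 0 then {0} else {..n - 0 - n}). frame_sum n m (1.1 * real m) 0 n r)"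
    by (rule prob_cover_le[OF X n mu]) simp
  also have "\<dots> = frame_sum n m (1.1 * real m) 0 n 0" using n by simp
  also have "\<dots> \<le> exp 1 * real m * exp (- 0.004 * real n)" by (rule frame_sum_sat[OF n m])
  finally show ?thesis .
qed

theorem theorem19:
  fixes \<alpha> :: real
  assumes "\<alpha> > 4.419"
  shows "(\<lambda>n. measure_pmf.prob (random_3sat n (nat \<lfloor>\<alpha> * real n\<rfloor>))
                {F. \<exists>\<sigma>. nontrivial_core {..<n} F \<sigma>}) \<longlonglongrightarrow> 0"
proof -
  define p where "p n = measure_pmf.prob (random_3sat n (nat \<lfloor>\<alpha> * real n\<rfloor>)) {F. \<exists>\<sigma>. nontrivial_core {..<n} F \<sigma>}" for n
  have m: "real (nat \<lfloor>\<alpha> * real n\<rfloor>) \<le> \<alpha> * real n" "\<alpha> * real n - 1 \<le> real (nat \<lfloor>\<alpha> * real n\<rfloor>)" for n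
  proof -
    have "0 \<le> \<alpha> * real n" using assms by simp
    then have "real (nat \<lfloor>\<alpha> * real n\<rfloor>) = real_of_int \<lfloor>\<alpha> * real n\<rfloor>" by (simp add: of_nat_nat)
    then show "real (nat \<lfloor>\<alpha> * real n\<rfloor>) \<le> \<alpha> * real n" "\<alpha> * real n - 1 \<le> real (nat \<lfloor>\<alpha> * real n\<rfloor>)" by linarith+
  qed
  \<comment> \<open>The floor costs at most 1, which \<open>(\<alpha> - \<beta>) * n\<close>
    eventually reaches; this uses that the inequality is strict.\<close>
  have dense: "\<forall>\<^sub>F n in sequentially. \<beta> * real n \<le> real (nat \<lfloor>\<alpha> * real n\<rfloor>)" if "\<beta> < \<alpha>" for \<beta>
  proof -
    have "\<forall>\<^sub>F n in sequentially. 1 / (\<alpha> - \<beta>) \<le> real n" by real_asymp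
    then show ?thesis
    proof eventually_elim
      case (elim n)
      then have "1 \<le> (\<alpha> - \<beta>) * real n" using that by (simp add: field_simps)
      then show ?case using m(2)[of n] by (simp add: algebra_simps)
    qed
  qed
  have pos: "\<forall>\<^sub>F n in sequentially. 0 \<le> p n" by (simp add: p_def)
  show ?thesis
  proof (cases "\<alpha> \<le> 4.7")
    case True
    have "\<forall>\<^sub>F n in sequentially. p n \<le> real n * (100000000 / (real n)^2 + (real n + 1) * (exp 41 * (4.7 * real n) * exp (- (1 / 20000) * real n)))"
      using dense[OF assms] eventually_ge_at_top[of "1000000 :: nat"]
    proof eventually_elim
      case (elim n)
      have "\<alpha> * real n \<le> 4.7 * real n" using True by (intro mult_right_mono) auto
      then have "real (nat \<lfloor>\<alpha> * real n\<rfloor>) \<le> 4.7 * real n" using m(1)[of n] by linarith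
      from prob_core_le[OF elim(2,1) this, of "{..<n}"] show ?case by (simp add: p_def random_3sat_def)
    qed
    moreover have "(\<lambda>n. real n * (100000000 / (real n)^2 + (real n + 1) * (exp 41 * (4.7 * real n) * exp (- (1 / 20000) * real n)))) \<longlonglongrightarrow> 0"
      by real_asymp
    ultimately have "p \<longlonglongrightarrow> 0" by (rule tendsto_sandwich[OF pos _ tendsto_const])
    then show ?thesis by (simp add: p_def[abs_def])
  next
    case False
    then have "4.7 < \<alpha>" by simp
    have "\<forall>\<^sub>F n in sequentially. p n \<le> exp 1 * (\<alpha> * real n) * exp (- 0.004 * real n)"
      using dense[OF \<open>4.7 < \<alpha>\<close>] eventually_ge_at_top[of "3 :: nat"]
    proof eventually_elim
      case (elim n)
      have "p n \<le> exp 1 * real (nat \<lfloor>\<alpha> * real n\<rfloor>) * exp (- 0.004 * real n)"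
        using prob_core_le_dense[OF elim(2,1), of "{..<n}"] by (simp add: p_def random_3sat_def)
      also have "\<dots> \<le> exp 1 * (\<alpha> * real n) * exp (- 0.004 * real n)"
        using m(1)[of n] by (intro mult_right_mono mult_left_mono) auto
      finally show ?case .
    qed
    moreover have "(\<lambda>n. exp 1 * (\<alpha> * real n) * exp (- 0.004 * real n)) \<longlonglongrightarrow> 0"
      by real_asymp
    ultimately have "p \<longlonglongrightarrow> 0" by (rule tendsto_sandwich[OF pos _ tendsto_const])
    then show ?thesis by (simp add: p_def[abs_def])
  qed
qed

end
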